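(* Let $n\ge3$, $a_0,\dots,a_{n-1}\in\mathbb{C}$, $a_n=1$, $r_0,\dots,r_{n-1}\in\mathcal{AP}(\mathbb{R},\mathbb{C})$, $r_n\equiv0$, and consider $$(E)\qquad y^{(n)}(t)+\sum_{i=0}^{n-1}(a_i+r_i(t))\,y^{(i)}(t)=0,\qquad t\in\mathbb{R}.$$ Let $\lambda_1,\dots,\lambda_n$ be the $n$ roots of $P(a;x)=x^n+\sum_{i=0}^{n-1}a_ix^i$, assume $\Re\lambda_i\ne\Re\lambda_j$ for $i\ne j$, and let $V=(\lambda_k^{\,i-1})_{1\le i,k\le n}$ (row index $i$, column index $k$) be the Vandermonde matrix of $\lambda_1,\dots,\lambda_n$. With the notation of the context, assume that $L_0^{\lambda_k}<1$ for every $k=1,\dots,n$, and that for every $k=1,\dots,n$ there is a constant $M_k\in\big(0,\min_{1\le l\le n}\delta_{\lambda_l}\big)$ such that $$H_{\lambda_k}\le\big[1-L_0^{\lambda_k}-m(M_k)Q_0^{\lambda_k}\big]M_k ,$$ and $$\max_{k}\bigg(M_k\big(m(M_k)+1\big)\sum_{i=2}^n\big[(|\lambda_k|+1)^{i-1}-|\lambda_k|^{i-1}\big]\bigg)\,\|V^{-1}\|_1<1 .$$ Then there exists a fundamental system of solutions $y_1,\dots,y_n$ of $(E)$ on $\mathbb{R}$ such that for $k=1,\dots,n$ $$\begin{aligned}y_k(t)=\ &e^{\lambda_kt}\exp\bigg(-\sum_{j=1}^{n-1}\frac1{\Gamma_{kj}\gamma_{kj}}G_{\gamma_{kj}}\big[P(r;\lambda_k)+\mathcal{L}_k(\cdot,z_k)+\mathcal{F}_k(\cdot,Z_k)\big](t)\bigg)\\&\times\exp\bigg((-1)^n\prod_{j\ne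 k}(\lambda_j-\lambda_k)^{-1}\int_0^t\big[P(r(s);\lambda_k)+\mathcal{L}_k(s,z_k(s))+\mathcal{F}_k(s,Z_k(s))\big]ds\bigg),\end{aligned}$$ where, for each $k$, $Z_k=(z_k,z_k',\dots,z_k^{(n-2)})$, $z_k\in\mathcal{AP}^{n-2}(\mathbb{R})$, and $z_k$ satisfies both the differential equation $$\mathcal{D}_kz+P(r;\lambda_k)+\mathcal{L}_k(t,z)+\mathcal{F}_k(t,z,\dots,z^{(n-2)})=0$$ and the integral equation $$z=-G^{\lambda_k}\big[P(r;\lambda_k)+\mathcal{L}_k(\cdot,z)+\mathcal{F}_k(\cdot,Z)\big].$$
   Context: $\mathcal{AP}(\mathbb{R},\mathbb{C})$: continuous $r:\mathbb{R}\to\mathbb{C}$ such that every real sequence $\{b_k\}$ has a subsequence $\{\tilde b_m\}$ for which $\lim_{m}r(t+\tilde b_m)$ exists uniformly in $t\in\mathbb{R}$. $\mathcal{AP}^{n-2}(\mathbb{R})$: functions $z:\mathbb{R}\to\mathbb{C}$ with $z^{(i)}\in\mathcal{AP}(\mathbb{R},\mathbb{C})$ for $i=0,\dots,n-2$. $\|\cdot\|_\infty$ is the supremum norm on $\mathbb{R}$. For a matrix $B=(b_{ik})$, $\|B\|_1=\max_k\sum_i|b_{ik}|$. A fundamental system of solutions is a family of $n$ linearly independent solutions. Green operators: for $\omega\in\mathbb{C}$, $\Re\omega\ne0$, put $g_\omega(t,s)=-\mathrm{sgn}(\Re\omega)e^{\omega(t-s)}$ if $\mathrm{sgn}(\Re\omega)(t-s)<0$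 and $g_\omega(t,s)=0$ otherwise; $G_\omega[f](t)=\int_{-\infty}^\infty g_\omega(t,s)f(s)\,ds$, $I_\omega[f](t)=\int_{-\infty}^\infty|g_\omega(t,s)f(s)|\,ds$. For $c=(c_0,\dots,c_n)$, $P(c;x)=\sum_{i=0}^nc_ix^i$; $a=(a_0,\dots,a_{n-1},1)$, $r=(r_0,\dots,r_{n-1},0)$; $\frac{\partial^k}{\partial x^k}P(\cdot;\lambda)$ is the $k$-th derivative in $x$ at $x=\lambda$. For each $k\in\{1,\dots,n\}$ let $\gamma_{k1},\dots,\gamma_{k,n-1}$ be the enumeration of $\{\lambda_j-\lambda_k: j\ne k\}$ in increasing order of $j$ (i.e. $\gamma_{kj}=\lambda_j-\lambda_k$ if $j<k$ and $\gamma_{kj}=\lambda_{j+1}-\lambda_k$ if $j\ge k$); $\alpha_{kj}=\Re\gamma_{kj}$, $\tilde\alpha_{kj}=\sum_{i=0}^{n-2}|\gamma_{kj}|^i$, $\Gamma_{kj}=\prod_{l\ne j,\,1\le l\le n-1}(\gamma_{kj}-\gamma_{kl})$, and $G^{\lambda_k}[f]=\sum_{j=1}^{n-1}\frac1{\Gamma_{kj}}G_{\gamma_{kj}}[f]$. Set $\mathcal{D}_kz=\sum_{j=1}^n\frac1{j!}\frac{\partial^j}{\partial x^j}P(a;\lambda_k)z^{(j-1)}$, $P(r(t);\lambda_k)=\sum_{l=0}^{n-1}\lambda_k^lr_l(t)$, $\mathcal{L}_k(t,z)=\sum_{l=1}^{n-1}\frac1{l!}\frac{\partial^l}{\partial x^l}P(r(t);\lambda_k)z^{(l-1)}(t)$,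 $$\mathcal{F}_k(t,z,\dots,z^{(n-2)})=\sum_{i=2}^n\sum_{j=0}^{n-i}\binom{i+j}j(a_{i+j}+r_{i+j}(t))\lambda_k^jf_{i-1}(z,\dots,z^{(i-2)})$$ (with $\lambda_k^0=1$ also if $\lambda_k=0$), where $B_0=1$, $B_{i+1}(x_1,\dots,x_{i+1})=\sum_{j=0}^i\binom ijB_{i-j}(x_1,\dots,x_{i-j})x_{j+1}$ (complete Bell polynomials) and $f_i(x_1,\dots,x_i)=B_{i+1}(x_1,\dots,x_{i+1})-x_{i+1}$ (a polynomial in $x_1,\dots,x_i$ only). The function $m$: with $\|X\|=\sum_l|x_l|$ and $B(0;\delta)$ the ball of radius $\delta$ centred at $0$ in $\mathbb{C}^i$, $m_i(\delta)=\sup\{|f_i(X)-f_i(Y)|/\|X-Y\| : X\ne Y,\ X,Y\in B(0;\delta)\}$ and $m(\delta)=\max_{i=2,\dots,n}m_i(\delta)$, $m(0)=0$; it is continuous on $[0,\infty)$, positive for $\delta>0$ and tends to $+\infty$ as $\delta\to+\infty$. For each $k$, $$L_0^{\lambda_k}=\sum_{j=1}^{n-1}\sum_{l=1}^{n-1}\Big|\frac{\tilde\alpha_{kj}}{\Gamma_{kj}\,l!}\Big|\Big\|I_{\alpha_{kj}}\Big[\frac{\partial^l}{\partial x^l}P(r(\cdot);\lambda_k)\Big]\Big\|_\infty,$$ $$Q_0^{\lambda_k}=\sum_{j=1}^{n-1}\sum_{i=2}^n\sum_{l=0}^{i-2}\frac{\tilde\alpha_{kj}}{|\Gamma_{kj}|}\binom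 il|\lambda_k|^l\Big(\frac{|a_i|}{|\alpha_{kj}|}+\big\|I_{\alpha_{kj}}[|r_i|]\big\|_\infty\Big),$$ $$H_{\lambda_k}=\Big\|\sum_{i=0}^{n-2}\big|G^{\lambda_k}[P(r;\lambda_k)]^{(i)}\big|\Big\|_\infty,$$ and, when $L_0^{\lambda_k}<1$, $\delta_{\lambda_k}>0$ is the number such that $0<m(\delta)<\frac{1-L_0^{\lambda_k}}{Q_0^{\lambda_k}}$ for all $\delta\in(0,\delta_{\lambda_k})$ and $m(\delta_{\lambda_k})=\frac{1-L_0^{\lambda_k}}{Q_0^{\lambda_k}}$. *)

theory Defs
  imports "HOL-Analysis.Analysis" "HOL-Computational_Algebra.Polynomial"
    "Jordan_Normal_Form.Gauss_Jordan_Elimination"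
begin

definition AP :: "(real \<Rightarrow> complex) \<Rightarrow> bool" where
  "AP r \<longleftrightarrow> continuous_on UNIV r \<and>
     (\<forall>b :: nat \<Rightarrow> real. \<exists>\<sigma> :: nat \<Rightarrow> nat. strict_mono \<sigma> \<and>
        (\<exists>l. uniform_limit UNIV (\<lambda>m t. r (t + b (\<sigma> m))) l sequentially))"

text \<open>
  \<open>nderiv i f\<close> is the iterated derivative; it is only meaningful when the derivatives exist,
  which is what \<open>times_differentiable\<close> asserts.
\<close>

definition nderiv :: "nat \<Rightarrow> (real \<Rightarrow> complex) \<Rightarrow> real \<Rightarrow> complex" where
  "nderiv i f = ((\<lambda>g t. vector_derivative g (at t)) ^^ i) f"

definition times_differentiable :: "nat \<Rightarrow> (real \<Rightarrow> complex) \<Rightarrow> bool" where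
  "times_differentiable m f \<longleftrightarrow> (\<forall>i<m. \<forall>t. nderiv i f differentiable (at t))"

definition AP_deriv :: "nat \<Rightarrow> (real \<Rightarrow> complex) \<Rightarrow> bool" where
  "AP_deriv m z \<longleftrightarrow> times_differentiable m z \<and> (\<forall>i\<le>m. AP (nderiv i z))"

definition sup_norm :: "(real \<Rightarrow> 'b::real_normed_vector) \<Rightarrow> real" where
  "sup_norm f = (SUP t. norm (f t))"

definition green :: "complex \<Rightarrow> real \<Rightarrow> real \<Rightarrow> complex" where
  "green \<omega> t s =
     (if sgn (Re \<omega>) * (t - s) < 0
      then - complex_of_real (sgn (Re \<omega>)) * exp (\<omega> * complex_of_real (t - s)) else 0)"

definition G_op :: "complex \<Rightarrow> (real \<Rightarrow> complex) \<Rightarrow> real \<Rightarrow> complex" where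
  "G_op \<omega> f t = (LINT s|lborel. green \<omega> t s * f s)"

definition I_op :: "complex \<Rightarrow> (real \<Rightarrow> complex) \<Rightarrow> real \<Rightarrow> real" where
  "I_op \<omega> f t = (LINT s|lborel. norm (green \<omega> t s * f s))"

text \<open>
  A tuple \<open>(c\<^sub>0, \<dots>, c\<^sub>n)\<close> is a function \<open>c :: nat \<Rightarrow> complex\<close>, read on \<open>{0..n}\<close>. Families indexed by
  \<open>1, \<dots>, n\<close> (such as the roots \<open>lam\<close>) are functions on \<open>nat\<close>, read on \<open>{1..n}\<close>.
\<close>

definition Ppoly :: "nat \<Rightarrow> (nat \<Rightarrow> complex) \<Rightarrow> complex poly" where
  "Ppoly n c = (\<Sum>i\<le>n. monom (c i) i)"

definition Pder :: "nat \<Rightarrow> nat \<Rightarrow> (nat \<Rightarrow> complex) \<Rightarrow> complex \<Rightarrow> complex" where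
  "Pder n k c x = poly ((pderiv ^^ k) (Ppoly n c)) x"

definition Pr :: "nat \<Rightarrow> (nat \<Rightarrow> real \<Rightarrow> complex) \<Rightarrow> complex \<Rightarrow> real \<Rightarrow> complex" where
  "Pr n r x t = (\<Sum>l=0..n-1. x ^ l * r l t)"

text \<open>The arguments \<open>x\<^sub>1, x\<^sub>2, \<dots>\<close> are given as a sequence \<open>x\<close>, whose value at \<open>0\<close> is unused.\<close>

fun bell :: "nat \<Rightarrow> (nat \<Rightarrow> complex) \<Rightarrow> complex" where
  "bell 0 x = 1"
| "bell (Suc i) x = (\<Sum>j\<le>i. of_nat (i choose j) * bell (i - j) x * x (j + 1))"

definition bell_f :: "nat \<Rightarrow> (nat \<Rightarrow> complex) \<Rightarrow> complex" where
  "bell_f i x = bell (i + 1) x - x (i + 1)"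

lemma bell_cong: "(\<And>l. 1 \<le> l \<Longrightarrow> l \<le> i \<Longrightarrow> x l = y l) \<Longrightarrow> bell i x = bell i y"
proof (induction i rule: less_induct)
  case (less i)
  show ?case
  proof (cases i)
    case (Suc k)
    have "bell (k - j) x * x (j + 1) = bell (k - j) y * y (j + 1)" if "j \<le> k" for j
      using less.IH[of "k - j"] less.prems that Suc by force
    then show ?thesis unfolding Suc bell.simps
      by (intro sum.cong) (auto simp: mult.assoc)
  qed simp
qed

text \<open>The summand \<open>x (i + 1)\<close> cancels, so \<open>bell_f i\<close> depends on \<open>x\<^sub>1, \<dots>, x\<^sub>i\<close> only.\<close>

lemma bell_f_cong:
  assumes "\<And>l. 1 \<le> l \<Longrightarrow> l \<le> i \<Longrightarrow> x l = y l"
  shows "bell_f i x = bell_f i y"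
proof -
  have *: "bell_f i u = (\<Sum>j<i. of_nat (i choose j) * bell (i - j) u * u (j + 1))" for u
    by (simp add: bell_f_def lessThan_Suc_atMost[symmetric])
  have "bell (i - j) x = bell (i - j) y" for j
    by (rule bell_cong) (use assms in auto)
  then show ?thesis unfolding * using assms by (intro sum.cong) auto
qed

text \<open>Points of \<open>\<complex>\<^sup>i\<close> are extensional functions on \<open>{1..i}\<close>; the ball is taken in the 1-norm.\<close>

definition norm1 :: "nat \<Rightarrow> (nat \<Rightarrow> complex) \<Rightarrow> real" where
  "norm1 i X = (\<Sum>l=1..i. norm (X l))"

definition ball1 :: "nat \<Rightarrow> real \<Rightarrow> (nat \<Rightarrow> complex) set" where
  "ball1 i \<delta> = {X \<in> {1..i} \<rightarrow>\<^sub>E UNIV. norm1 i X < \<delta>}"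

definition m_comp :: "nat \<Rightarrow> real \<Rightarrow> real" where
  "m_comp i \<delta> = Sup {norm (bell_f i X - bell_f i Y) / norm1 i (\<lambda>l. X l - Y l) | X Y.
     X \<in> ball1 i \<delta> \<and> Y \<in> ball1 i \<delta> \<and> X \<noteq> Y}"

definition m_fun :: "nat \<Rightarrow> real \<Rightarrow> real" where
  "m_fun n \<delta> = (if \<delta> = 0 then 0 else Max ((\<lambda>i. m_comp i \<delta>) ` {2..n}))"

definition gam :: "(nat \<Rightarrow> complex) \<Rightarrow> nat \<Rightarrow> nat \<Rightarrow> complex" where
  "gam lam k j = (if j < k then lam j - lam k else lam (j + 1) - lam k)"

definition alph :: "(nat \<Rightarrow> complex) \<Rightarrow> nat \<Rightarrow> nat \<Rightarrow> real" where
  "alph lam k j = Re (gam lam k j)"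

definition alph_tilde :: "nat \<Rightarrow> (nat \<Rightarrow> complex) \<Rightarrow> nat \<Rightarrow> nat \<Rightarrow> real" where
  "alph_tilde n lam k j = (\<Sum>i=0..n-2. norm (gam lam k j) ^ i)"

definition Gam :: "nat \<Rightarrow> (nat \<Rightarrow> complex) \<Rightarrow> nat \<Rightarrow> nat \<Rightarrow> complex" where
  "Gam n lam k j = (\<Prod>l\<in>{1..n-1} - {j}. gam lam k j - gam lam k l)"

definition G_lam ::
    "nat \<Rightarrow> (nat \<Rightarrow> complex) \<Rightarrow> nat \<Rightarrow> (real \<Rightarrow> complex) \<Rightarrow> real \<Rightarrow> complex" where
  "G_lam n lam k f t = (\<Sum>j=1..n-1. 1 / Gam n lam k j * G_op (gam lam k j) f t)"

definition D_op ::
    "nat \<Rightarrow> (nat \<Rightarrow> complex) \<Rightarrow> (nat \<Rightarrow> complex) \<Rightarrow> nat \<Rightarrow> (real \<Rightarrow> complex) \<Rightarrow> real \<Rightarrow> complex"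
where
  "D_op n a lam k z t = (\<Sum>j=1..n. 1 / fact j * Pder n j a (lam k) * nderiv (j - 1) z t)"

definition L_op ::
    "nat \<Rightarrow> (nat \<Rightarrow> real \<Rightarrow> complex) \<Rightarrow> (nat \<Rightarrow> complex) \<Rightarrow> nat \<Rightarrow> real \<Rightarrow> (real \<Rightarrow> complex) \<Rightarrow> complex"
where
  "L_op n r lam k t z =
     (\<Sum>l=1..n-1. 1 / fact l * Pder n l (\<lambda>i. r i t) (lam k) * nderiv (l - 1) z t)"

text \<open>Here \<open>x l\<close> stands for the derivative of order \<open>l - 1\<close> of \<open>z\<close> at \<open>t\<close> (cf. \<open>jet\<close> below);
  only its values on \<open>{1..n-1}\<close> matter, by \<open>bell_f_cong\<close>.\<close>

definition F_op ::
    "nat \<Rightarrow> (nat \<Rightarrow> complex) \<Rightarrow> (nat \<Rightarrow> real \<Rightarrow> complex) \<Rightarrow> (nat \<Rightarrow> complex) \<Rightarrow> nat \<Rightarrow> real \<Rightarrow>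
     (nat \<Rightarrow> complex) \<Rightarrow> complex"
where
  "F_op n a r lam k t x =
     (\<Sum>i=2..n. \<Sum>j=0..n-i.
        of_nat ((i + j) choose j) * (a (i + j) + r (i + j) t) * lam k ^ j * bell_f (i - 1) x)"

definition jet :: "(real \<Rightarrow> complex) \<Rightarrow> real \<Rightarrow> nat \<Rightarrow> complex" where
  "jet z t l = nderiv (l - 1) z t"

definition L0 :: "nat \<Rightarrow> (nat \<Rightarrow> real \<Rightarrow> complex) \<Rightarrow> (nat \<Rightarrow> complex) \<Rightarrow> nat \<Rightarrow> real" where
  "L0 n r lam k =
     (\<Sum>j=1..n-1. \<Sum>l=1..n-1.
        norm (complex_of_real (alph_tilde n lam k j) / (Gam n lam k j * fact l)) *
        sup_norm (I_op (complex_of_real (alph lam k j)) (\<lambda>s. Pder n l (\<lambda>i. r i s) (lam k))))"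

definition Q0 ::
    "nat \<Rightarrow> (nat \<Rightarrow> complex) \<Rightarrow> (nat \<Rightarrow> real \<Rightarrow> complex) \<Rightarrow> (nat \<Rightarrow> complex) \<Rightarrow> nat \<Rightarrow> real"
where
  "Q0 n a r lam k =
     (\<Sum>j=1..n-1. \<Sum>i=2..n. \<Sum>l=0..i-2.
        alph_tilde n lam k j / norm (Gam n lam k j) * real (i choose l) * norm (lam k) ^ l *
        (norm (a i) / \<bar>alph lam k j\<bar> +
         sup_norm (I_op (complex_of_real (alph lam k j)) (\<lambda>s. complex_of_real (norm (r i s))))))"

definition H_lam :: "nat \<Rightarrow> (nat \<Rightarrow> real \<Rightarrow> complex) \<Rightarrow> (nat \<Rightarrow> complex) \<Rightarrow> nat \<Rightarrow> real" where
  "H_lam n r lam k =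
     sup_norm (\<lambda>t. \<Sum>i=0..n-2. norm (nderiv i (G_lam n lam k (Pr n r (lam k))) t))"

definition delta_lam ::
    "nat \<Rightarrow> (nat \<Rightarrow> complex) \<Rightarrow> (nat \<Rightarrow> real \<Rightarrow> complex) \<Rightarrow> (nat \<Rightarrow> complex) \<Rightarrow> nat \<Rightarrow> real"
where
  "delta_lam n a r lam k =
     (THE d. d > 0 \<and>
        (\<forall>\<delta>\<in>{0<..<d}. 0 < m_fun n \<delta> \<and> m_fun n \<delta> < (1 - L0 n r lam k) / Q0 n a r lam k) \<and>
        m_fun n d = (1 - L0 n r lam k) / Q0 n a r lam k)"

text \<open>Matrix indices start at \<open>0\<close>, so the entry at \<open>(i, k)\<close> belongs to row \<open>i + 1\<close>, column \<open>k + 1\<close>.\<close>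

definition vandermonde :: "nat \<Rightarrow> (nat \<Rightarrow> complex) \<Rightarrow> complex Matrix.mat" where
  "vandermonde n lam = Matrix.mat n n (\<lambda>(i, k). lam (k + 1) ^ i)"

definition mat_norm1 :: "complex Matrix.mat \<Rightarrow> real" where
  "mat_norm1 B = Max ((\<lambda>k. \<Sum>i<dim_row B. norm (B $$ (i, k))) ` {..<dim_col B})"

definition solution ::
    "nat \<Rightarrow> (nat \<Rightarrow> complex) \<Rightarrow> (nat \<Rightarrow> real \<Rightarrow> complex) \<Rightarrow> (real \<Rightarrow> complex) \<Rightarrow> bool"
where
  "solution n a r y \<longleftrightarrow> times_differentiable n y \<and>
     (\<forall>t. nderiv n y t + (\<Sum>i=0..n-1. (a i + r i t) * nderiv i y t) = 0)"

definition fundamental_system ::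
    "nat \<Rightarrow> (nat \<Rightarrow> complex) \<Rightarrow> (nat \<Rightarrow> real \<Rightarrow> complex) \<Rightarrow> (nat \<Rightarrow> real \<Rightarrow> complex) \<Rightarrow> bool"
where
  "fundamental_system n a r y \<longleftrightarrow>
     (\<forall>k\<in>{1..n}. solution n a r (y k)) \<and>
     (\<forall>c :: nat \<Rightarrow> complex. (\<forall>t. (\<Sum>k=1..n. c k * y k t) = 0) \<longrightarrow> (\<forall>k\<in>{1..n}. c k = 0))"

end

theory Submission
  imports Defs "Jordan_Normal_Form.Determinant"
begin

text \<open>
  Writing \<open>y = exp (\<integral> (\<lambda>\<^sub>k + z))\<close>, the quotients \<open>y\<^sup>(\<^sup>i\<^sup>) / y\<close> are complete Bell polynomials in
  \<open>\<lambda>\<^sub>k + z, z', z'', \<dots>\<close>, and the equation for \<open>y\<close> becomes \<open>\<D>\<^sub>k z + P(r; \<lambda>\<^sub>k) + \<L>\<^sub>k + \<F>\<^sub>k = 0\<close>. The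
  operator \<open>G\<^sup>\<lambda>\<close> inverts \<open>\<D>\<^sub>k\<close>, by the Lagrange identities for \<open>\<Sum>\<^sub>j \<gamma>\<^sub>j\<^sup>i / \<Gamma>\<^sub>j\<close>, so \<open>z\<close> is a fixed
  point of a map on jets which is Lipschitz with constant \<open>q = L\<^sub>0 + m(M\<^sub>k) Q\<^sub>0\<close> on the ball of radius
  \<open>M\<^sub>k\<close>. The bound on \<open>H\<close> gives \<open>q \<le> 1\<close> and the invariance of the ball. For \<open>q < 1\<close> the Picard
  iteration converges; comparing the fixed point with its translates, the contraction bounds their
  difference by that of the coefficients \<open>r\<^sub>i\<close>, whence almost periodicity. For \<open>q = 1\<close> the bound
  forces \<open>H = 0\<close>, and \<open>z = 0\<close> is a solution. Finally the Wronskian matrix at \<open>0\<close> is, up to nonzero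
  column factors, a perturbation of \<open>V\<close> whose 1-norm is less than \<open>1 / \<parallel>V\<^sup>-\<^sup>1\<parallel>\<^sub>1\<close>.
\<close>

section \<open>Green operators\<close>

text \<open>The unknown of the fixed-point problem is a tuple of \<open>n - 1\<close> unrelated
  continuous functions, not one function together with its derivatives. Uniform limits of continuous
  functions then suffice for the iteration. Component \<open>l + 1\<close> becomes the derivative of
  component \<open>l\<close> only at the fixed point, because there all components arise from one
  source through the same Green operators, with the coefficients \<open>g j ^ i / Gam j\<close>.
  These coefficients also explain the constants of the statement: adding their moduli over the tuple
  gives \<open>alph_tilde / norm Gam\<close>, the terms of the source that are linear in the jet
  then produce \<open>L0\<close>, and the Bell terms produce \<open>Q0\<close>. To obtain exactly
  these constants, the Lipschitz factor of the source, a function of time, has to stay under the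
  Green integral until the end. The solution is written through the integral of the source instead
  of that of \<open>z\<close>; both exponents have the same derivative by a Lagrange identity, which
  fixes the factor in front of the integral.\<close>

lemma has_bochner_integral_exp_half_line:
  assumes "b > 0"
  shows "has_bochner_integral lborel (\<lambda>u::real. if u > 0 then exp (- b * u) else 0) (1 / b)"
proof (rule has_bochner_integral_nn_integral)
  have "((\<lambda>u. exp (- b * u)) has_integral 1 / b) {0..}"
    using has_integral_exp_minus_to_infinity[OF assms, of 0] by simp
  then have "((\<lambda>u. if u > 0 then exp (- b * u) else 0) has_integral 1 / b) {0..}"
    by (rule has_integral_spike[of "{0}", rotated 2]) auto
  then have "((\<lambda>u::real. if u > 0 then exp (- b * u) else 0) has_integral 1 / b) UNIV"
    by (rule has_integral_on_superset) auto
  then show "(\<integral>\<^sup>+u. ennreal (if u > 0 then exp (- b * u) else 0) \<partial>lborel) = ennreal (1 / b)"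
    by (intro nn_integral_has_integral_lborel) auto
qed (use assms in auto)

lemma norm_green:
  "norm (green \<omega> t s) = (if sgn (Re \<omega>) * (t - s) < 0 then exp (Re \<omega> * (t - s)) else 0)"
  by (auto simp: green_def norm_mult sgn_if)

lemma green_measurable [measurable]: "green \<omega> t \<in> borel_measurable borel"
  unfolding green_def by measurable

text \<open>The substitution \<open>s = t + sgn (Re \<omega>) * u\<close> maps the support of the
  kernel to the half line \<open>u > 0\<close> for either sign of the real part.\<close>

lemma has_bochner_integral_norm_green:
  assumes "Re \<omega> \<noteq> 0"
  shows "has_bochner_integral lborel (\<lambda>s. norm (green \<omega> t s)) (1 / \<bar>Re \<omega>\<bar>)"
proof -
  have "norm (green \<omega> t (t + sgn (Re \<omega>) * u)) = (if u > 0 then exp (- \<bar>Re \<omega>\<bar> * u) else 0)" for u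
    using assms by (auto simp: norm_green sgn_if)
  then have "has_bochner_integral lborel (\<lambda>u. norm (green \<omega> t (t + sgn (Re \<omega>) * u))) (1 / \<bar>Re \<omega>\<bar>)"
    using has_bochner_integral_exp_half_line[of "\<bar>Re \<omega>\<bar>"] assms by simp
  then show ?thesis
    using lborel_has_bochner_integral_real_affine_iff[of "sgn (Re \<omega>)" "\<lambda>s. norm (green \<omega> t s)" "1 / \<bar>Re \<omega>\<bar>" t] assms
    by (simp add: sgn_if abs_if split: if_splits)
qed

lemma integrable_green_mult:
  fixes f :: "real \<Rightarrow> complex"
  assumes "Re \<omega> \<noteq> 0" "continuous_on UNIV f" "\<And>s. norm (f s) \<le> B"
  shows "integrable lborel (\<lambda>s. green \<omega> t s * f s)"
proof (rule Bochner_Integration.integrable_bound)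
  show "integrable lborel (\<lambda>s. B * norm (green \<omega> t s))"
    using has_bochner_integral_norm_green[OF assms(1)]
    by (intro integrable_mult_right) (auto simp: has_bochner_integral_iff)
  have [measurable]: "f \<in> borel_measurable borel"
    using assms(2) by (rule borel_measurable_continuous_onI)
  show "(\<lambda>s. green \<omega> t s * f s) \<in> borel_measurable lborel" by simp
  show "AE s in lborel. norm (green \<omega> t s * f s) \<le> norm (B * norm (green \<omega> t s))"
  proof (rule AE_I2)
    fix s
    have "norm (green \<omega> t s) * norm (f s) \<le> norm (green \<omega> t s) * B"
      by (intro mult_left_mono assms) auto
    also have "\<dots> \<le> norm (B * norm (green \<omega> t s))" by (simp add: mult.commute abs_mult mult_right_mono)
    finally show "norm (green \<omega> t s * f s) \<le> norm (B * norm (green \<omega> t s))" by (simp add: norm_mult)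
  qed
qed

lemma integrable_norm_green_mult:
  fixes f :: "real \<Rightarrow> real"
  assumes "Re \<omega> \<noteq> 0" "continuous_on UNIV f" "\<And>s. \<bar>f s\<bar> \<le> B"
  shows "integrable lborel (\<lambda>s. norm (green \<omega> t s) * f s)"
proof -
  have "integrable lborel (\<lambda>s. B * norm (green \<omega> t s))"
    using has_bochner_integral_norm_green[OF assms(1)]
    by (intro integrable_mult_right) (auto simp: has_bochner_integral_iff)
  then show ?thesis
  proof (rule Bochner_Integration.integrable_bound)
    have [measurable]: "f \<in> borel_measurable borel"
      using assms(2) by (rule borel_measurable_continuous_onI)
    show "(\<lambda>s. norm (green \<omega> t s) * f s) \<in> borel_measurable lborel" by simp
    have "norm (norm (green \<omega> t s) * f s) \<le> norm (B * norm (green \<omega> t s))" for s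
    proof -
      have "norm (green \<omega> t s) * \<bar>f s\<bar> \<le> norm (green \<omega> t s) * \<bar>B\<bar>"
        by (rule mult_left_mono) (use assms(3)[of s] in auto)
      then show ?thesis by (simp add: abs_mult mult.commute)
    qed
    then show "AE s in lborel. norm (norm (green \<omega> t s) * f s) \<le> norm (B * norm (green \<omega> t s))"
      by (intro AE_I2)
  qed
qed

text \<open>The modulus of the kernel depends on the real part of \<omega> only. Hence the operators
  with exponent \<open>alph\<close> in \<open>L0\<close> and \<open>Q0\<close> dominate the Green
  operators with exponent \<open>gam\<close>.\<close>

lemma I_op_eq: "I_op (complex_of_real (Re \<omega>)) f t = (LINT s|lborel. norm (green \<omega> t s) * norm (f s))"
  unfolding I_op_def by (intro Bochner_Integration.integral_cong) (auto simp: norm_mult norm_green)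

text \<open>A supremum of reals is a bound only when the set is bounded above; the estimate
  \<open>B / \<bar>Re \<omega>\<bar>\<close> supplies this.\<close>

lemma I_op_le_sup_norm:
  fixes f :: "real \<Rightarrow> complex"
  assumes "Re \<omega> \<noteq> 0" "continuous_on UNIV f" "\<And>s. norm (f s) \<le> B"
  shows "I_op \<omega> f t \<le> sup_norm (I_op \<omega> f)"
proof -
  have "norm (I_op \<omega> f t) \<le> B / \<bar>Re \<omega>\<bar>" for t
  proof -
    have "norm (I_op \<omega> f t) = I_op \<omega> f t" unfolding I_op_def by simp
    also have "\<dots> = (LINT s|lborel. norm (green \<omega> t s) * norm (f s))"
      by (simp add: I_op_def norm_mult)
    also have "\<dots> \<le> (LINT s|lborel. norm (green \<omega> t s) * B)"
    proof (rule integral_mono)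
      show "integrable lborel (\<lambda>s. norm (green \<omega> t s) * norm (f s))"
        by (intro integrable_norm_green_mult[where B=B] continuous_on_norm assms) (use assms(3) in simp)
      show "integrable lborel (\<lambda>s. norm (green \<omega> t s) * B)"
        by (rule integrable_norm_green_mult[where B="\<bar>B\<bar>", OF assms(1)]) auto
    qed (use assms(3) in \<open>simp add: mult_left_mono\<close>)
    also have "\<dots> = B / \<bar>Re \<omega>\<bar>"
      using has_bochner_integral_norm_green[OF assms(1), of t] by (simp add: has_bochner_integral_iff)
    finally show ?thesis .
  qed
  then have "norm (I_op \<omega> f t) \<le> sup_norm (I_op \<omega> f)"
    unfolding sup_norm_def by (intro cSUP_upper bdd_aboveI2[where M="B / \<bar>Re \<omega>\<bar>"]) auto
  then show ?thesis by simp
qed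

text \<open>The majorant \<open>v\<close> stays under the integral. Replacing it by its supremum
  would lose the contraction constant, which is made of Green integrals of the coefficients.\<close>

lemma norm_G_op_le:
  fixes u :: "real \<Rightarrow> complex" and v :: "real \<Rightarrow> real"
  assumes "Re \<omega> \<noteq> 0" "continuous_on UNIV u" "continuous_on UNIV v"
    and "\<And>s. norm (u s) \<le> v s" "\<And>s. v s \<le> B"
  shows "norm (G_op \<omega> u t) \<le> (LINT s|lborel. norm (green \<omega> t s) * v s)"
proof -
  have "norm (G_op \<omega> u t) \<le> (LINT s|lborel. norm (green \<omega> t s * u s))"
    unfolding G_op_def by (rule integral_norm_bound)
  also have "\<dots> = (LINT s|lborel. norm (green \<omega> t s) * norm (u s))" by (simp add: norm_mult)
  also have "\<dots> \<le> (LINT s|lborel. norm (green \<omega> t s) * v s)"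
  proof (rule integral_mono)
    have 0: "0 \<le> norm (u s)" "norm (u s) \<le> v s" "v s \<le> B" for s using assms(4,5) by auto
    have "\<bar>norm (u s)\<bar> \<le> B" for s using 0[of s] by linarith
    then show "integrable lborel (\<lambda>s. norm (green \<omega> t s) * norm (u s))"
      by (rule integrable_norm_green_mult[OF assms(1) continuous_on_norm[OF assms(2)]])
    have "\<bar>v s\<bar> \<le> B" for s using 0[of s] by linarith
    then show "integrable lborel (\<lambda>s. norm (green \<omega> t s) * v s)"
      by (rule integrable_norm_green_mult[OF assms(1,3)])
  qed (use assms(4) in \<open>simp add: mult_left_mono\<close>)
  finally show ?thesis .
qed

lemma G_op_bounded:
  assumes "Re \<omega> \<noteq> 0" "continuous_on UNIV f" "\<And>s. norm (f s) \<le> B"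
  shows "norm (G_op \<omega> f t) \<le> B / \<bar>Re \<omega>\<bar>"
  using norm_G_op_le[OF assms(1,2) continuous_on_const assms(3) order_refl, of t]
    has_bochner_integral_norm_green[OF assms(1), of t] by (simp add: has_bochner_integral_iff)

lemma G_op_diff:
  fixes u v :: "real \<Rightarrow> complex"
  assumes "Re \<omega> \<noteq> 0" "continuous_on UNIV u" "\<And>s. norm (u s) \<le> B"
    "continuous_on UNIV v" "\<And>s. norm (v s) \<le> C"
  shows "G_op \<omega> (\<lambda>s. u s - v s) t = G_op \<omega> u t - G_op \<omega> v t"
  unfolding G_op_def right_diff_distrib
  by (intro Bochner_Integration.integral_diff integrable_green_mult[of _ _ B]
      integrable_green_mult[of _ _ C] assms)

lemma G_op_shift: "G_op \<omega> f (t + c) = G_op \<omega> (\<lambda>s. f (s + c)) t"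
proof -
  have "G_op \<omega> f (t + c) = (LINT s|lborel. green \<omega> (t + c) (c + s) * f (c + s))"
    unfolding G_op_def using lborel_integral_real_affine[of 1 "\<lambda>s. green \<omega> (t + c) s * f s" c] by simp
  moreover have "green \<omega> (t + c) (c + s) = green \<omega> t s" for s by (simp add: green_def)
  ultimately show ?thesis by (simp add: G_op_def add.commute)
qed

text \<open>For either sign of \<open>Re \<omega>\<close> the kernels at \<open>t\<close> and \<open>t\<^sub>0\<close> differ only on \<open>[t\<^sub>0, t]\<close>.\<close>

lemma G_op_increment:
  fixes f :: "real \<Rightarrow> complex"
  assumes "Re \<omega> \<noteq> 0" "continuous_on UNIV f" "\<And>s. norm (f s) \<le> B" "t0 \<le> t"
  shows "exp (- \<omega> * t) * G_op \<omega> f t - exp (- \<omega> * t0) * G_op \<omega> f t0 =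
    integral {t0..t} (\<lambda>s. exp (- \<omega> * s) * f s)"
proof -
  note [measurable] = borel_measurable_continuous_onI[OF assms(2)]
  let ?F = "\<lambda>s. indicator {t0..t} s *\<^sub>R (exp (- \<omega> * s) * f s)"
  have int: "integrable lborel (\<lambda>s. green \<omega> t s * f s)" for t
    using assms by (intro integrable_green_mult) auto
  \<comment> \<open>The exponential factors cancel the dependence of the kernels on \<open>t\<close>
    and \<open>t0\<close>, so that only the two cutoffs remain. The endpoints are left out because
    the cutoff in \<open>green\<close> is strict.\<close>
  have eq: "exp (- \<omega> * t) * (green \<omega> t s * f s) - exp (- \<omega> * t0) * (green \<omega> t0 s * f s) = ?F s"
    if "s \<noteq> t" "s \<noteq> t0" for s
  proof -
    have e: "exp (- (\<omega> * of_real \<tau>)) * (exp (\<omega> * (of_real \<tau> - of_real s)) * f s) = exp (- (\<omega> * of_real s)) * f s" for \<tau>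
      by (simp add: mult.assoc[symmetric] exp_add[symmetric] algebra_simps)
    show ?thesis
      using that assms(1,4) by (auto simp: green_def indicator_def sgn_if e)
  qed
  have "exp (- \<omega> * t) * G_op \<omega> f t - exp (- \<omega> * t0) * G_op \<omega> f t0 =
      (LINT s|lborel. exp (- \<omega> * t) * (green \<omega> t s * f s) - exp (- \<omega> * t0) * (green \<omega> t0 s * f s))"
    unfolding G_op_def using int by (simp del: mult_minus_left)
  also have "\<dots> = (LINT s|lborel. ?F s)"
  proof (rule integral_cong_AE)
    show "AE s in lborel. exp (- \<omega> * t) * (green \<omega> t s * f s) - exp (- \<omega> * t0) * (green \<omega> t0 s * f s) = ?F s"
      using AE_lborel_singleton[of t] AE_lborel_singleton[of t0] by eventually_elim (rule eq)
  qed measurable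
  also have "\<dots> = integral {t0..t} (\<lambda>s. exp (- \<omega> * s) * f s)"
  proof -
    have "continuous_on {t0..t} (\<lambda>s. exp (- \<omega> * s) * f s)"
      by (intro continuous_intros continuous_on_subset[OF assms(2)]) auto
    then have "set_integrable lborel {t0..t} (\<lambda>s. exp (- \<omega> * s) * f s)"
      unfolding set_integrable_def by (intro borel_integrable_compact) auto
    from set_borel_integral_eq_integral(2)[OF this] show ?thesis
      unfolding set_lebesgue_integral_def .
  qed
  finally show ?thesis .
qed

text \<open>By the increment formula, \<open>G_op\<close> is on \<open>[t - 1, \<infinity>)\<close>
  an exponential times a constant plus a primitive, so nothing has to be differentiated under an
  improper integral. The base point \<open>t - 1\<close> keeps \<open>t\<close> in the
  interior.\<close>

lemma G_op_has_vector_derivative: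
  fixes f :: "real \<Rightarrow> complex"
  assumes "Re \<omega> \<noteq> 0" "continuous_on UNIV f" "\<And>s. norm (f s) \<le> B"
  shows "(G_op \<omega> f has_vector_derivative \<omega> * G_op \<omega> f t + f t) (at t)"
proof -
  let ?g = "\<lambda>s. exp (- \<omega> * complex_of_real s) * f s"
  have cont: "continuous_on {t-1..t+1} ?g"
    by (intro continuous_intros continuous_on_subset[OF assms(2)]) auto
  define A where "A = exp (- \<omega> * (t - 1)) * G_op \<omega> f (t - 1)"
  have "((\<lambda>\<tau>. integral {t-1..\<tau>} ?g) has_vector_derivative ?g t) (at t within {t-1..t+1})"
    using integral_has_vector_derivative[OF cont, of t] by simp
  then have "((\<lambda>\<tau>. integral {t-1..\<tau>} ?g) has_vector_derivative ?g t) (at t)"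
    by (subst (asm) at_within_interior) auto
  then have "((\<lambda>\<tau>. exp (\<omega> * of_real \<tau>) * (A + integral {t-1..\<tau>} ?g)) has_vector_derivative
      exp (\<omega> * t) * ?g t + \<omega> * exp (\<omega> * t) * (A + integral {t-1..t} ?g)) (at t)"
    by (auto intro!: derivative_eq_intros has_vector_derivative_real_field simp: algebra_simps)
  moreover have eq: "exp (\<omega> * of_real \<tau>) * (A + integral {t-1..\<tau>} ?g) = G_op \<omega> f \<tau>" if "\<tau> \<ge> t - 1" for \<tau>
  proof -
    have "exp (- \<omega> * \<tau>) * G_op \<omega> f \<tau> = A + integral {t-1..\<tau>} ?g"
      using G_op_increment[OF assms that] unfolding A_def by (simp add: algebra_simps)
    then have "exp (\<omega> * of_real \<tau>) * (A + integral {t-1..\<tau>} ?g) = exp (\<omega> * \<tau>) * (exp (- \<omega> * \<tau>) * G_op \<omega> f \<tau>)"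
      by simp
    then show ?thesis by (simp add: mult.assoc[symmetric] exp_add[symmetric])
  qed
  moreover have "exp (\<omega> * t) * ?g t + \<omega> * exp (\<omega> * t) * (A + integral {t-1..t} ?g) = \<omega> * G_op \<omega> f t + f t"
  proof -
    have "exp (\<omega> * t) * ?g t = (exp (\<omega> * t) * exp (- \<omega> * t)) * f t" by (rule mult.assoc[symmetric])
    also have "exp (\<omega> * t) * exp (- \<omega> * t) = 1" by (simp add: exp_add[symmetric])
    finally show ?thesis using eq[of t] by (simp add: mult.assoc)
  qed
  ultimately show ?thesis
    using has_vector_derivative_transform_within_open[of
        "\<lambda>\<tau>. exp (\<omega> * of_real \<tau>) * (A + integral {t-1..\<tau>} ?g)" _ t "{t-1<..}" "G_op \<omega> f"]
    by auto
qed

lemma G_op_continuous: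
  assumes "Re \<omega> \<noteq> 0" "continuous_on UNIV f" "\<And>s. norm (f s) \<le> B"
  shows "continuous_on UNIV (G_op \<omega> f)"
  by (intro continuous_at_imp_continuous_on ballI)
    (rule has_vector_derivative_continuous[OF G_op_has_vector_derivative[OF assms]])

section \<open>Almost periodic functions\<close>

lemma AP_continuous: "AP f \<Longrightarrow> continuous_on UNIV f"
  by (simp add: AP_def)

text \<open>Translates by points \<open>b m\<close> at which the modulus exceeds \<open>m\<close>
  have no subsequence that converges at \<open>0\<close>.\<close>

lemma AP_bounded:
  assumes "AP f"
  obtains B where "B \<ge> 0" "\<And>t. norm (f t) \<le> B"
proof -
  have "\<exists>B. \<forall>t. norm (f t) \<le> B"
  proof (rule ccontr)
    assume "\<not> ?thesis"
    then have "\<exists>t. norm (f t) > real m" for m :: nat by (meson not_le)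
    then obtain b where b: "norm (f (b m)) > real m" for m :: nat by metis
    obtain \<sigma> l where \<sigma>: "strict_mono \<sigma>" "uniform_limit UNIV (\<lambda>m t. f (t + b (\<sigma> m))) l sequentially"
      using assms unfolding AP_def by blast
    have "(\<lambda>m. f (0 + b (\<sigma> m))) \<longlonglongrightarrow> l 0"
      by (rule tendsto_uniform_limitI[OF \<sigma>(2)]) simp
    then have "Bseq (\<lambda>m. f (b (\<sigma> m)))" by (intro convergent_imp_Bseq) (auto simp: convergent_def)
    then obtain K where K: "\<And>m. norm (f (b (\<sigma> m))) \<le> K" by (auto simp: Bseq_def)
    obtain m :: nat where "K < m" using reals_Archimedean2 by blast
    also have "real m \<le> real (\<sigma> m)" using seq_suble[OF \<sigma>(1)] by simp
    finally show False using b[of "\<sigma> m"] K[of m] by linarith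
  qed
  then obtain B where "\<And>t. norm (f t) \<le> B" by blast
  then show ?thesis using that[of B] norm_ge_zero order_trans by blast
qed

lemma AP_const: "AP (\<lambda>t. c)"
  unfolding AP_def by (auto intro!: exI[of _ "\<lambda>n. n"] exI[of _ "\<lambda>t. c"] strict_monoI uniform_limit_const)

lemma AP_common_subsequence:
  fixes b :: "nat \<Rightarrow> real" and n :: nat
  assumes "\<And>i. i < n \<Longrightarrow> AP (r i)"
  shows "\<exists>\<sigma>. strict_mono \<sigma> \<and> (\<forall>i<n. \<exists>l. uniform_limit UNIV (\<lambda>m t. r i (t + b (\<sigma> m))) l sequentially)"
  using assms
proof (induction n)
  case 0
  then show ?case by (auto intro!: exI[of _ "\<lambda>n. n"] strict_monoI)
next
  case (Suc n)
  then obtain \<sigma> where \<sigma>: "strict_mono \<sigma>"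
    "\<And>i. i < n \<Longrightarrow> \<exists>l. uniform_limit UNIV (\<lambda>m t. r i (t + b (\<sigma> m))) l sequentially"
    by force
  obtain \<tau> l where \<tau>: "strict_mono \<tau>" "uniform_limit UNIV (\<lambda>m t. r n (t + b (\<sigma> (\<tau> m)))) l sequentially"
    using Suc.prems[of n] unfolding AP_def by (auto dest: spec[of _ "b \<circ> \<sigma>"])
  have "\<exists>l. uniform_limit UNIV (\<lambda>m t. r i (t + b ((\<sigma> \<circ> \<tau>) m))) l sequentially" if i: "i < Suc n" for i
  proof (cases "i = n")
    case False
    then obtain l where "uniform_limit UNIV (\<lambda>m t. r i (t + b (\<sigma> m))) l sequentially"
      using \<sigma>(2)[of i] i False by (auto simp: less_Suc_eq)
    then show ?thesis
      using filterlim_compose[OF _ filterlim_subseq[OF \<tau>(1)]] by (auto simp: o_def intro!: exI[of _ l])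
  qed (use \<tau> in auto)
  then show ?case using strict_mono_o[OF \<sigma>(1) \<tau>(1)] by blast
qed

text \<open>A function whose translation differences are controlled by those of finitely many
  almost periodic functions is itself almost periodic; no stability of the class under limits
  or integral operators is then required.\<close>

lemma AP_transfer:
  fixes f :: "real \<Rightarrow> complex" and n :: nat
  assumes "\<And>i. i < n \<Longrightarrow> AP (r i)" "continuous_on UNIV f"
    and "\<And>c e. (\<And>i s. i < n \<Longrightarrow> norm (r i (s + c) - r i s) \<le> e) \<Longrightarrow> e > 0
      \<Longrightarrow> \<forall>t. norm (f (t + c) - f t) \<le> C * e"
  shows "AP f"
  unfolding AP_def
proof (intro conjI allI assms(2))
  fix b :: "nat \<Rightarrow> real"
  obtain \<sigma> where \<sigma>: "strict_mono \<sigma>"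
    "\<And>i. i < n \<Longrightarrow> \<exists>l. uniform_limit UNIV (\<lambda>m t. r i (t + b (\<sigma> m))) l sequentially"
    using AP_common_subsequence[of n r b] assms(1) by auto
  have "uniformly_Cauchy_on UNIV (\<lambda>m t. f (t + b (\<sigma> m)))"
  proof (rule uniformly_Cauchy_onI)
    fix e :: real assume "e > 0"
    define d where "d = e / (2 * (\<bar>C\<bar> + 1))"
    have "d > 0" using \<open>e > 0\<close> by (simp add: d_def)
    have "\<exists>K. \<forall>m\<ge>K. \<forall>p\<ge>K. \<forall>t. norm (r i (t + b (\<sigma> m)) - r i (t + b (\<sigma> p))) < d" if "i < n" for i
    proof -
      have "uniformly_Cauchy_on UNIV (\<lambda>m t. r i (t + b (\<sigma> m)))"
        using \<sigma>(2)[OF that] by (intro uniformly_convergent_Cauchy) (auto simp: uniformly_convergent_on_def)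
      from this[unfolded uniformly_Cauchy_on_def dist_norm, rule_format, OF \<open>d > 0\<close>] show ?thesis by blast
    qed
    then obtain K where K: "\<And>i m p t. i < n \<Longrightarrow> m \<ge> K i \<Longrightarrow> p \<ge> K i \<Longrightarrow> norm (r i (t + b (\<sigma> m)) - r i (t + b (\<sigma> p))) < d"
      by metis
    have "dist (f (t + b (\<sigma> m))) (f (t + b (\<sigma> p))) < e"
      if "m \<ge> Max (insert 0 (K ` {..<n}))" "p \<ge> Max (insert 0 (K ` {..<n}))" for t m p
    proof -
      \<comment> \<open>Two translates of \<open>f\<close> differ by a single translation with
        \<open>c = b (\<sigma> m) - b (\<sigma> p)\<close>, started at
        \<open>t + b (\<sigma> p)\<close>; this puts the Cauchy condition into the form of the third
        assumption.\<close>
      have "norm (r i (s + (b (\<sigma> m) - b (\<sigma> p))) - r i s) \<le> d" if "i < n" for i s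
        using K[of i m p "s - b (\<sigma> p)"] that \<open>m \<ge> _\<close> \<open>p \<ge> _\<close> by (force simp: algebra_simps)
      then have "\<forall>t. norm (f (t + (b (\<sigma> m) - b (\<sigma> p))) - f t) \<le> C * d"
        using \<open>d > 0\<close> by (intro assms(3))
      from this[rule_format, of "t + b (\<sigma> p)"]
      have "norm (f (t + b (\<sigma> m)) - f (t + b (\<sigma> p))) \<le> C * d" by (simp add: algebra_simps)
      also have "\<dots> \<le> \<bar>C\<bar> * d" using \<open>d > 0\<close> by (simp add: mult_right_mono)
      also have "\<dots> < e" using \<open>e > 0\<close> by (simp add: d_def field_simps add_strict_increasing2)
      finally show ?thesis by (simp add: dist_norm)
    qed
    then show "\<exists>M. \<forall>x\<in>UNIV. \<forall>m\<ge>M. \<forall>p\<ge>M. dist (f (x + b (\<sigma> m))) (f (x + b (\<sigma> p))) < e" by blast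
  qed
  then show "\<exists>\<sigma>. strict_mono \<sigma> \<and> (\<exists>l. uniform_limit UNIV (\<lambda>m t. f (t + b (\<sigma> m))) l sequentially)"
    using \<sigma>(1) Cauchy_uniformly_convergent unfolding uniformly_convergent_on_def by blast
qed

section \<open>Lipschitz bounds for Bell polynomials\<close>

lemma norm1_nonneg: "0 \<le> norm1 i X"
  by (simp add: norm1_def sum_nonneg)

lemma norm_le_norm1: "l \<in> {1..i} \<Longrightarrow> norm (X l) \<le> norm1 i X"
  unfolding norm1_def by (rule member_le_sum) auto

lemma norm1_mono: "i \<le> j \<Longrightarrow> norm1 i X \<le> norm1 j X"
  unfolding norm1_def by (rule sum_mono2) auto

lemma norm1_cong: "(\<And>l. l \<in> {1..i} \<Longrightarrow> X l = Y l) \<Longrightarrow> norm1 i X = norm1 i Y"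
  unfolding norm1_def by (rule sum.cong) auto

text \<open>The bound on \<open>p\<close> is carried along because the Lipschitz constant of a
  product involves the bounds of its factors. The constants stay anonymous: they serve only to make
  the supremum in \<open>m_comp\<close> finite.\<close>

definition lipschitz_bounded :: "nat \<Rightarrow> real \<Rightarrow> ((nat \<Rightarrow> complex) \<Rightarrow> complex) \<Rightarrow> bool" where
  "lipschitz_bounded K \<delta> p \<longleftrightarrow> (\<exists>B C. 0 \<le> B \<and> 0 \<le> C \<and> (\<forall>X Y. norm1 K X \<le> \<delta> \<longrightarrow> norm1 K Y \<le> \<delta> \<longrightarrow>
     norm (p X) \<le> B \<and> norm (p X - p Y) \<le> C * norm1 K (\<lambda>l. X l - Y l)))"

lemma lipschitz_bounded_const: "lipschitz_bounded K \<delta> (\<lambda>X. c)"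
  unfolding lipschitz_bounded_def by (intro exI[of _ "norm c"] exI[of _ 0]) auto

lemma lipschitz_bounded_component:
  assumes "l \<in> {1..K}"
  shows "lipschitz_bounded K \<delta> (\<lambda>X. X l)"
proof -
  have "norm (X l) \<le> \<bar>\<delta>\<bar>" if "norm1 K X \<le> \<delta>" for X
    using norm_le_norm1[OF assms, of X] that by linarith
  moreover have "norm (X l - Y l) \<le> 1 * norm1 K (\<lambda>l. X l - Y l)" for X Y
    using norm_le_norm1[OF assms, of "\<lambda>l. X l - Y l"] by simp
  ultimately show ?thesis
    unfolding lipschitz_bounded_def by (intro exI[of _ "\<bar>\<delta>\<bar>"] exI[of _ 1]) auto
qed

lemma lipschitz_bounded_add:
  assumes "lipschitz_bounded K \<delta> p" "lipschitz_bounded K \<delta> q"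
  shows "lipschitz_bounded K \<delta> (\<lambda>X. p X + q X)"
proof -
  obtain B C where B: "0 \<le> B" "0 \<le> C" "\<And>X Y. norm1 K X \<le> \<delta> \<Longrightarrow> norm1 K Y \<le> \<delta> \<Longrightarrow>
     norm (p X) \<le> B \<and> norm (p X - p Y) \<le> C * norm1 K (\<lambda>l. X l - Y l)"
    using assms(1) unfolding lipschitz_bounded_def by blast
  obtain B' C' where B': "0 \<le> B'" "0 \<le> C'" "\<And>X Y. norm1 K X \<le> \<delta> \<Longrightarrow> norm1 K Y \<le> \<delta> \<Longrightarrow>
     norm (q X) \<le> B' \<and> norm (q X - q Y) \<le> C' * norm1 K (\<lambda>l. X l - Y l)"
    using assms(2) unfolding lipschitz_bounded_def by blast
  have "norm (p X + q X) \<le> B + B' \<and> norm (p X + q X - (p Y + q Y)) \<le> (C + C') * norm1 K (\<lambda>l. X l - Y l)"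
    if "norm1 K X \<le> \<delta>" "norm1 K Y \<le> \<delta>" for X Y
    using B(3)[OF that] B'(3)[OF that] norm_triangle_ineq[of "p X" "q X"]
      norm_triangle_ineq[of "p X - p Y" "q X - q Y"] by (simp add: algebra_simps)
  then show ?thesis
    unfolding lipschitz_bounded_def using B(1,2) B'(1,2)
    by (intro exI[of _ "B + B'"] exI[of _ "C + C'"]) auto
qed

lemma lipschitz_bounded_mult:
  assumes "lipschitz_bounded K \<delta> p" "lipschitz_bounded K \<delta> q"
  shows "lipschitz_bounded K \<delta> (\<lambda>X. p X * q X)"
proof -
  obtain B C where B: "0 \<le> B" "0 \<le> C" "\<And>X Y. norm1 K X \<le> \<delta> \<Longrightarrow> norm1 K Y \<le> \<delta> \<Longrightarrow>
     norm (p X) \<le> B \<and> norm (p X - p Y) \<le> C * norm1 K (\<lambda>l. X l - Y l)"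
    using assms(1) unfolding lipschitz_bounded_def by blast
  obtain B' C' where B': "0 \<le> B'" "0 \<le> C'" "\<And>X Y. norm1 K X \<le> \<delta> \<Longrightarrow> norm1 K Y \<le> \<delta> \<Longrightarrow>
     norm (q X) \<le> B' \<and> norm (q X - q Y) \<le> C' * norm1 K (\<lambda>l. X l - Y l)"
    using assms(2) unfolding lipschitz_bounded_def by blast
  have "norm (p X * q X) \<le> B * B' \<and> norm (p X * q X - p Y * q Y) \<le> (B * C' + C * B') * norm1 K (\<lambda>l. X l - Y l)"
    if X: "norm1 K X \<le> \<delta>" and Y: "norm1 K Y \<le> \<delta>" for X Y
  proof
    show "norm (p X * q X) \<le> B * B'"
      unfolding norm_mult using B(3)[OF X Y] B'(3)[OF X Y] B(1) by (intro mult_mono) auto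
    have "p X * q X - p Y * q Y = p X * (q X - q Y) + (p X - p Y) * q Y" by (simp add: algebra_simps)
    also have "norm \<dots> \<le> norm (p X) * norm (q X - q Y) + norm (p X - p Y) * norm (q Y)"
      by (metis norm_mult norm_triangle_ineq)
    also have "\<dots> \<le> B * (C' * norm1 K (\<lambda>l. X l - Y l)) + (C * norm1 K (\<lambda>l. X l - Y l)) * B'"
      using B(3)[OF X Y] B'(3)[OF X Y] B'(3)[OF Y X] B(1,2) B'(1,2)
      by (intro add_mono mult_mono) (auto simp: norm1_nonneg)
    finally show "norm (p X * q X - p Y * q Y) \<le> (B * C' + C * B') * norm1 K (\<lambda>l. X l - Y l)"
      by (simp add: algebra_simps)
  qed
  then show ?thesis
    unfolding lipschitz_bounded_def using B(1,2) B'(1,2)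
    by (intro exI[of _ "B * B'"] exI[of _ "B * C' + C * B'"]) auto
qed

lemma lipschitz_bounded_sum:
  assumes "finite A" "\<And>j. j \<in> A \<Longrightarrow> lipschitz_bounded K \<delta> (p j)"
  shows "lipschitz_bounded K \<delta> (\<lambda>X. \<Sum>j\<in>A. p j X)"
  using assms by (induction A rule: finite_induct) (auto intro: lipschitz_bounded_const lipschitz_bounded_add)

lemma lipschitz_bounded_bell: "i \<le> K \<Longrightarrow> lipschitz_bounded K \<delta> (bell i)"
proof (induction i rule: less_induct)
  case (less i)
  show ?case
  proof (cases i)
    case 0
    have "bell 0 = (\<lambda>X. 1)" by (rule ext) simp
    then show ?thesis using 0 by (simp only: lipschitz_bounded_const)
  next
    case (Suc k)
    have "bell (Suc k) = (\<lambda>X. \<Sum>j\<le>k. of_nat (k choose j) * bell (k - j) X * X (j + 1))"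
      by (rule ext) simp
    moreover have "lipschitz_bounded K \<delta> (\<lambda>X. of_nat (k choose j) * bell (k - j) X * X (j + 1))" if "j \<le> k" for j
    proof -
      have "lipschitz_bounded K \<delta> (bell (k - j))" using less.IH[of "k - j"] less.prems Suc by simp
      then show ?thesis
        using less.prems Suc that
        by (intro lipschitz_bounded_mult lipschitz_bounded_const lipschitz_bounded_component) auto
    qed
    ultimately show ?thesis using Suc by (auto intro: lipschitz_bounded_sum)
  qed
qed

lemma bell_f_eq: "bell_f i X = (\<Sum>j<i. of_nat (i choose j) * bell (i - j) X * X (j + 1))"
  by (simp add: bell_f_def lessThan_Suc_atMost[symmetric])

lemma lipschitz_bounded_bell_f: "lipschitz_bounded i \<delta> (bell_f i)"
proof -
  have "bell_f i = (\<lambda>X. \<Sum>j<i. of_nat (i choose j) * bell (i - j) X * X (j + 1))"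
    by (rule ext) (rule bell_f_eq)
  moreover have "lipschitz_bounded i \<delta> (\<lambda>X. \<Sum>j<i. of_nat (i choose j) * bell (i - j) X * X (j + 1))"
    by (intro lipschitz_bounded_sum lipschitz_bounded_mult lipschitz_bounded_const
        lipschitz_bounded_bell lipschitz_bounded_component) auto
  ultimately show ?thesis by simp
qed

lemma continuous_on_bell:
  assumes "\<And>l. 1 \<le> l \<Longrightarrow> l \<le> i \<Longrightarrow> continuous_on S (x l)"
  shows "continuous_on S (\<lambda>s. bell i (\<lambda>l. x l s))"
  using assms
proof (induction i rule: less_induct)
  case (less i)
  show ?case
  proof (cases i)
    case (Suc k)
    show ?thesis unfolding Suc bell.simps
      by (intro continuous_intros less.IH less.prems) (use Suc in auto)
  qed simp
qed

lemma continuous_on_bell_f: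
  assumes "\<And>l. 1 \<le> l \<Longrightarrow> l \<le> i \<Longrightarrow> continuous_on S (x l)"
  shows "continuous_on S (\<lambda>s. bell_f i (\<lambda>l. x l s))"
  unfolding bell_f_eq by (intro continuous_intros continuous_on_bell assms) auto

lemma bell_zero: "0 < i \<Longrightarrow> bell i (\<lambda>l. 0) = 0"
  by (cases i) auto

lemma bell_f_zero: "bell_f i (\<lambda>l. 0) = 0"
  by (simp add: bell_f_def bell_zero)

lemma bell_eq: "0 < m \<Longrightarrow> bell m x = x m + bell_f (m - 1) x"
  by (simp add: bell_f_def)

lemma bdd_above_m_comp:
  "bdd_above {norm (bell_f i X - bell_f i Y) / norm1 i (\<lambda>l. X l - Y l) | X Y.
     X \<in> ball1 i \<delta> \<and> Y \<in> ball1 i \<delta> \<and> X \<noteq> Y}"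
proof -
  obtain B C where C: "0 \<le> C" "\<And>X Y. norm1 i X \<le> \<delta> \<Longrightarrow> norm1 i Y \<le> \<delta> \<Longrightarrow>
      norm (bell_f i X - bell_f i Y) \<le> C * norm1 i (\<lambda>l. X l - Y l)"
    using lipschitz_bounded_bell_f[of i \<delta>] unfolding lipschitz_bounded_def by blast
  show ?thesis
  proof (rule bdd_aboveI[where M=C], clarify)
    fix X Y assume "X \<in> ball1 i \<delta>" "Y \<in> ball1 i \<delta>"
    then have "norm (bell_f i X - bell_f i Y) \<le> C * norm1 i (\<lambda>l. X l - Y l)"
      by (intro C(2)) (auto simp: ball1_def)
    \<comment> \<open>For a zero denominator the quotient is \<open>0\<close> by convention, which
      \<open>0 \<le> C\<close> covers.\<close>
    then show "norm (bell_f i X - bell_f i Y) / norm1 i (\<lambda>l. X l - Y l) \<le> C"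
      using C(1) norm1_nonneg[of i "\<lambda>l. X l - Y l"]
      by (cases "norm1 i (\<lambda>l. X l - Y l) = 0") (auto simp: divide_le_eq)
  qed
qed

text \<open>\<open>ball1\<close> contains extensional functions only, so arbitrary sequences are
  first restricted to \<open>{1..i}\<close>, which changes neither \<open>bell_f i\<close> nor
  \<open>norm1 i\<close>. Equal coordinates are treated apart since the supremum ranges over
  distinct points.\<close>

lemma bell_f_le_m_comp:
  assumes "norm1 i X < \<delta>" "norm1 i Y < \<delta>"
  shows "norm (bell_f i X - bell_f i Y) \<le> m_comp i \<delta> * norm1 i (\<lambda>l. X l - Y l)"
proof (cases "\<forall>l\<in>{1..i}. X l = Y l")
  case True
  then have "bell_f i X = bell_f i Y" by (intro bell_f_cong) auto
  moreover have "norm1 i (\<lambda>l. X l - Y l) = 0" using True by (simp add: norm1_def)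
  ultimately show ?thesis by simp
next
  case False
  then obtain l where l: "l \<in> {1..i}" "X l \<noteq> Y l" by blast
  then have "0 < norm (X l - Y l)" by simp
  then have pos: "0 < norm1 i (\<lambda>l. X l - Y l)" using norm_le_norm1[OF l(1), of "\<lambda>l. X l - Y l"] by linarith
  let ?X = "restrict X {1..i}" and ?Y = "restrict Y {1..i}"
  have eq: "bell_f i ?X = bell_f i X" "bell_f i ?Y = bell_f i Y"
      "norm1 i (\<lambda>l. ?X l - ?Y l) = norm1 i (\<lambda>l. X l - Y l)" "norm1 i ?X = norm1 i X" "norm1 i ?Y = norm1 i Y"
    by (auto intro!: bell_f_cong norm1_cong)
  have "?X l \<noteq> ?Y l" using l by simp
  then have "?X \<noteq> ?Y" by metis
  have "norm (bell_f i ?X - bell_f i ?Y) / norm1 i (\<lambda>l. ?X l - ?Y l) \<le> m_comp i \<delta>"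
    unfolding m_comp_def
    by (rule cSup_upper[OF _ bdd_above_m_comp], rule CollectI, rule exI[of _ ?X], rule exI[of _ ?Y])
      (use \<open>?X \<noteq> ?Y\<close> assms eq(4,5) in \<open>auto simp: ball1_def\<close>)
  then show ?thesis unfolding eq using pos by (simp add: divide_le_eq)
qed

lemma m_comp_le_m_fun: "i \<in> {2..n} \<Longrightarrow> 0 < \<delta> \<Longrightarrow> m_comp i \<delta> \<le> m_fun n \<delta>"
  by (simp add: m_fun_def)

text \<open>Two points differing only in \<open>x\<^sub>2\<close> show that \<open>f\<^sub>1(x) = x\<^sub>1\<^sup>2\<close>, which the definition of \<open>m\<close>
  leaves out, has a smaller Lipschitz constant than \<open>f\<^sub>2(x) = x\<^sub>1\<^sup>3 + 3 x\<^sub>1 x\<^sub>2\<close>.\<close>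

lemma m_comp_2_ge:
  assumes "0 < \<delta>"
  shows "2 * \<delta> \<le> m_comp 2 \<delta>"
proof -
  \<comment> \<open>Varying \<open>x_2\<close> alone, the difference quotient of \<open>f_2\<close>
    is \<open>3 x_1\<close>. At \<open>x_1 = 2\<delta>/3\<close> this is \<open>2\<delta>\<close>,
    the Lipschitz constant of \<open>x_1^2\<close> on the ball, and
    \<open>2\<delta>/3 + \<delta>/6 < \<delta>\<close> leaves room for the variation.\<close>
  define X where "X = (\<lambda>l::nat. if l = 1 then complex_of_real (2 * \<delta> / 3) else complex_of_real (\<delta> / 6))"
  define Y where "Y = (\<lambda>l::nat. if l = 1 then complex_of_real (2 * \<delta> / 3) else 0)"
  have n: "norm1 2 Z = norm (Z 1) + norm (Z 2)" for Z by (simp add: norm1_def numeral_2_eq_2)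
  have f: "bell_f 2 Z = Z 1 ^ 3 + 3 * Z 1 * Z 2" for Z
    by (simp add: bell_f_eq numeral_2_eq_2 numeral_3_eq_3 algebra_simps)
  have "norm (bell_f 2 X - bell_f 2 Y) \<le> m_comp 2 \<delta> * norm1 2 (\<lambda>l. X l - Y l)"
    using assms by (intro bell_f_le_m_comp) (simp_all add: n X_def Y_def norm_divide norm_mult)
  then have "2 * \<delta> * (\<delta> / 6) \<le> m_comp 2 \<delta> * (\<delta> / 6)"
    using assms by (simp add: n f X_def Y_def norm_divide norm_mult)
  then show ?thesis using assms by simp
qed

lemma m_fun_nonneg:
  assumes "2 \<le> n" "0 \<le> \<delta>"
  shows "0 \<le> m_fun n \<delta>"
proof (cases "\<delta> = 0")
  case False
  then have "0 \<le> 2 * \<delta>" using assms by simp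
  also have "\<dots> \<le> m_comp 2 \<delta>" using False assms by (intro m_comp_2_ge) simp
  also have "\<dots> \<le> m_fun n \<delta>" using False assms by (intro m_comp_le_m_fun) auto
  finally show ?thesis .
qed (simp add: m_fun_def)

text \<open>The source contains \<open>f_1\<close>, whereas \<open>m_fun\<close> is a maximum over
  indices from \<open>2\<close> on. For \<open>i = 1\<close> the difference of squares gives the
  constant \<open>2\<delta>\<close>, which \<open>m_comp_2_ge\<close> absorbs.\<close>

lemma bell_f_le_m_fun_open:
  assumes "2 \<le> n" "1 \<le> i" "i \<le> n" "norm1 i X < \<delta>" "norm1 i Y < \<delta>"
  shows "norm (bell_f i X - bell_f i Y) \<le> m_fun n \<delta> * norm1 i (\<lambda>l. X l - Y l)"
proof -
  have "0 < \<delta>" using assms(4) norm1_nonneg[of i X] by linarith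
  show ?thesis
  proof (cases "i = 1")
    case True
    have n: "norm1 1 Z = norm (Z 1)" for Z by (simp add: norm1_def)
    have "bell_f 1 X - bell_f 1 Y = (X 1 + Y 1) * (X 1 - Y 1)" by (simp add: bell_f_eq algebra_simps)
    then have "norm (bell_f 1 X - bell_f 1 Y) = norm (X 1 + Y 1) * norm (X 1 - Y 1)" by (simp add: norm_mult)
    also have "\<dots> \<le> (2 * \<delta>) * norm (X 1 - Y 1)"
      using assms(4,5) True norm_triangle_ineq[of "X 1" "Y 1"] n[of X] n[of Y] by (intro mult_right_mono) auto
    also have "\<dots> \<le> m_fun n \<delta> * norm (X 1 - Y 1)"
      using m_comp_2_ge[OF \<open>0 < \<delta>\<close>] m_comp_le_m_fun[OF _ \<open>0 < \<delta>\<close>, of 2 n] assms(1)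
      by (intro mult_right_mono) auto
    finally show ?thesis using True by (simp add: norm1_def)
  next
    case False
    have "norm (bell_f i X - bell_f i Y) \<le> m_comp i \<delta> * norm1 i (\<lambda>l. X l - Y l)"
      using assms by (intro bell_f_le_m_comp)
    also have "\<dots> \<le> m_fun n \<delta> * norm1 i (\<lambda>l. X l - Y l)"
      using False assms \<open>0 < \<delta>\<close> by (intro mult_right_mono m_comp_le_m_fun norm1_nonneg) auto
    finally show ?thesis .
  qed
qed

text \<open>The constant \<open>m(\<delta>)\<close> refers to the open ball; scaling by \<open>s < 1\<close> and letting \<open>s \<rightarrow> 1\<close> extends
  the estimate to the closed ball, in which the fixed point lives.\<close>

lemma bell_f_le_m_fun:
  assumes "2 \<le> n" "1 \<le> i" "i \<le> n" "0 < \<delta>" "norm1 i X \<le> \<delta>" "norm1 i Y \<le> \<delta>"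
  shows "norm (bell_f i X - bell_f i Y) \<le> m_fun n \<delta> * norm1 i (\<lambda>l. X l - Y l)"
proof -
  define p where "p s = norm (bell_f i (\<lambda>l. complex_of_real s * X l) - bell_f i (\<lambda>l. complex_of_real s * Y l))" for s
  have sc: "norm1 i (\<lambda>l. complex_of_real s * Z l) = s * norm1 i Z" if "0 < s" for s Z
    using that by (simp add: norm1_def norm_mult sum_distrib_left)
  have le: "p s \<le> m_fun n \<delta> * norm1 i (\<lambda>l. X l - Y l)" if "0 < s" "s < 1" for s
  proof -
    have "s * norm1 i Z < \<delta>" if "norm1 i Z \<le> \<delta>" for Z
    proof -
      have "s * norm1 i Z \<le> s * \<delta>" using that \<open>0 < s\<close> by simp
      also have "\<dots> < \<delta>" using \<open>s < 1\<close> \<open>0 < \<delta>\<close> by simp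
      finally show ?thesis .
    qed
    then have "p s \<le> m_fun n \<delta> * norm1 i (\<lambda>l. complex_of_real s * X l - complex_of_real s * Y l)"
      unfolding p_def using assms that by (intro bell_f_le_m_fun_open) (auto simp: sc)
    also have "\<dots> = s * (m_fun n \<delta> * norm1 i (\<lambda>l. X l - Y l))"
      using sc[of s "\<lambda>l. X l - Y l"] that by (simp add: right_diff_distrib)
    also have "\<dots> \<le> 1 * (m_fun n \<delta> * norm1 i (\<lambda>l. X l - Y l))"
      using that m_fun_nonneg[of n \<delta>] assms norm1_nonneg by (intro mult_right_mono mult_nonneg_nonneg) auto
    finally show ?thesis by simp
  qed
  have "continuous_on UNIV p"
    unfolding p_def by (intro continuous_intros continuous_on_bell_f)
  then have "(p \<longlongrightarrow> p 1) (at_left 1)"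
    by (auto simp: continuous_on_def intro: tendsto_within_subset)
  moreover have "eventually (\<lambda>s::real. p s \<le> m_fun n \<delta> * norm1 i (\<lambda>l. X l - Y l)) (at_left 1)"
    using eventually_at_left_real[of 0 "1::real"] by (auto elim!: eventually_mono intro: le)
  ultimately have "p 1 \<le> m_fun n \<delta> * norm1 i (\<lambda>l. X l - Y l)"
    by (intro tendsto_upperbound) auto
  then show ?thesis by (simp add: p_def)
qed

lemma norm_bell_f_le:
  assumes "2 \<le> n" "1 \<le> i" "i \<le> n" "0 < \<delta>" "norm1 i X \<le> \<delta>"
  shows "norm (bell_f i X) \<le> m_fun n \<delta> * norm1 i X"
  using bell_f_le_m_fun[OF assms, of "\<lambda>l. 0"] assms(4) by (simp add: bell_f_zero norm1_def)

section \<open>Interpolation and Taylor coefficients\<close>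

lemma coeff_prod_linear_factors:
  fixes g :: "'b \<Rightarrow> 'a :: field"
  assumes "finite J"
  shows "Polynomial.coeff (\<Prod>l\<in>J. [:- g l, 1:]) (card J) = 1"
    and "Polynomial.degree (\<Prod>l\<in>J. [:- g l, 1:]) = card J"
proof -
  show deg: "Polynomial.degree (\<Prod>l\<in>J. [:- g l, 1:]) = card J"
    by (subst degree_prod_sum_eq) auto
  show "Polynomial.coeff (\<Prod>l\<in>J. [:- g l, 1:]) (card J) = 1"
    using lead_coeff_prod[of "\<lambda>l. [:- g l, 1:]" J] unfolding deg by simp
qed

lemma lagrange_interpolation:
  fixes g :: "'b \<Rightarrow> 'a :: field"
  assumes J: "finite J" "inj_on g J" and deg: "Polynomial.degree p < card J"
  shows "p = (\<Sum>j\<in>J. Polynomial.smult (poly p (g j) / (\<Prod>l\<in>J - {j}. g j - g l))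
    (\<Prod>l\<in>J - {j}. [:- g l, 1:]))" (is "p = ?q")
proof (rule poly_eqI_degree[of "g ` J"])
  have "card J > 0" using deg by simp
  show "Polynomial.degree p < card (g ` J)" using deg J by (simp add: card_image)
  have "Polynomial.degree ?q \<le> card J - 1"
    using J by (intro degree_sum_le) (auto intro!: order_trans[OF degree_smult_le] simp: coeff_prod_linear_factors(2))
  then show "Polynomial.degree ?q < card (g ` J)" using \<open>card J > 0\<close> J by (simp add: card_image)
  fix x assume "x \<in> g ` J"
  then obtain i where i: "i \<in> J" "x = g i" by blast
  have nz: "(\<Prod>l\<in>J - {i}. g i - g l) \<noteq> 0" using J i by (auto simp: inj_on_def)
  have "poly ?q x = (\<Sum>j\<in>J. poly p (g j) / (\<Prod>l\<in>J - {j}. g j - g l) * (\<Prod>l\<in>J - {j}. g i - g l))"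
    by (simp add: poly_sum poly_prod i(2))
  also have "\<dots> = (\<Sum>j\<in>J. if j = i then poly p (g i) else 0)"
  proof (rule sum.cong)
    fix j assume "j \<in> J"
    then show "poly p (g j) / (\<Prod>l\<in>J - {j}. g j - g l) * (\<Prod>l\<in>J - {j}. g i - g l)
        = (if j = i then poly p (g i) else 0)"
      using i nz J(1) by auto
  qed simp
  also have "\<dots> = poly p x" using i J by simp
  finally show "poly p x = poly ?q x" by simp
qed

text \<open>Interpolation reproduces the monomial of degree \<open>i\<close>; the identity compares
  the coefficients of degree \<open>card J - 1\<close> on both sides.\<close>

lemma sum_power_divide_prod_diff:
  fixes g :: "'b \<Rightarrow> 'a :: field"
  assumes J: "finite J" "inj_on g J" and i: "i < card J"
  shows "(\<Sum>j\<in>J. g j ^ i / (\<Prod>l\<in>J - {j}. g j - g l)) = (if i = card J - 1 then 1 else 0)"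
proof -
  have "Polynomial.coeff (Polynomial.monom (1::'a) i) (card J - 1) =
    (\<Sum>j\<in>J. g j ^ i / (\<Prod>l\<in>J - {j}. g j - g l) * Polynomial.coeff (\<Prod>l\<in>J - {j}. [:- g l, 1:]) (card J - 1))"
    using i by (subst lagrange_interpolation[OF J]) (auto simp: degree_monom_eq coeff_sum poly_monom)
  also have "\<dots> = (\<Sum>j\<in>J. g j ^ i / (\<Prod>l\<in>J - {j}. g j - g l))"
  proof (rule sum.cong)
    fix j assume "j \<in> J"
    then show "g j ^ i / (\<Prod>l\<in>J - {j}. g j - g l) * Polynomial.coeff (\<Prod>l\<in>J - {j}. [:- g l, 1:]) (card J - 1)
      = g j ^ i / (\<Prod>l\<in>J - {j}. g j - g l)"
      using coeff_prod_linear_factors(1)[of "J - {j}" g] J(1) by simp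
  qed simp
  finally show ?thesis by simp
qed

text \<open>The interpolation polynomial of the constant \<open>1\<close>, evaluated at
  \<open>0\<close>; the omitted factor of each product is restored as
  \<open>g j / g j\<close>.\<close>

lemma sum_inverse_divide_prod_diff:
  fixes g :: "'b \<Rightarrow> 'a :: field"
  assumes J: "finite J" "inj_on g J" "J \<noteq> {}" and nz: "\<And>j. j \<in> J \<Longrightarrow> g j \<noteq> 0"
  shows "(\<Sum>j\<in>J. 1 / ((\<Prod>l\<in>J - {j}. g j - g l) * g j)) = (- 1) ^ (card J + 1) * (\<Prod>j\<in>J. inverse (g j))"
proof -
  let ?\<Gamma> = "\<lambda>j. \<Prod>l\<in>J - {j}. g j - g l"
  have "card J > 0" using J by (simp add: card_gt_0_iff)
  then have "poly 1 (0::'a) = poly (\<Sum>j\<in>J. Polynomial.smult (poly 1 (g j) / ?\<Gamma> j) (\<Prod>l\<in>J - {j}. [:- g l, 1:])) 0"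
    by (subst lagrange_interpolation[OF J(1,2)]) auto
  then have "1 = (\<Sum>j\<in>J. 1 / ?\<Gamma> j * (\<Prod>l\<in>J - {j}. - g l))"
    by (simp add: poly_sum poly_prod)
  also have "\<dots> = (\<Sum>j\<in>J. 1 / (?\<Gamma> j * g j) * ((- 1) ^ (card J + 1) * (\<Prod>j\<in>J. g j)))"
  proof (rule sum.cong)
    fix j assume j: "j \<in> J"
    have "(\<Prod>l\<in>J - {j}. - g l) = (- 1) ^ (card J - 1) * (\<Prod>l\<in>J - {j}. g l)"
      using prod.distrib[of "\<lambda>_. - 1" g "J - {j}"] j J(1) by simp
    moreover have "(- 1 :: 'a) ^ (card J + 1) = (- 1) ^ (card J - 1)"
      using \<open>card J > 0\<close> by (cases "card J") auto
    moreover have "(\<Prod>l\<in>J. g l) = g j * (\<Prod>l\<in>J - {j}. g l)"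
      using J(1) j by (rule prod.remove)
    ultimately show "1 / ?\<Gamma> j * (\<Prod>l\<in>J - {j}. - g l) = 1 / (?\<Gamma> j * g j) * ((- 1) ^ (card J + 1) * (\<Prod>j\<in>J. g j))"
      using nz[OF j] by (simp add: field_simps)
  qed simp
  also have "\<dots> = (\<Sum>j\<in>J. 1 / (?\<Gamma> j * g j)) * ((- 1) ^ (card J + 1) * (\<Prod>j\<in>J. g j))"
    by (simp only: sum_distrib_right)
  finally have one: "1 = (\<Sum>j\<in>J. 1 / (?\<Gamma> j * g j)) * ((- 1) ^ (card J + 1) * (\<Prod>j\<in>J. g j))" .
  define S where "S = (\<Sum>j\<in>J. 1 / (?\<Gamma> j * g j))"
  define E :: 'a where "E = (- 1) ^ (card J + 1)"
  define P where "P = (\<Prod>j\<in>J. g j)"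
  have "E * E = 1" unfolding E_def by (simp flip: power_mult_distrib)
  moreover have "P * inverse P = 1" using nz J(1) by (simp add: P_def)
  moreover have "E * inverse P = (E * inverse P) * (S * (E * P))"
    using one unfolding S_def E_def P_def by simp
  moreover have "\<dots> = S * (E * E) * (P * inverse P)" by (simp only: ac_simps)
  ultimately have "S = E * inverse P" by simp
  then show ?thesis by (simp add: S_def E_def P_def prod_inversef[symmetric] o_def)
qed

lemma coeff_Ppoly: "Polynomial.coeff (Ppoly n c) i = (if i \<le> n then c i else 0)"
  by (simp add: Ppoly_def coeff_sum)

text \<open>The derivatives in \<open>D_op\<close> and \<open>L_op\<close> and the binomial sums in
  \<open>F_op\<close> are thereby recognized as the same Taylor coefficients, up to the
  factorial.\<close>

lemma Pder_eq:
  assumes "m \<le> n"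
  shows "Pder n m c x = fact m * (\<Sum>j=0..n-m. of_nat ((m + j) choose j) * c (m + j) * x ^ j)"
proof -
  have "(pderiv ^^ m) (Ppoly n c) = (\<Sum>j=0..n-m. Polynomial.monom (fact m * (of_nat ((m + j) choose j) * c (m + j))) j)"
  proof (rule poly_eqI)
    fix k
    have "pochhammer (1 + of_nat k) m = (fact m * of_nat ((m + k) choose k) :: complex)"
    proof -
      have "pochhammer (1 + of_nat k) m * fact k = (fact (m + k) :: complex)"
        by (simp add: pochhammer_fact pochhammer_product'[of 1 k m] add.commute)
      moreover have "(fact (m + k) :: complex) = of_nat (fact k * fact m * ((m + k) choose k))"
        using binomial_fact_lemma[of k "m + k"] by simp
      ultimately show ?thesis by (simp add: ac_simps)
    qed
    then have "Polynomial.coeff ((pderiv ^^ m) (Ppoly n c)) k =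
        (if k \<le> n - m then fact m * (of_nat ((m + k) choose k) * c (m + k)) else 0)"
      using assms by (auto simp: coeff_higher_pderiv coeff_Ppoly add.commute[of k m])
    then show "Polynomial.coeff ((pderiv ^^ m) (Ppoly n c)) k =
        Polynomial.coeff (\<Sum>j=0..n-m. Polynomial.monom (fact m * (of_nat ((m + j) choose j) * c (m + j))) j) k"
      by (simp add: coeff_sum)
  qed
  then show ?thesis
    unfolding Pder_def by (simp add: poly_sum poly_monom sum_distrib_left mult.assoc)
qed

text \<open>Sorting by \<open>m = i - j\<close>. The sequence \<open>B\<close> is arbitrary so that
  one rearrangement serves both the Taylor formula, with powers of \<open>h\<close>, and the
  differential equation, with Bell polynomials.\<close>

lemma sum_shift_binomial:
  fixes c B :: "nat \<Rightarrow> complex"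
  shows "(\<Sum>i\<le>n. c i * (\<Sum>j\<le>i. of_nat (i choose j) * x ^ j * B (i - j))) =
    (\<Sum>m\<le>n. (\<Sum>j=0..n-m. of_nat ((m + j) choose j) * c (m + j) * x ^ j) * B m)"
proof -
  have "(\<Sum>i\<le>n. c i * (\<Sum>j\<le>i. of_nat (i choose j) * x ^ j * B (i - j))) =
      (\<Sum>(i, j)\<in>(SIGMA i:{..n}. {..i}). of_nat (i choose j) * c i * x ^ j * B (i - j))"
    by (simp add: sum.Sigma sum_distrib_left ac_simps)
  also have "\<dots> = (\<Sum>(m, j)\<in>(SIGMA m:{..n}. {0..n-m}). of_nat ((m + j) choose j) * c (m + j) * x ^ j * B m)"
    by (rule sum.reindex_bij_witness[of _ "\<lambda>(m, j). (m + j, j)" "\<lambda>(i, j). (i - j, j)"]) auto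
  also have "\<dots> = (\<Sum>m\<le>n. (\<Sum>j=0..n-m. of_nat ((m + j) choose j) * c (m + j) * x ^ j) * B m)"
    by (simp add: sum.Sigma sum_distrib_right)
  finally show ?thesis .
qed

lemma poly_Ppoly: "poly (Ppoly n c) x = (\<Sum>i\<le>n. c i * x ^ i)"
  by (simp add: Ppoly_def poly_sum poly_monom)

lemma taylor_Ppoly: "poly (Ppoly n c) (x + h) = (\<Sum>m\<le>n. Pder n m c x / fact m * h ^ m)"
proof -
  have "poly (Ppoly n c) (x + h) = (\<Sum>i\<le>n. c i * (\<Sum>j\<le>i. of_nat (i choose j) * x ^ j * h ^ (i - j)))"
    by (simp add: poly_Ppoly binomial_ring)
  also have "\<dots> = (\<Sum>m\<le>n. Pder n m c x / fact m * h ^ m)"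
    unfolding sum_shift_binomial by (intro sum.cong) (simp_all add: Pder_eq)
  finally show ?thesis .
qed

section \<open>Iterated derivatives\<close>

text \<open>The factors are families of candidate derivatives instead of functions, so that the
  product rule applies before these families are known to be iterated derivatives.\<close>

definition leibniz :: "(nat \<Rightarrow> real \<Rightarrow> complex) \<Rightarrow> (nat \<Rightarrow> real \<Rightarrow> complex) \<Rightarrow> nat \<Rightarrow> real \<Rightarrow> complex" where
  "leibniz u v i t = (\<Sum>j\<le>i. of_nat (i choose j) * u (i - j) t * v j t)"

lemma leibniz_has_vector_derivative:
  assumes "\<And>j. j \<le> i \<Longrightarrow> (u j has_vector_derivative u (Suc j) t) (at t)"
    and "\<And>j. j \<le> i \<Longrightarrow> (v j has_vector_derivative v (Suc j) t) (at t)"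
  shows "(leibniz u v i has_vector_derivative leibniz u v (Suc i) t) (at t)"
proof -
  have "((\<lambda>t. \<Sum>j\<le>i. of_nat (i choose j) * (u (i - j) t * v j t)) has_vector_derivative
      (\<Sum>j\<le>i. of_nat (i choose j) * (u (i - j) t * v (Suc j) t + u (Suc (i - j)) t * v j t))) (at t)"
    by (intro derivative_intros assms) auto
  moreover have "(\<Sum>j\<le>i. of_nat (i choose j) * (u (i - j) t * v (Suc j) t + u (Suc (i - j)) t * v j t)) =
      leibniz u v (Suc i) t"
  proof -
    have "leibniz u v (Suc i) t = u (Suc i) t * v 0 t +
        (\<Sum>j\<le>i. of_nat ((i choose Suc j) + (i choose j)) * u (i - j) t * v (Suc j) t)"
      unfolding leibniz_def sum.atMost_Suc_shift by (simp add: add.commute)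
    also have "\<dots> = (u (Suc i) t * v 0 t + (\<Sum>j\<le>i. of_nat (i choose Suc j) * u (i - j) t * v (Suc j) t))
        + (\<Sum>j\<le>i. of_nat (i choose j) * u (i - j) t * v (Suc j) t)"
      by (simp add: algebra_simps sum.distrib)
    also have "u (Suc i) t * v 0 t + (\<Sum>j\<le>i. of_nat (i choose Suc j) * u (i - j) t * v (Suc j) t) =
        (\<Sum>j\<le>Suc i. of_nat (i choose j) * u (Suc i - j) t * v j t)"
      unfolding sum.atMost_Suc_shift by simp
    also have "\<dots> = (\<Sum>j\<le>i. of_nat (i choose j) * u (Suc (i - j)) t * v j t)"
      by (simp add: Suc_diff_le)
    finally show ?thesis by (simp add: sum.distrib algebra_simps)
  qed
  ultimately show ?thesis by (simp add: leibniz_def[abs_def] mult.assoc)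
qed

text \<open>\<open>nderiv\<close> is never computed directly: an explicit family in which each
  member is the derivative of the preceding one determines it and yields differentiability as
  well.\<close>

lemma nderiv_chain:
  assumes "\<And>i t. i < m \<Longrightarrow> (x i has_vector_derivative x (Suc i) t) (at t)"
  shows "i \<le> m \<Longrightarrow> nderiv i (x 0) = x i" and "times_differentiable m (x 0)"
proof -
  show *: "nderiv i (x 0) = x i" if "i \<le> m" for i
    using that
  proof (induction i)
    case (Suc i)
    have "nderiv (Suc i) (x 0) = (\<lambda>t. vector_derivative (nderiv i (x 0)) (at t))"
      by (simp add: nderiv_def)
    also have "\<dots> = x (Suc i)"
      using Suc assms[of i] by (auto intro!: vector_derivative_at)
    finally show ?case .
  qed (simp add: nderiv_def)
  show "times_differentiable m (x 0)"
    unfolding times_differentiable_def using * assms by (auto intro: differentiableI_vector)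
qed

section \<open>Perturbations of the Vandermonde matrix\<close>

text \<open>The rows of the inverse are the coefficient vectors of the Lagrange basis polynomials.
  They show that \<open>mat_inverse\<close> succeeds; the identity is then stated for its result
  \<open>B\<close>, because the smallness hypothesis speaks of that matrix.\<close>

lemma vandermonde_inverse:
  assumes "inj_on lam {1..n}"
  obtains B where "mat_inverse (vandermonde n lam) = Some B" "B \<in> carrier_mat n n"
    "\<And>i j. i < n \<Longrightarrow> j < n \<Longrightarrow> (\<Sum>l<n. B $$ (i, l) * lam (j + 1) ^ l) = (if i = j then 1 else 0)"
proof -
  define L where "L i = Polynomial.smult (1 / (\<Prod>l\<in>{1..n} - {i}. lam i - lam l)) (\<Prod>l\<in>{1..n} - {i}. [:- lam l, 1:])" for i
  define C where "C = Matrix.mat n n (\<lambda>(i, l). Polynomial.coeff (L (i + 1)) l)"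
  have V: "vandermonde n lam \<in> carrier_mat n n" and C: "C \<in> carrier_mat n n"
    by (simp_all add: vandermonde_def C_def)
  have "(C * vandermonde n lam) $$ (i, j) = 1\<^sub>m n $$ (i, j)" if "i < n" "j < n" for i j
  proof -
    have "Polynomial.degree (L (i + 1)) \<le> n - 1"
      using coeff_prod_linear_factors(2)[of "{1..n} - {i + 1}" lam] that
      unfolding L_def by (intro order_trans[OF degree_smult_le]) simp
    then have deg: "Polynomial.degree (L (i + 1)) < n" using that by simp
    have "(C * vandermonde n lam) $$ (i, j) = (\<Sum>l<n. Polynomial.coeff (L (i + 1)) l * lam (j + 1) ^ l)"
      using that by (simp add: C_def vandermonde_def scalar_prod_def atLeast0LessThan)
    also have "\<dots> = poly (L (i + 1)) (lam (j + 1))"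
      unfolding poly_altdef
    proof (rule sum.mono_neutral_right)
      show "{..Polynomial.degree (L (i + 1))} \<subseteq> {..<n}" using deg by auto
      show "\<forall>l\<in>{..<n} - {..Polynomial.degree (L (i + 1))}. Polynomial.coeff (L (i + 1)) l * lam (j + 1) ^ l = 0"
        by (simp add: coeff_eq_0)
    qed simp
    also have "\<dots> = (if i = j then 1 else 0)"
    proof -
      have "(\<Prod>l\<in>{1..n} - {i + 1}. lam (j + 1) - lam l) = 0" if "i \<noteq> j"
        by (rule prod_zero) (use that \<open>j < n\<close> in \<open>auto intro!: bexI[of _ "j + 1"]\<close>)
      moreover have "(\<Prod>l\<in>{1..n} - {i + 1}. lam (i + 1) - lam l) \<noteq> 0"
      proof -
        have "lam (i + 1) - lam l \<noteq> 0" if "l \<in> {1..n} - {i + 1}" for l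
          using inj_onD[OF assms, of "i + 1" l] \<open>i < n\<close> that by auto
        then show ?thesis by (subst prod_zero_iff) auto
      qed
      moreover have "poly (L (i + 1)) (lam (j + 1)) =
          (\<Prod>l\<in>{1..n} - {i + 1}. lam (j + 1) - lam l) / (\<Prod>l\<in>{1..n} - {i + 1}. lam (i + 1) - lam l)"
        by (simp add: L_def poly_prod)
      ultimately show ?thesis by (cases "i = j") simp_all
    qed
    finally show ?thesis using that by simp
  qed
  then have CV: "C * vandermonde n lam = 1\<^sub>m n"
    by (intro eq_matI) (auto simp: C_def vandermonde_def)
  have "mat_inverse (vandermonde n lam) \<noteq> None"
  proof
    assume "mat_inverse (vandermonde n lam) = None"
    then have "vandermonde n lam \<notin> Units (ring_mat TYPE(complex) n ())"
      using mat_inverse(1)[OF V, where b = "()"] by simp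
    moreover have "vandermonde n lam * C = 1\<^sub>m n" by (rule mat_mult_left_right_inverse[OF C V CV])
    ultimately show False using V C CV by (auto simp: Units_def ring_mat_def)
  qed
  then obtain B where B: "mat_inverse (vandermonde n lam) = Some B" by blast
  note inv = mat_inverse(2)[OF V B]
  have "(\<Sum>l<n. B $$ (i, l) * lam (j + 1) ^ l) = (if i = j then 1 else 0)" if "i < n" "j < n" for i j
  proof -
    have "B \<in> carrier_mat n n" using inv by blast
    then have "(\<Sum>l<n. B $$ (i, l) * lam (j + 1) ^ l) = (B * vandermonde n lam) $$ (i, j)"
      using that by (auto simp: vandermonde_def scalar_prod_def atLeast0LessThan)
    then show ?thesis using inv that by simp
  qed
  then show ?thesis using that B inv by blast
qed

text \<open>If the perturbed matrix annihilates \<open>p\<close>, then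
  \<open>p = - V^-1 (\<beta> - V) p\<close>, and taking 1-norms gives a bound of \<open>p\<close> by
  a multiple of itself with factor \<open>E * N < 1\<close>. Since the 1-norm of a matrix is a
  maximum over columns, \<open>E\<close> has to bound the perturbation column by column.\<close>

lemma perturbed_vandermonde:
  assumes lam: "inj_on lam {1..n}" and n: "0 < n"
    and small: "E * mat_norm1 (the (mat_inverse (vandermonde n lam))) < 1"
    and \<beta>: "\<And>k. k \<in> {1..n} \<Longrightarrow> (\<Sum>l<n. norm (\<beta> k l - lam k ^ l)) \<le> E"
    and p: "\<And>l. l < n \<Longrightarrow> (\<Sum>k=1..n. p k * \<beta> k l) = 0"
    and k: "k \<in> {1..n}"
  shows "p k = 0"
proof -
  obtain B where B: "mat_inverse (vandermonde n lam) = Some B" "B \<in> carrier_mat n n"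
    and inv: "\<And>i j. i < n \<Longrightarrow> j < n \<Longrightarrow> (\<Sum>l<n. B $$ (i, l) * lam (j + 1) ^ l) = (if i = j then 1 else 0)"
    using vandermonde_inverse[OF lam] by blast
  define N where "N = mat_norm1 B"
  have col: "(\<Sum>i<n. norm (B $$ (i, l))) \<le> N" if "l < n" for l
    unfolding N_def mat_norm1_def using B(2) that by (intro Max_ge) auto
  have N0: "0 \<le> N" using col[OF n] sum_nonneg[of "{..<n}" "\<lambda>i. norm (B $$ (i, 0))"] by simp
  define S where "S = (\<Sum>j<n. norm (p (j + 1)))"
  have shift: "(\<Sum>k=1..n. f k) = (\<Sum>j<n. f (j + 1))" for f :: "nat \<Rightarrow> complex"
    by (rule sum.reindex_bij_witness[of _ "\<lambda>j. j + 1" "\<lambda>k. k - 1"]) auto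
  have p_eq: "p (i + 1) = - (\<Sum>l<n. B $$ (i, l) * (\<Sum>j<n. p (j + 1) * (\<beta> (j + 1) l - lam (j + 1) ^ l)))"
    if i: "i < n" for i
  proof -
    have "p (i + 1) = (\<Sum>j<n. p (j + 1) * (if i = j then 1 else 0))"
      using i by (simp add: if_distrib cong: if_cong)
    also have "\<dots> = (\<Sum>j<n. p (j + 1) * (\<Sum>l<n. B $$ (i, l) * lam (j + 1) ^ l))"
      by (rule sum.cong) (use inv i in auto)
    also have "\<dots> = (\<Sum>j<n. \<Sum>l<n. B $$ (i, l) * (p (j + 1) * lam (j + 1) ^ l))"
      by (simp only: sum_distrib_left mult.left_commute)
    also have "\<dots> = (\<Sum>l<n. \<Sum>j<n. B $$ (i, l) * (p (j + 1) * lam (j + 1) ^ l))" by (rule sum.swap)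
    also have "\<dots> = (\<Sum>l<n. - (B $$ (i, l) * (\<Sum>j<n. p (j + 1) * (\<beta> (j + 1) l - lam (j + 1) ^ l))))"
    proof (rule sum.cong[OF refl])
      fix l assume "l \<in> {..<n}"
      then have "(\<Sum>j<n. p (j + 1) * \<beta> (j + 1) l) = 0" using p[of l] shift[of "\<lambda>k. p k * \<beta> k l"] by simp
      then have "(\<Sum>j<n. p (j + 1) * (\<beta> (j + 1) l - lam (j + 1) ^ l)) = - (\<Sum>j<n. p (j + 1) * lam (j + 1) ^ l)"
        by (simp add: right_diff_distrib sum_subtractf)
      then show "(\<Sum>j<n. B $$ (i, l) * (p (j + 1) * lam (j + 1) ^ l)) =
          - (B $$ (i, l) * (\<Sum>j<n. p (j + 1) * (\<beta> (j + 1) l - lam (j + 1) ^ l)))"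
        by (simp add: sum_distrib_left)
    qed
    also have "\<dots> = - (\<Sum>l<n. B $$ (i, l) * (\<Sum>j<n. p (j + 1) * (\<beta> (j + 1) l - lam (j + 1) ^ l)))"
      by (rule sum_negf)
    finally show ?thesis .
  qed
  let ?e = "\<lambda>j l. norm (p (j + 1)) * norm (\<beta> (j + 1) l - lam (j + 1) ^ l)"
  have "S \<le> (\<Sum>i<n. \<Sum>l<n. norm (B $$ (i, l)) * (\<Sum>j<n. ?e j l))"
    unfolding S_def
  proof (rule sum_mono)
    fix i assume "i \<in> {..<n}"
    then have "norm (p (i + 1)) = norm (\<Sum>l<n. B $$ (i, l) * (\<Sum>j<n. p (j + 1) * (\<beta> (j + 1) l - lam (j + 1) ^ l)))"
      by (simp only: p_eq lessThan_iff norm_minus_cancel)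
    also have "\<dots> \<le> (\<Sum>l<n. norm (B $$ (i, l)) * (\<Sum>j<n. ?e j l))"
    proof (rule sum_norm_le)
      fix l
      have "norm (\<Sum>j<n. p (j + 1) * (\<beta> (j + 1) l - lam (j + 1) ^ l)) \<le> (\<Sum>j<n. ?e j l)"
        by (rule sum_norm_le) (simp only: norm_mult order_refl)
      then show "norm (B $$ (i, l) * (\<Sum>j<n. p (j + 1) * (\<beta> (j + 1) l - lam (j + 1) ^ l))) \<le> norm (B $$ (i, l)) * (\<Sum>j<n. ?e j l)"
        unfolding norm_mult by (rule mult_left_mono) simp
    qed
    finally show "norm (p (i + 1)) \<le> (\<Sum>l<n. norm (B $$ (i, l)) * (\<Sum>j<n. ?e j l))" .
  qed
  also have "\<dots> = (\<Sum>l<n. (\<Sum>i<n. norm (B $$ (i, l))) * (\<Sum>j<n. ?e j l))"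
    by (subst sum.swap) (simp only: sum_distrib_right)
  also have "\<dots> \<le> (\<Sum>l<n. N * (\<Sum>j<n. ?e j l))"
    by (intro sum_mono mult_right_mono col sum_nonneg) auto
  also have "\<dots> = N * (\<Sum>l<n. \<Sum>j<n. ?e j l)" by (simp only: sum_distrib_left)
  also have "(\<Sum>l<n. \<Sum>j<n. ?e j l) = (\<Sum>j<n. \<Sum>l<n. ?e j l)" by (rule sum.swap)
  also have "N * (\<Sum>j<n. \<Sum>l<n. ?e j l) \<le> N * (\<Sum>j<n. norm (p (j + 1)) * E)"
  proof (intro mult_left_mono sum_mono N0)
    fix j assume "j \<in> {..<n}"
    then show "(\<Sum>l<n. ?e j l) \<le> norm (p (j + 1)) * E"
      unfolding sum_distrib_left[symmetric] by (intro mult_left_mono \<beta>) auto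
  qed
  also have "\<dots> = (E * N) * S" unfolding S_def sum_distrib_right[symmetric] by (simp only: mult_ac)
  finally have "S \<le> (E * N) * S" .
  moreover have "E * N < 1" using small by (simp add: B(1) N_def)
  moreover have S0: "0 \<le> S" unfolding S_def by (simp add: sum_nonneg)
  ultimately have "S = 0" by (metis mult_le_cancel_right1 not_less order_antisym)
  then have "norm (p (j + 1)) = 0" if "j < n" for j
    unfolding S_def using that by (simp add: sum_nonneg_eq_0_iff)
  from this[of "k - 1"] show ?thesis using k by auto
qed

section \<open>Bounded continuous functions\<close>

text \<open>On this class all Green integrals converge, and it is closed under the operations that
  build the source from coefficients and jet.\<close>

definition bcont :: "(real \<Rightarrow> 'a::real_normed_vector) \<Rightarrow> bool" where
  "bcont f \<longleftrightarrow> continuous_on UNIV f \<and> (\<exists>B. \<forall>s. norm (f s) \<le> B)"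

lemma bcontE:
  assumes "bcont f"
  obtains B where "continuous_on UNIV f" "\<And>s. norm (f s) \<le> B"
  using assms unfolding bcont_def by blast

lemma bcont_const: "bcont (\<lambda>s. c)"
  unfolding bcont_def by (auto intro: exI[of _ "norm c"])

lemma bcont_add:
  assumes "bcont f" "bcont g"
  shows "bcont (\<lambda>s. f s + g s)"
proof -
  obtain B C where "continuous_on UNIV f" "\<And>s. norm (f s) \<le> B" "continuous_on UNIV g" "\<And>s. norm (g s) \<le> C"
    using assms by (metis bcontE)
  then show ?thesis
    unfolding bcont_def by (auto intro!: exI[of _ "B + C"] continuous_intros order_trans[OF norm_triangle_ineq] add_mono)
qed

lemma bcont_mult:
  fixes f g :: "real \<Rightarrow> 'a::real_normed_algebra"
  assumes "bcont f" "bcont g"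
  shows "bcont (\<lambda>s. f s * g s)"
proof -
  obtain B C where *: "continuous_on UNIV f" "\<And>s. norm (f s) \<le> B" "continuous_on UNIV g" "\<And>s. norm (g s) \<le> C"
    using assms by (metis bcontE)
  have "norm (f s * g s) \<le> \<bar>B\<bar> * \<bar>C\<bar>" for s
    using *(2)[of s] *(4)[of s] by (intro order_trans[OF norm_mult_ineq] mult_mono) auto
  then show ?thesis
    unfolding bcont_def using * by (auto intro!: continuous_intros)
qed

lemma bcont_sum: "(\<And>j. j \<in> A \<Longrightarrow> bcont (f j)) \<Longrightarrow> bcont (\<lambda>s. \<Sum>j\<in>A. f j s)"
  by (induction A rule: infinite_finite_induct) (auto intro: bcont_const bcont_add)

lemma bcont_norm: "bcont f \<Longrightarrow> bcont (\<lambda>s. norm (f s))"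
  unfolding bcont_def by (auto intro: continuous_intros)

lemma bcont_minus: "bcont f \<Longrightarrow> bcont (\<lambda>s. - f s)"
  unfolding bcont_def by (auto intro: continuous_intros)

lemma bcont_diff: "bcont f \<Longrightarrow> bcont g \<Longrightarrow> bcont (\<lambda>s. f s - g s)"
  using bcont_add[of f "\<lambda>s. - g s"] bcont_minus[of g] by simp

lemma bcont_shift:
  assumes "bcont f"
  shows "bcont (\<lambda>s. f (s + c))"
proof -
  have "continuous_on UNIV (\<lambda>s. f (s + c))"
    using assms by (auto simp: bcont_def intro!: continuous_intros intro: continuous_on_compose2[of UNIV f])
  then show ?thesis using assms by (auto simp: bcont_def)
qed

lemma bcont_bell:
  assumes "\<And>l. 1 \<le> l \<Longrightarrow> l \<le> i \<Longrightarrow> bcont (x l)"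
  shows "bcont (\<lambda>s. bell i (\<lambda>l. x l s))"
  using assms
proof (induction i rule: less_induct)
  case (less i)
  show ?case
  proof (cases i)
    case (Suc k)
    show ?thesis unfolding Suc bell.simps
      by (intro bcont_sum bcont_mult bcont_const less.IH less.prems) (use Suc in auto)
  qed (simp add: bcont_const)
qed

lemma bcont_bell_f:
  assumes "\<And>l. 1 \<le> l \<Longrightarrow> l \<le> i \<Longrightarrow> bcont (x l)"
  shows "bcont (\<lambda>s. bell_f i (\<lambda>l. x l s))"
  unfolding bell_f_eq by (intro bcont_sum bcont_mult bcont_const bcont_bell assms) auto

lemma AP_bcont: "AP f \<Longrightarrow> bcont f"
  by (metis AP_bounded AP_continuous bcont_def)

section \<open>The right-hand side of the integral equation\<close>

text \<open>The sum \<open>P(r; \<lambda>) + \<L> + \<F>\<close> at one instant, with \<open>\<rho>\<close> and \<open>\<xi>\<close> the values of the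
  perturbations and of the jet.\<close>

definition rhs :: "nat \<Rightarrow> (nat \<Rightarrow> complex) \<Rightarrow> complex \<Rightarrow> (nat \<Rightarrow> complex) \<Rightarrow> (nat \<Rightarrow> complex) \<Rightarrow> complex" where
  "rhs n a x \<rho> \<xi> = (\<Sum>l=0..n-1. x ^ l * \<rho> l) + (\<Sum>l=1..n-1. 1 / fact l * Pder n l \<rho> x * \<xi> l) +
     (\<Sum>i=2..n. \<Sum>j=0..n-i. of_nat ((i + j) choose j) * (a (i + j) + \<rho> (i + j)) * x ^ j * bell_f (i - 1) \<xi>)"

lemma rhs_eq:
  "rhs n a (lam k) (\<lambda>i. r i s) (jet z s) =
     Pr n r (lam k) s + L_op n r lam k s z + F_op n a r lam k s (jet z s)"
  by (simp add: rhs_def Pr_def L_op_def F_op_def jet_def)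

lemma rhs_cong:
  assumes "\<And>l. l \<in> {1..n-1} \<Longrightarrow> \<xi> l = \<eta> l"
  shows "rhs n a x \<rho> \<xi> = rhs n a x \<rho> \<eta>"
proof -
  have "bell_f (i - 1) \<xi> = bell_f (i - 1) \<eta>" if "i \<in> {2..n}" for i
    using that by (intro bell_f_cong assms) auto
  then show ?thesis unfolding rhs_def using assms by (intro arg_cong2[of _ _ _ _ "(+)"] sum.cong) auto
qed

text \<open>Passes from the indexing of the double sum in \<open>F_op\<close> to the one in
  \<open>Q0\<close>.\<close>

lemma sum_triangle_reindex:
  fixes h :: "nat \<Rightarrow> nat \<Rightarrow> 'a::comm_monoid_add"
  shows "(\<Sum>i=2..n. \<Sum>j=0..n-i. h (i + j) j) = (\<Sum>i=2..n. \<Sum>l=0..i-2. h i l)"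
proof -
  have "(\<Sum>i=2..n. \<Sum>j=0..n-i. h (i + j) j) = (\<Sum>(i, j)\<in>(SIGMA i:{2..n}. {0..n-i}). h (i + j) j)"
    by (simp add: sum.Sigma)
  also have "\<dots> = (\<Sum>(i, l)\<in>(SIGMA i:{2..n}. {0..i-2}). h i l)"
    by (rule sum.reindex_bij_witness[of _ "\<lambda>(i, l). (i - l, l)" "\<lambda>(i, j). (i + j, j)"]) auto
  also have "\<dots> = (\<Sum>i=2..n. \<Sum>l=0..i-2. h i l)" by (simp add: sum.Sigma)
  finally show ?thesis .
qed

text \<open>The term free of the jet cancels. The factor is left as an unevaluated sum because its
  Green integrals have to reproduce \<open>L0\<close> and \<open>Q0\<close> term by term.\<close>

lemma rhs_lipschitz_jet:
  assumes n: "2 \<le> n" and d: "0 < d" and X: "norm1 (n - 1) X \<le> d" and Y: "norm1 (n - 1) Y \<le> d"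
  shows "norm (rhs n a x \<rho> X - rhs n a x \<rho> Y) \<le>
    ((\<Sum>l=1..n-1. norm (Pder n l \<rho> x) / fact l) +
      m_fun n d * (\<Sum>i=2..n. \<Sum>l=0..i-2. real (i choose l) * norm x ^ l * (norm (a i) + norm (\<rho> i)))) *
    norm1 (n - 1) (\<lambda>l. X l - Y l)" (is "_ \<le> (?A + _ * ?B) * ?N")
proof -
  let ?m = "m_fun n d"
  have m0: "0 \<le> ?m" using n d by (intro m_fun_nonneg) auto
  have bf: "norm (bell_f (i - 1) X - bell_f (i - 1) Y) \<le> ?m * ?N" if "i \<in> {2..n}" for i
  proof -
    have le: "norm1 (i - 1) Z \<le> norm1 (n - 1) Z" for Z using that by (intro norm1_mono) auto
    have "norm (bell_f (i - 1) X - bell_f (i - 1) Y) \<le> ?m * norm1 (i - 1) (\<lambda>l. X l - Y l)"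
      using that n d order_trans[OF le X] order_trans[OF le Y] by (intro bell_f_le_m_fun) auto
    also have "\<dots> \<le> ?m * ?N" using m0 le by (intro mult_left_mono)
    finally show ?thesis .
  qed
  have eq: "rhs n a x \<rho> X - rhs n a x \<rho> Y = (\<Sum>l=1..n-1. 1 / fact l * Pder n l \<rho> x * (X l - Y l)) +
     (\<Sum>i=2..n. \<Sum>j=0..n-i. of_nat ((i + j) choose j) * (a (i + j) + \<rho> (i + j)) * x ^ j *
       (bell_f (i - 1) X - bell_f (i - 1) Y))"
    unfolding rhs_def by (simp add: right_diff_distrib sum_subtractf)
  have "norm ((\<Sum>l=1..n-1. 1 / fact l * Pder n l \<rho> x * (X l - Y l)) +
     (\<Sum>i=2..n. \<Sum>j=0..n-i. of_nat ((i + j) choose j) * (a (i + j) + \<rho> (i + j)) * x ^ j *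
       (bell_f (i - 1) X - bell_f (i - 1) Y))) \<le> ?A * ?N + ?m * ?B * ?N"
  proof (rule order_trans[OF norm_triangle_ineq], rule add_mono)
    have "norm (\<Sum>l=1..n-1. 1 / fact l * Pder n l \<rho> x * (X l - Y l)) \<le>
        (\<Sum>l=1..n-1. norm (Pder n l \<rho> x) / fact l * ?N)"
    proof (rule sum_norm_le)
      fix l assume "l \<in> {1..n-1}"
      then have "norm (X l - Y l) \<le> ?N" using norm_le_norm1[of l "n - 1" "\<lambda>l. X l - Y l"] by simp
      then have "norm (Pder n l \<rho> x) / fact l * norm (X l - Y l) \<le> norm (Pder n l \<rho> x) / fact l * ?N"
        by (intro mult_left_mono) auto
      then show "norm (1 / fact l * Pder n l \<rho> x * (X l - Y l)) \<le> norm (Pder n l \<rho> x) / fact l * ?N"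
        by (simp add: norm_mult norm_divide)
    qed
    then show "norm (\<Sum>l=1..n-1. 1 / fact l * Pder n l \<rho> x * (X l - Y l)) \<le> ?A * ?N"
      by (simp only: sum_distrib_right)
    have "norm (\<Sum>i=2..n. \<Sum>j=0..n-i. of_nat ((i + j) choose j) * (a (i + j) + \<rho> (i + j)) * x ^ j *
         (bell_f (i - 1) X - bell_f (i - 1) Y)) \<le>
       (\<Sum>i=2..n. \<Sum>j=0..n-i. real ((i + j) choose j) * norm x ^ j * (norm (a (i + j)) + norm (\<rho> (i + j))) * (?m * ?N))"
    proof (intro sum_norm_le)
      fix i j assume ij: "i \<in> {2..n}" "j \<in> {0..n-i}"
      have "norm (of_nat ((i + j) choose j) * (a (i + j) + \<rho> (i + j)) * x ^ j * (bell_f (i - 1) X - bell_f (i - 1) Y))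
          = real ((i + j) choose j) * norm x ^ j * norm (a (i + j) + \<rho> (i + j)) * norm (bell_f (i - 1) X - bell_f (i - 1) Y)"
        by (simp add: norm_mult norm_power)
      also have "\<dots> \<le> real ((i + j) choose j) * norm x ^ j * (norm (a (i + j)) + norm (\<rho> (i + j))) * (?m * ?N)"
        using ij by (intro mult_mono bf norm_triangle_ineq mult_nonneg_nonneg add_nonneg_nonneg) auto
      finally show "norm (of_nat ((i + j) choose j) * (a (i + j) + \<rho> (i + j)) * x ^ j * (bell_f (i - 1) X - bell_f (i - 1) Y))
        \<le> real ((i + j) choose j) * norm x ^ j * (norm (a (i + j)) + norm (\<rho> (i + j))) * (?m * ?N)" .
    qed
    also have "\<dots> = ?B * (?m * ?N)"
      unfolding sum_triangle_reindex[of "\<lambda>i j. real (i choose j) * norm x ^ j * (norm (a i) + norm (\<rho> i)) * (?m * ?N)"]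
      by (simp only: sum_distrib_right)
    finally show "norm (\<Sum>i=2..n. \<Sum>j=0..n-i. of_nat ((i + j) choose j) * (a (i + j) + \<rho> (i + j)) * x ^ j *
         (bell_f (i - 1) X - bell_f (i - 1) Y)) \<le> ?m * ?B * ?N" by (simp only: ac_simps)
  qed
  then show ?thesis unfolding eq distrib_right[of ?A "?m * ?B" ?N] .
qed

text \<open>Translating the equation in time changes the coefficients only. A bound uniform over
  jets in the ball is needed for almost periodicity, where the size of \<open>K\<close> does not
  matter.\<close>

lemma rhs_lipschitz_coeff:
  assumes n: "2 \<le> n" and d: "0 < d"
  obtains K where "0 \<le> K" "\<And>\<rho> \<rho>' X e. norm1 (n - 1) X \<le> d \<Longrightarrow> (\<And>i. i \<le> n \<Longrightarrow> norm (\<rho> i - \<rho>' i) \<le> e) \<Longrightarrow>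
    norm (rhs n a x \<rho> X - rhs n a x \<rho>' X) \<le> K * e"
proof -
  let ?m = "m_fun n d"
  have m0: "0 \<le> ?m" using n d by (intro m_fun_nonneg) auto
  define K where "K = (\<Sum>l=0..n-1. norm x ^ l) +
    (\<Sum>l=1..n-1. \<Sum>j=0..n-l. real ((l + j) choose j) * norm x ^ j * d) +
    (\<Sum>i=2..n. \<Sum>j=0..n-i. real ((i + j) choose j) * norm x ^ j * (?m * d))"
  have "0 \<le> K" unfolding K_def using m0 d by (intro add_nonneg_nonneg sum_nonneg mult_nonneg_nonneg) auto
  moreover have "norm (rhs n a x \<rho> X - rhs n a x \<rho>' X) \<le> K * e"
    if X: "norm1 (n - 1) X \<le> d" and e: "\<And>i. i \<le> n \<Longrightarrow> norm (\<rho> i - \<rho>' i) \<le> e" for \<rho> \<rho>' X e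
  proof -
    have e0: "0 \<le> e" using e[of 0] norm_ge_zero order_trans by blast
    have bf: "norm (bell_f (i - 1) X) \<le> ?m * d" if "i \<in> {2..n}" for i
    proof -
      have le: "norm1 (i - 1) X \<le> d" by (rule order_trans[OF norm1_mono X]) (use that in auto)
      have "norm (bell_f (i - 1) X) \<le> ?m * norm1 (i - 1) X"
        using that n d le by (intro norm_bell_f_le) auto
      also have "\<dots> \<le> ?m * d" using m0 le by (intro mult_left_mono)
      finally show ?thesis .
    qed
    have P: "1 / fact l * Pder n l \<rho> x - 1 / fact l * Pder n l \<rho>' x =
        (\<Sum>j=0..n-l. of_nat ((l + j) choose j) * (\<rho> (l + j) - \<rho>' (l + j)) * x ^ j)" if "l \<le> n" for l
      using that by (simp add: Pder_eq right_diff_distrib left_diff_distrib sum_subtractf)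
    have eq: "rhs n a x \<rho> X - rhs n a x \<rho>' X = (\<Sum>l=0..n-1. x ^ l * (\<rho> l - \<rho>' l)) +
       (\<Sum>l=1..n-1. (1 / fact l * Pder n l \<rho> x - 1 / fact l * Pder n l \<rho>' x) * X l) +
       (\<Sum>i=2..n. \<Sum>j=0..n-i. of_nat ((i + j) choose j) * (\<rho> (i + j) - \<rho>' (i + j)) * x ^ j * bell_f (i - 1) X)"
    proof -
      have 1: "(\<Sum>l=0..n-1. x ^ l * (\<rho> l - \<rho>' l)) = (\<Sum>l=0..n-1. x ^ l * \<rho> l) - (\<Sum>l=0..n-1. x ^ l * \<rho>' l)"
        by (simp only: right_diff_distrib sum_subtractf)
      have 2: "(\<Sum>l=1..n-1. (1 / fact l * Pder n l \<rho> x - 1 / fact l * Pder n l \<rho>' x) * X l) =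
          (\<Sum>l=1..n-1. 1 / fact l * Pder n l \<rho> x * X l) - (\<Sum>l=1..n-1. 1 / fact l * Pder n l \<rho>' x * X l)"
        by (simp only: left_diff_distrib sum_subtractf)
      have "c * (\<rho> m - \<rho>' m) * y * f = c * (a m + \<rho> m) * y * f - c * (a m + \<rho>' m) * y * f" for c y f m
        by (simp add: algebra_simps)
      then have 3: "(\<Sum>i=2..n. \<Sum>j=0..n-i. of_nat ((i + j) choose j) * (\<rho> (i + j) - \<rho>' (i + j)) * x ^ j * bell_f (i - 1) X) =
          (\<Sum>i=2..n. \<Sum>j=0..n-i. of_nat ((i + j) choose j) * (a (i + j) + \<rho> (i + j)) * x ^ j * bell_f (i - 1) X) -
          (\<Sum>i=2..n. \<Sum>j=0..n-i. of_nat ((i + j) choose j) * (a (i + j) + \<rho>' (i + j)) * x ^ j * bell_f (i - 1) X)"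
        by (simp only: sum_subtractf)
      show ?thesis unfolding rhs_def 1 2 3 by (simp only: add_diff_add)
    qed
    have eq2: "(\<Sum>l=1..n-1. (1 / fact l * Pder n l \<rho> x - 1 / fact l * Pder n l \<rho>' x) * X l) =
        (\<Sum>l=1..n-1. \<Sum>j=0..n-l. of_nat ((l + j) choose j) * (\<rho> (l + j) - \<rho>' (l + j)) * x ^ j * X l)"
    proof (rule sum.cong[OF refl])
      fix l assume "l \<in> {1..n-1}"
      then have "l \<le> n" by auto
      show "(1 / fact l * Pder n l \<rho> x - 1 / fact l * Pder n l \<rho>' x) * X l =
          (\<Sum>j=0..n-l. of_nat ((l + j) choose j) * (\<rho> (l + j) - \<rho>' (l + j)) * x ^ j * X l)"
        unfolding P[OF \<open>l \<le> n\<close>] by (rule sum_distrib_right)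
    qed
    have "norm ((\<Sum>l=0..n-1. x ^ l * (\<rho> l - \<rho>' l)) +
       (\<Sum>l=1..n-1. \<Sum>j=0..n-l. of_nat ((l + j) choose j) * (\<rho> (l + j) - \<rho>' (l + j)) * x ^ j * X l) +
       (\<Sum>i=2..n. \<Sum>j=0..n-i. of_nat ((i + j) choose j) * (\<rho> (i + j) - \<rho>' (i + j)) * x ^ j * bell_f (i - 1) X)) \<le>
       (\<Sum>l=0..n-1. norm x ^ l * e) + (\<Sum>l=1..n-1. \<Sum>j=0..n-l. real ((l + j) choose j) * e * norm x ^ j * d) +
       (\<Sum>i=2..n. \<Sum>j=0..n-i. real ((i + j) choose j) * e * norm x ^ j * (?m * d))"
    proof (intro order_trans[OF norm_triangle_ineq] add_mono sum_norm_le)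
      fix l assume "l \<in> {0..n-1}"
      then show "norm (x ^ l * (\<rho> l - \<rho>' l)) \<le> norm x ^ l * e"
        using e[of l] by (simp add: norm_mult norm_power mult_left_mono)
    next
      fix l j assume lj: "l \<in> {1..n-1}" "j \<in> {0..n-l}"
      then have "norm (\<rho> (l + j) - \<rho>' (l + j)) \<le> e" "norm (X l) \<le> d"
        using e[of "l + j"] norm_le_norm1[of l "n - 1" X] X by auto
      then show "norm (of_nat ((l + j) choose j) * (\<rho> (l + j) - \<rho>' (l + j)) * x ^ j * X l) \<le>
          real ((l + j) choose j) * e * norm x ^ j * d"
        unfolding norm_mult norm_power norm_of_nat using e0 by (intro mult_mono mult_nonneg_nonneg) auto
    next
      fix i j assume ij: "i \<in> {2..n}" "j \<in> {0..n-i}"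
      then have "norm (\<rho> (i + j) - \<rho>' (i + j)) \<le> e" using e[of "i + j"] by auto
      then show "norm (of_nat ((i + j) choose j) * (\<rho> (i + j) - \<rho>' (i + j)) * x ^ j * bell_f (i - 1) X) \<le>
          real ((i + j) choose j) * e * norm x ^ j * (?m * d)"
        unfolding norm_mult norm_power norm_of_nat using e0 bf[OF ij(1)] by (intro mult_mono mult_nonneg_nonneg) auto
    qed
    also have "\<dots> = K * e"
      unfolding K_def distrib_right sum_distrib_right by (simp only: ac_simps)
    finally show ?thesis unfolding eq eq2 .
  qed
  ultimately show ?thesis by (rule that)
qed

lemma bcont_Pder:
  assumes "l \<le> n" "\<And>i. i \<le> n \<Longrightarrow> bcont (r i)"
  shows "bcont (\<lambda>s. Pder n l (\<lambda>i. r i s) x)"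
  using assms(1) unfolding Pder_eq[OF assms(1)]
  by (intro bcont_mult bcont_sum bcont_const assms(2)) auto

lemma bcont_rhs:
  assumes "\<And>i. i \<le> n \<Longrightarrow> bcont (r i)" "\<And>l. l \<in> {1..n-1} \<Longrightarrow> bcont (\<xi> l)"
  shows "bcont (\<lambda>s. rhs n a x (\<lambda>i. r i s) (\<lambda>l. \<xi> l s))"
  unfolding rhs_def
  by (intro bcont_add bcont_sum bcont_mult bcont_const bcont_Pder bcont_bell_f assms) auto

section \<open>The equation at one characteristic root\<close>

text \<open>Each root is treated on its own, with \<open>d\<close> in the role of
  \<open>M k\<close>; the roots meet again only in the proof of linear independence.\<close>

locale perturbed_root =
  fixes n :: nat and a :: "nat \<Rightarrow> complex" and r :: "nat \<Rightarrow> real \<Rightarrow> complex"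
    and lam :: "nat \<Rightarrow> complex" and k :: nat and d :: real
  assumes n3: "3 \<le> n" and an: "a n = 1"
    and r_AP: "\<And>i. i < n \<Longrightarrow> AP (r i)" and rn: "\<And>t. r n t = 0"
    and root: "\<And>i. i \<in> {1..n} \<Longrightarrow> poly (Ppoly n a) (lam i) = 0"
    and Re_distinct: "\<And>i j. i \<in> {1..n} \<Longrightarrow> j \<in> {1..n} \<Longrightarrow> i \<noteq> j \<Longrightarrow> Re (lam i) \<noteq> Re (lam j)"
    and k: "k \<in> {1..n}" and d: "0 < d"
    and H_le: "H_lam n r lam k \<le> (1 - L0 n r lam k - m_fun n d * Q0 n a r lam k) * d"
begin

section \<open>The differences of the roots and their Lagrange identities\<close>

abbreviation J :: "nat set" where "J \<equiv> {1..n-1}"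
abbreviation x :: complex where "x \<equiv> lam k"
abbreviation g :: "nat \<Rightarrow> complex" where "g \<equiv> gam lam k"
abbreviation \<Gamma> :: "nat \<Rightarrow> complex" where "\<Gamma> \<equiv> Gam n lam k"

lemma gam_eq: "g j = lam (if j < k then j else j + 1) - x"
  by (simp add: gam_def)

text \<open>The enumeration that jumps over \<open>k\<close> links the index set \<open>J\<close> of
  the Green operators with the products over all roots but \<open>lam k\<close>.\<close>

lemma bij_betw_skip: "bij_betw (\<lambda>j. if j < k then j else j + 1) J ({1..n} - {k})"
  using k by (intro bij_betw_byWitness[where f'="\<lambda>j. if j < k then j else j - 1"]) auto

lemma skip_in: "j \<in> J \<Longrightarrow> (if j < k then j else j + 1) \<in> {1..n} - {k}"
  using bij_betw_skip by (auto simp: bij_betw_def)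

lemma Re_gam: "j \<in> J \<Longrightarrow> Re (g j) \<noteq> 0"
  using skip_in[of j] Re_distinct[OF _ k] unfolding gam_eq by fastforce

lemma gam_nonzero: "j \<in> J \<Longrightarrow> g j \<noteq> 0"
  using Re_gam by fastforce

lemma inj_on_lam: "inj_on lam {1..n}"
  using Re_distinct by (metis inj_onI)

lemma inj_on_gam: "inj_on g J"
proof (rule inj_onI)
  fix i j assume ij: "i \<in> J" "j \<in> J" "g i = g j"
  then have "lam (if i < k then i else i + 1) = lam (if j < k then j else j + 1)" by (simp add: gam_eq)
  then have "(if i < k then i else i + 1) = (if j < k then j else j + 1)"
    using inj_onD[OF inj_on_lam] skip_in ij by blast
  then show "i = j" by (simp split: if_splits)
qed

lemma poly_gam: "j \<in> J \<Longrightarrow> poly (Ppoly n a) (x + g j) = 0"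
  using root skip_in[of j] unfolding gam_eq by simp

lemma prod_inverse_gam: "(\<Prod>j\<in>{1..n} - {k}. inverse (lam j - x)) = (\<Prod>j\<in>J. inverse (g j))"
  unfolding gam_eq by (rule prod.reindex_bij_betw[OF bij_betw_skip, symmetric])

lemma sum_gam_power: "i \<le> n - 2 \<Longrightarrow> (\<Sum>j\<in>J. g j ^ i / \<Gamma> j) = (if i = n - 2 then 1 else 0)"
  unfolding Gam_def using sum_power_divide_prod_diff[OF _ inj_on_gam, of i] n3 by auto

text \<open>Since \<open>card J = n - 1\<close>, the sign is \<open>(-1)^n\<close>. This is the
  source of the factor in front of the integral in the formula for the solution.\<close>

lemma sum_inverse_gam:
  "(\<Sum>j\<in>J. 1 / (\<Gamma> j * g j)) = (- 1) ^ n * (\<Prod>j\<in>{1..n} - {k}. inverse (lam j - x))"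
  unfolding prod_inverse_gam Gam_def
  using sum_inverse_divide_prod_diff[OF _ inj_on_gam _ gam_nonzero] n3 by simp

section \<open>Derivatives of the operator \<open>G_lam\<close>, and why it inverts
  \<open>D_op\<close>\<close>

definition Gd :: "(real \<Rightarrow> complex) \<Rightarrow> nat \<Rightarrow> real \<Rightarrow> complex" where
  "Gd u i t = (\<Sum>j\<in>J. g j ^ i / \<Gamma> j * G_op (g j) u t)"

lemma G_lam_eq: "G_lam n lam k u = Gd u 0"
  by (rule ext) (simp add: G_lam_def Gd_def)

lemma Gd_continuous:
  assumes "bcont u"
  shows "continuous_on UNIV (Gd u i)"
proof -
  obtain B where B: "continuous_on UNIV u" "\<And>s. norm (u s) \<le> B" using assms by (metis bcontE)
  show ?thesis
    unfolding Gd_def[abs_def] by (intro continuous_intros G_op_continuous[OF Re_gam B])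
qed

text \<open>The sums \<open>\<Sum>\<^sub>j \<gamma>\<^sub>j\<^sup>i / \<Gamma>\<^sub>j\<close> vanish for \<open>i < n - 2\<close>, so that \<open>G\<^sup>\<lambda>\<close> gains \<open>n - 1\<close> derivatives.\<close>

lemma Gd_has_vector_derivative:
  assumes "bcont u" "i \<le> n - 2"
  shows "(Gd u i has_vector_derivative Gd u (Suc i) t + (if i = n - 2 then u t else 0)) (at t)"
proof -
  obtain B where B: "continuous_on UNIV u" "\<And>s. norm (u s) \<le> B" using assms by (metis bcontE)
  have "(Gd u i has_vector_derivative (\<Sum>j\<in>J. g j ^ i / \<Gamma> j * (g j * G_op (g j) u t + u t))) (at t)"
    unfolding Gd_def[abs_def]
    by (intro has_vector_derivative_sum has_vector_derivative_mult_right G_op_has_vector_derivative[OF Re_gam B])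
  moreover have "(\<Sum>j\<in>J. g j ^ i / \<Gamma> j * (g j * G_op (g j) u t + u t)) =
      Gd u (Suc i) t + (\<Sum>j\<in>J. g j ^ i / \<Gamma> j) * u t"
  proof -
    have "g j ^ i / \<Gamma> j * (g j * G_op (g j) u t + u t) =
        g j ^ Suc i / \<Gamma> j * G_op (g j) u t + g j ^ i / \<Gamma> j * u t" for j
      by (simp add: distrib_left)
    then show ?thesis by (simp only: Gd_def sum.distrib sum_distrib_right)
  qed
  ultimately show ?thesis using sum_gam_power[OF assms(2)] by (simp split: if_splits)
qed

lemma nderiv_Gd: "bcont u \<Longrightarrow> i \<le> n - 2 \<Longrightarrow> nderiv i (Gd u 0) = Gd u i"
proof (rule nderiv_chain(1)[where x = "Gd u"])
  show "(Gd u i has_vector_derivative Gd u (Suc i) t) (at t)" if "bcont u" "i < n - 2" for i t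
    using Gd_has_vector_derivative[of u i t] that by simp
qed

text \<open>By Taylor's formula the symbol of \<open>D_op\<close> is
  \<open>(P(x + h) - P(x)) / h\<close>. It vanishes at every \<open>h = g j\<close>, because
  \<open>x\<close> and \<open>x + g j\<close> are both roots.\<close>

lemma sum_Pder_Gd: "(\<Sum>m=1..n. 1 / fact m * Pder n m a x * Gd u (m - 1) t) = 0"
proof -
  have zero: "(\<Sum>m=1..n. Pder n m a x / fact m * g j ^ (m - 1)) = 0" if j: "j \<in> J" for j
  proof -
    have "g j * (\<Sum>m=1..n. Pder n m a x / fact m * g j ^ (m - 1)) = (\<Sum>m=1..n. Pder n m a x / fact m * g j ^ m)"
      unfolding sum_distrib_left
    proof (rule sum.cong[OF refl])
      fix m assume "m \<in> {1..n}"
      then have "g j ^ m = g j * g j ^ (m - 1)" by (cases m) auto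
      then show "g j * (Pder n m a x / fact m * g j ^ (m - 1)) = Pder n m a x / fact m * g j ^ m"
        by (simp add: mult_ac)
    qed
    also have "\<dots> = poly (Ppoly n a) (x + g j) - poly (Ppoly n a) (x + 0)"
      unfolding taylor_Ppoly atMost_atLeast0 by (simp add: sum.atLeast_Suc_atMost power_0_left)
    also have "\<dots> = 0" using poly_gam[OF j] root[OF k] by simp
    finally show ?thesis using gam_nonzero[OF j] by simp
  qed
  have "(\<Sum>m=1..n. 1 / fact m * Pder n m a x * Gd u (m - 1) t) =
      (\<Sum>m=1..n. \<Sum>j\<in>J. 1 / \<Gamma> j * G_op (g j) u t * (Pder n m a x / fact m * g j ^ (m - 1)))"
    unfolding Gd_def sum_distrib_left by (intro sum.cong) (auto simp: mult_ac)
  also have "\<dots> = (\<Sum>j\<in>J. \<Sum>m=1..n. 1 / \<Gamma> j * G_op (g j) u t * (Pder n m a x / fact m * g j ^ (m - 1)))"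
    by (rule sum.swap)
  also have "\<dots> = (\<Sum>j\<in>J. 1 / \<Gamma> j * G_op (g j) u t * (\<Sum>m=1..n. Pder n m a x / fact m * g j ^ (m - 1)))"
    by (simp only: sum_distrib_left)
  also have "\<dots> = 0"
  proof (rule sum.neutral, rule ballI)
    fix j assume "j \<in> J"
    then show "1 / \<Gamma> j * G_op (g j) u t * (\<Sum>m=1..n. Pder n m a x / fact m * g j ^ (m - 1)) = 0"
      by (simp only: zero mult_zero_right)
  qed
  finally show ?thesis .
qed

lemma Pder_top: "Pder n n a x = fact n"
  by (simp add: Pder_eq an)

section \<open>The Lipschitz factor of the source and the constant \<open>q\<close>\<close>

definition weight :: "nat \<Rightarrow> real" where
  "weight j = alph_tilde n lam k j / norm (\<Gamma> j)"

lemma weight_nonneg: "0 \<le> weight j"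
  by (simp add: weight_def alph_tilde_def sum_nonneg)

text \<open>Adding the moduli of the coefficients of one Green operator over all jet components is
  what produces \<open>alph_tilde\<close>.\<close>

lemma norm1_Gd_le: "norm1 (n - 1) (\<lambda>l. - Gd u (l - 1) t) \<le> (\<Sum>j\<in>J. weight j * norm (G_op (g j) u t))"
proof -
  have "norm1 (n - 1) (\<lambda>l. - Gd u (l - 1) t) \<le>
      (\<Sum>l=1..n-1. \<Sum>j\<in>J. norm (g j) ^ (l - 1) / norm (\<Gamma> j) * norm (G_op (g j) u t))"
    unfolding norm1_def Gd_def norm_minus_cancel
    by (intro sum_mono order_trans[OF norm_sum]) (simp add: norm_mult norm_divide norm_power)
  also have "\<dots> = (\<Sum>j\<in>J. \<Sum>l=1..n-1. norm (g j) ^ (l - 1) / norm (\<Gamma> j) * norm (G_op (g j) u t))"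
    by (rule sum.swap)
  also have "\<dots> = (\<Sum>j\<in>J. (\<Sum>l=1..n-1. norm (g j) ^ (l - 1)) / norm (\<Gamma> j) * norm (G_op (g j) u t))"
    by (simp only: sum_distrib_right sum_divide_distrib)
  also have "\<dots> = (\<Sum>j\<in>J. weight j * norm (G_op (g j) u t))"
  proof -
    have "(\<Sum>l=1..n-1. norm (g j) ^ (l - 1)) = alph_tilde n lam k j" for j
      unfolding alph_tilde_def by (rule sum.reindex_bij_witness[of _ Suc "\<lambda>l. l - 1"]) (use n3 in auto)
    then show ?thesis by (simp only: weight_def)
  qed
  finally show ?thesis .
qed

lemma r_bcont: "i \<le> n \<Longrightarrow> bcont (r i)"
proof (cases "i = n")
  case True
  have "r n = (\<lambda>s. 0)" using rn by (rule ext)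
  then show ?thesis using True by (simp add: bcont_const)
qed (simp add: AP_bcont r_AP)

text \<open>The Lipschitz factor of the source at time \<open>s\<close> from
  \<open>rhs_lipschitz_jet\<close>; its weighted Green integrals are bounded by
  \<open>q\<close>.\<close>

definition V :: "real \<Rightarrow> real" where
  "V s = (\<Sum>l=1..n-1. norm (Pder n l (\<lambda>i. r i s) x) / fact l) +
    m_fun n d * (\<Sum>i=2..n. \<Sum>l=0..i-2. real (i choose l) * norm x ^ l * (norm (a i) + norm (r i s)))"

lemma m_nonneg: "0 \<le> m_fun n d"
  using n3 d by (intro m_fun_nonneg) auto

lemma V_nonneg: "0 \<le> V s"
  unfolding V_def using m_nonneg by (intro add_nonneg_nonneg sum_nonneg mult_nonneg_nonneg) auto

lemma V_bcont: "bcont V"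
  unfolding V_def[abs_def] divide_inverse
  by (intro bcont_add bcont_sum bcont_mult bcont_const bcont_norm bcont_Pder r_bcont) auto

text \<open>The constants \<open>a i\<close> integrate exactly to
  \<open>norm (a i) / \<bar>alph\<bar>\<close>, whereas the terms with the perturbations are bounded
  by suprema of \<open>I_op\<close>; hence the two kinds of summands in \<open>Q0\<close>.\<close>

lemma green_V_le:
  assumes j: "j \<in> J"
  shows "(LINT s|lborel. norm (green (g j) t s) * V s) \<le>
    (\<Sum>l=1..n-1. 1 / fact l * sup_norm (I_op (complex_of_real (alph lam k j)) (\<lambda>s. Pder n l (\<lambda>i. r i s) x))) +
    m_fun n d * (\<Sum>i=2..n. \<Sum>l=0..i-2. real (i choose l) * norm x ^ l *
      (norm (a i) / \<bar>alph lam k j\<bar> + sup_norm (I_op (complex_of_real (alph lam k j)) (\<lambda>s. complex_of_real (norm (r i s))))))"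
proof -
  let ?g = "\<lambda>s. norm (green (g j) t s)"
  let ?W = "\<lambda>f. LINT s|lborel. ?g s * f s"
  have HB: "has_bochner_integral lborel (\<lambda>s. ?g s * f s) (?W f)" if f: "bcont f" for f :: "real \<Rightarrow> real"
  proof -
    obtain B where "continuous_on UNIV f" "\<And>s. norm (f s) \<le> B" using f by (metis bcontE)
    then show ?thesis
      using integrable_norm_green_mult[OF Re_gam[OF j], of f B t] by (simp add: has_bochner_integral_integrable)
  qed
  have Pb: "bcont (\<lambda>s. Pder n l (\<lambda>i. r i s) x)" if "l \<in> {1..n-1}" for l
    using that by (intro bcont_Pder r_bcont) auto
  \<comment> \<open>The factor \<open>1\<close> is written out so that every summand is a Green
    integral of the shape handled by \<open>HB\<close>.\<close>
  have hb: "has_bochner_integral lborel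
     (\<lambda>s. (\<Sum>l=1..n-1. 1 / fact l * (?g s * norm (Pder n l (\<lambda>i. r i s) x))) +
       m_fun n d * (\<Sum>i=2..n. \<Sum>l=0..i-2. real (i choose l) * norm x ^ l * (norm (a i) * (?g s * 1) + ?g s * norm (r i s))))
     ((\<Sum>l=1..n-1. 1 / fact l * ?W (\<lambda>s. norm (Pder n l (\<lambda>i. r i s) x))) +
       m_fun n d * (\<Sum>i=2..n. \<Sum>l=0..i-2. real (i choose l) * norm x ^ l * (norm (a i) * ?W (\<lambda>s. 1) + ?W (\<lambda>s. norm (r i s)))))"
    by (intro has_bochner_integral_add has_bochner_integral_sum has_bochner_integral_mult_right HB bcont_norm
        bcont_const Pb r_bcont) auto
  have eq: "(\<lambda>s. (\<Sum>l=1..n-1. 1 / fact l * (?g s * norm (Pder n l (\<lambda>i. r i s) x))) +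
       m_fun n d * (\<Sum>i=2..n. \<Sum>l=0..i-2. real (i choose l) * norm x ^ l * (norm (a i) * (?g s * 1) + ?g s * norm (r i s))))
       = (\<lambda>s. ?g s * V s)"
    unfolding V_def by (rule ext) (simp add: sum_distrib_left distrib_left mult_ac)
  have "?W V = (\<Sum>l=1..n-1. 1 / fact l * ?W (\<lambda>s. norm (Pder n l (\<lambda>i. r i s) x))) +
       m_fun n d * (\<Sum>i=2..n. \<Sum>l=0..i-2. real (i choose l) * norm x ^ l * (norm (a i) * ?W (\<lambda>s. 1) + ?W (\<lambda>s. norm (r i s))))"
    using has_bochner_integral_integral_eq[OF hb] unfolding eq .
  also have "\<dots> \<le> (\<Sum>l=1..n-1. 1 / fact l * sup_norm (I_op (complex_of_real (alph lam k j)) (\<lambda>s. Pder n l (\<lambda>i. r i s) x))) +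
    m_fun n d * (\<Sum>i=2..n. \<Sum>l=0..i-2. real (i choose l) * norm x ^ l *
      (norm (a i) / \<bar>alph lam k j\<bar> + sup_norm (I_op (complex_of_real (alph lam k j)) (\<lambda>s. complex_of_real (norm (r i s))))))"
  proof (intro add_mono sum_mono mult_left_mono m_nonneg)
    have le: "?W (\<lambda>s. norm (f s)) \<le> sup_norm (I_op (complex_of_real (alph lam k j)) f)"
      if f: "bcont f" for f :: "real \<Rightarrow> complex"
    proof -
      obtain B where B: "continuous_on UNIV f" "\<And>s. norm (f s) \<le> B" using f by (metis bcontE)
      have "I_op (complex_of_real (Re (g j))) f t \<le> sup_norm (I_op (complex_of_real (Re (g j))) f)"
        using Re_gam[OF j] B by (intro I_op_le_sup_norm) auto
      then show ?thesis unfolding alph_def I_op_eq[of "g j" f t] .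
    qed
    show "?W (\<lambda>s. norm (Pder n l (\<lambda>i. r i s) x)) \<le> sup_norm (I_op (complex_of_real (alph lam k j)) (\<lambda>s. Pder n l (\<lambda>i. r i s) x))"
      if "l \<in> {1..n-1}" for l by (rule le[OF Pb[OF that]])
    show "norm (a i) * ?W (\<lambda>s. 1) \<le> norm (a i) / \<bar>alph lam k j\<bar>" for i
      using has_bochner_integral_norm_green[OF Re_gam[OF j], of t] by (simp add: has_bochner_integral_iff alph_def)
    have "bcont (\<lambda>s. complex_of_real (norm (r i s)))" if "i \<in> {2..n}" for i
      using r_bcont[of i] that unfolding bcont_def by (auto intro: continuous_intros)
    from le[OF this] show "?W (\<lambda>s. norm (r i s)) \<le> sup_norm (I_op (complex_of_real (alph lam k j)) (\<lambda>s. complex_of_real (norm (r i s))))"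
      if "i \<in> {2..n}" for i using that by simp
  qed auto
  finally show ?thesis .
qed

definition q :: real where "q = L0 n r lam k + m_fun n d * Q0 n a r lam k"

lemma sum_weight_V_le: "(\<Sum>j\<in>J. weight j * (LINT s|lborel. norm (green (g j) t s) * V s)) \<le> q"
proof -
  let ?A = "\<lambda>j. \<Sum>l=1..n-1. 1 / fact l * sup_norm (I_op (complex_of_real (alph lam k j)) (\<lambda>s. Pder n l (\<lambda>i. r i s) x))"
  let ?B = "\<lambda>j. \<Sum>i=2..n. \<Sum>l=0..i-2. real (i choose l) * norm x ^ l *
      (norm (a i) / \<bar>alph lam k j\<bar> + sup_norm (I_op (complex_of_real (alph lam k j)) (\<lambda>s. complex_of_real (norm (r i s)))))"
  have "(\<Sum>j\<in>J. weight j * (LINT s|lborel. norm (green (g j) t s) * V s)) \<le> (\<Sum>j\<in>J. weight j * (?A j + m_fun n d * ?B j))"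
    by (intro sum_mono mult_left_mono green_V_le weight_nonneg)
  also have "\<dots> = (\<Sum>j\<in>J. weight j * ?A j) + m_fun n d * (\<Sum>j\<in>J. weight j * ?B j)"
    by (simp only: distrib_left sum.distrib mult.left_commute[of _ "m_fun n d"] sum_distrib_left[symmetric])
  also have "(\<Sum>j\<in>J. weight j * ?A j) = L0 n r lam k"
  proof -
    have "0 \<le> alph_tilde n lam k j" for j by (simp add: alph_tilde_def sum_nonneg)
    then show ?thesis
      unfolding L0_def sum_distrib_left weight_def by (simp add: norm_divide norm_mult)
  qed
  also have "(\<Sum>j\<in>J. weight j * ?B j) = Q0 n a r lam k"
    unfolding Q0_def sum_distrib_left weight_def by (simp only: mult.assoc)
  finally show ?thesis by (simp only: q_def)
qed

text \<open>\<open>q\<close> dominates integrals of nonnegative functions, so the suprema inside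
  \<open>L0\<close> and \<open>Q0\<close> need not be examined.\<close>

lemma q_nonneg: "0 \<le> q"
proof -
  have "0 \<le> (\<Sum>j\<in>J. weight j * (LINT s|lborel. norm (green (g j) 0 s) * V s))"
    by (intro sum_nonneg mult_nonneg_nonneg weight_nonneg integral_nonneg V_nonneg) (simp add: V_nonneg)
  then show ?thesis using sum_weight_V_le[of 0] by linarith
qed

section \<open>The fixed-point map on jets\<close>

definition src :: "(nat \<Rightarrow> real \<Rightarrow> complex) \<Rightarrow> real \<Rightarrow> complex" where
  "src \<xi> s = rhs n a x (\<lambda>i. r i s) (\<lambda>l. \<xi> l s)"

definition T :: "(nat \<Rightarrow> real \<Rightarrow> complex) \<Rightarrow> nat \<Rightarrow> real \<Rightarrow> complex" where
  "T \<xi> l t = - Gd (src \<xi>) (l - 1) t"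

text \<open>The ball is closed so that the limit of the iteration remains in it. Components outside
  \<open>J\<close> are arbitrary, since the source does not see them.\<close>

definition admissible :: "(nat \<Rightarrow> real \<Rightarrow> complex) \<Rightarrow> bool" where
  "admissible \<xi> \<longleftrightarrow> (\<forall>l\<in>J. continuous_on UNIV (\<xi> l)) \<and> (\<forall>t. norm1 (n - 1) (\<lambda>l. \<xi> l t) \<le> d)"

lemma admissible_bcont: "admissible \<xi> \<Longrightarrow> l \<in> J \<Longrightarrow> bcont (\<xi> l)"
  unfolding admissible_def bcont_def using norm_le_norm1 order_trans by blast

lemma src_bcont: "admissible \<xi> \<Longrightarrow> bcont (src \<xi>)"
  unfolding src_def[abs_def] by (intro bcont_rhs r_bcont admissible_bcont)

lemma admissible_shift:
  assumes "admissible \<xi>"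
  shows "admissible (\<lambda>l s. \<xi> l (s + c))"
  using assms unfolding admissible_def
  by (auto intro!: continuous_intros intro: continuous_on_compose2[of UNIV])

text \<open>Stated for the weighted sum of the individual Green operators and not just for
  \<open>T\<close>: the comparison with a translate adds an error inside each of these
  operators.\<close>

lemma contraction:
  assumes \<xi>: "admissible \<xi>" and \<eta>: "admissible \<eta>" and e: "\<And>s. norm1 (n - 1) (\<lambda>l. \<xi> l s - \<eta> l s) \<le> e"
  shows "(\<Sum>j\<in>J. weight j * norm (G_op (g j) (\<lambda>s. src \<xi> s - src \<eta> s) t)) \<le> q * e"
proof -
  have e0: "0 \<le> e" using e norm1_nonneg order_trans by blast
  have le: "norm (src \<xi> s - src \<eta> s) \<le> V s * e" for s
  proof -
    have "norm (src \<xi> s - src \<eta> s) \<le> V s * norm1 (n - 1) (\<lambda>l. \<xi> l s - \<eta> l s)"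
      unfolding src_def V_def using n3 d \<xi> \<eta> by (intro rhs_lipschitz_jet) (auto simp: admissible_def)
    also have "\<dots> \<le> V s * e" by (intro mult_left_mono e V_nonneg)
    finally show ?thesis .
  qed
  have "bcont (\<lambda>s. src \<xi> s - src \<eta> s)" by (intro bcont_diff src_bcont assms)
  then have c1: "continuous_on UNIV (\<lambda>s. src \<xi> s - src \<eta> s)" by (simp add: bcont_def)
  have "bcont (\<lambda>s. V s * e)" by (intro bcont_mult V_bcont bcont_const)
  then obtain B where c2: "continuous_on UNIV (\<lambda>s. V s * e)" and B: "\<And>s. norm (V s * e) \<le> B" by (metis bcontE)
  have "(\<Sum>j\<in>J. weight j * norm (G_op (g j) (\<lambda>s. src \<xi> s - src \<eta> s) t)) \<le>
      (\<Sum>j\<in>J. weight j * ((LINT s|lborel. norm (green (g j) t s) * V s) * e))"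
  proof (intro sum_mono mult_left_mono weight_nonneg)
    fix j assume j: "j \<in> J"
    have "V s * e \<le> B" for s using B[of s] by simp
    from norm_G_op_le[OF Re_gam[OF j] c1 c2 le this]
    have "norm (G_op (g j) (\<lambda>s. src \<xi> s - src \<eta> s) t) \<le> (LINT s|lborel. norm (green (g j) t s) * (V s * e))" .
    also have "\<dots> = (LINT s|lborel. norm (green (g j) t s) * V s) * e"
      by (simp only: mult.assoc[symmetric] integral_mult_left_zero)
    finally show "norm (G_op (g j) (\<lambda>s. src \<xi> s - src \<eta> s) t) \<le> (LINT s|lborel. norm (green (g j) t s) * V s) * e" .
  qed
  also have "\<dots> = (\<Sum>j\<in>J. weight j * (LINT s|lborel. norm (green (g j) t s) * V s)) * e"
    by (simp only: sum_distrib_right mult.assoc)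
  also have "\<dots> \<le> q * e" by (intro mult_right_mono sum_weight_V_le e0)
  finally show ?thesis .
qed

lemma Gd_diff: "bcont u \<Longrightarrow> bcont v \<Longrightarrow> Gd (\<lambda>s. u s - v s) i t = Gd u i t - Gd v i t"
proof -
  assume "bcont u" "bcont v"
  then obtain B C where B: "continuous_on UNIV u" "\<And>s. norm (u s) \<le> B"
    and C: "continuous_on UNIV v" "\<And>s. norm (v s) \<le> C" by (metis bcontE)
  have "g j ^ i / \<Gamma> j * G_op (g j) (\<lambda>s. u s - v s) t =
      g j ^ i / \<Gamma> j * G_op (g j) u t - g j ^ i / \<Gamma> j * G_op (g j) v t" if "j \<in> J" for j
    using G_op_diff[OF Re_gam[OF that] B C, of t] by (simp add: right_diff_distrib)
  then show ?thesis unfolding Gd_def sum_subtractf[symmetric] by (intro sum.cong) auto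
qed

lemma T_contraction:
  assumes "admissible \<xi>" "admissible \<eta>" "\<And>s. norm1 (n - 1) (\<lambda>l. \<xi> l s - \<eta> l s) \<le> e"
  shows "norm1 (n - 1) (\<lambda>l. T \<xi> l t - T \<eta> l t) \<le> q * e"
proof -
  have "norm1 (n - 1) (\<lambda>l. T \<xi> l t - T \<eta> l t) = norm1 (n - 1) (\<lambda>l. - Gd (\<lambda>s. src \<xi> s - src \<eta> s) (l - 1) t)"
    using assms(1,2) by (simp add: T_def Gd_diff src_bcont)
  also have "\<dots> \<le> q * e"
    by (rule order_trans[OF norm1_Gd_le contraction[OF assms]])
  finally show ?thesis .
qed

lemma admissible_zero: "admissible (\<lambda>l s. 0)"
  using d by (simp add: admissible_def norm1_def)

text \<open>At the zero jet the source reduces to \<open>Pr\<close>, so the norm of the image is the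
  function whose supremum is \<open>H_lam\<close>. The estimate \<open>bound\<close> ensures that
  this supremum is an upper bound.\<close>

lemma norm1_T_zero_le: "norm1 (n - 1) (\<lambda>l. T (\<lambda>l s. 0) l t) \<le> (1 - q) * d"
proof -
  let ?u = "Pr n r x"
  have src0: "src (\<lambda>l s. 0) = ?u"
    by (rule ext) (simp add: src_def rhs_def Pr_def bell_f_zero)
  have bc: "bcont ?u" using src_bcont[OF admissible_zero] by (simp add: src0)
  then obtain B where B: "continuous_on UNIV ?u" "\<And>s. norm (?u s) \<le> B" by (metis bcontE)
  have eq: "norm1 (n - 1) (\<lambda>l. T (\<lambda>l s. 0) l t) = (\<Sum>i=0..n-2. norm (nderiv i (G_lam n lam k ?u) t))" for t
  proof -
    have "norm1 (n - 1) (\<lambda>l. T (\<lambda>l s. 0) l t) = (\<Sum>l=1..n-1. norm (Gd ?u (l - 1) t))"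
      by (simp add: norm1_def T_def src0)
    also have "\<dots> = (\<Sum>i=0..n-2. norm (Gd ?u i t))"
      by (rule sum.reindex_bij_witness[of _ Suc "\<lambda>l. l - 1"]) (use n3 in auto)
    also have "\<dots> = (\<Sum>i=0..n-2. norm (nderiv i (G_lam n lam k ?u) t))"
      by (intro sum.cong) (auto simp: G_lam_eq nderiv_Gd[OF bc])
    finally show ?thesis .
  qed
  have bound: "norm1 (n - 1) (\<lambda>l. T (\<lambda>l s. 0) l t) \<le> (\<Sum>j\<in>J. weight j * (B / \<bar>Re (g j)\<bar>))" for t
  proof -
    have "norm1 (n - 1) (\<lambda>l. T (\<lambda>l s. 0) l t) \<le> (\<Sum>j\<in>J. weight j * norm (G_op (g j) ?u t))"
      unfolding T_def src0 by (rule norm1_Gd_le)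
    also have "\<dots> \<le> (\<Sum>j\<in>J. weight j * (B / \<bar>Re (g j)\<bar>))"
      by (intro sum_mono mult_left_mono weight_nonneg G_op_bounded Re_gam B)
    finally show ?thesis .
  qed
  have "norm1 (n - 1) (\<lambda>l. T (\<lambda>l s. 0) l t) \<le> H_lam n r lam k"
  proof -
    let ?N = "\<lambda>t. norm1 (n - 1) (\<lambda>l. T (\<lambda>l s. 0) l t)"
    have nn: "norm (?N t) = ?N t" for t by (simp add: norm1_nonneg)
    have "bdd_above (range (\<lambda>t. norm (?N t)))"
      unfolding nn by (rule bdd_aboveI2[OF bound])
    then have "norm (?N t) \<le> (SUP t. norm (?N t))" by (rule cSUP_upper[OF UNIV_I])
    then show ?thesis unfolding H_lam_def sup_norm_def eq[symmetric] nn .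
  qed
  also have "\<dots> \<le> (1 - q) * d" using H_le by (simp add: q_def algebra_simps)
  finally show ?thesis .
qed

lemma q_le_1: "q \<le> 1"
proof -
  have "0 \<le> (1 - q) * d" by (rule order_trans[OF norm1_nonneg norm1_T_zero_le[of 0]])
  then show ?thesis using d by (simp add: zero_le_mult_iff)
qed

text \<open>The distance from the image of \<open>0\<close> and the norm of that image add up to
  \<open>q * d + (1 - q) * d = d\<close>.\<close>

lemma admissible_T:
  assumes "admissible \<xi>"
  shows "admissible (T \<xi>)"
  unfolding admissible_def
proof (intro conjI ballI allI)
  fix l assume "l \<in> J"
  show "continuous_on UNIV (T \<xi> l)"
    unfolding T_def[abs_def] by (intro continuous_intros Gd_continuous src_bcont assms)
next
  fix t
  have "norm1 (n - 1) (\<lambda>l. T \<xi> l t) \<le> norm1 (n - 1) (\<lambda>l. T \<xi> l t - T (\<lambda>l s. 0) l t) + norm1 (n - 1) (\<lambda>l. T (\<lambda>l s. 0) l t)"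
  proof -
    have "norm (T \<xi> l t) \<le> norm (T \<xi> l t - T (\<lambda>l s. 0) l t) + norm (T (\<lambda>l s. 0) l t)" for l
      using norm_triangle_sub[of "T \<xi> l t" "T (\<lambda>l s. 0) l t"] by simp
    then show ?thesis unfolding norm1_def sum.distrib[symmetric] by (rule sum_mono)
  qed
  also have "\<dots> \<le> q * d + (1 - q) * d"
    using assms by (intro add_mono T_contraction admissible_zero norm1_T_zero_le) (auto simp: admissible_def)
  finally show "norm1 (n - 1) (\<lambda>l. T \<xi> l t) \<le> d" by (simp add: algebra_simps)
qed

section \<open>Existence and almost periodicity of the fixed point\<close>

definition fixed_point :: "(nat \<Rightarrow> real \<Rightarrow> complex) \<Rightarrow> bool" where
  "fixed_point \<xi> \<longleftrightarrow> admissible \<xi> \<and> (\<forall>l\<in>J. \<forall>t. \<xi> l t = T \<xi> l t)"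

lemma T_fixed_point_exists:
  assumes q: "q < 1"
  shows "\<exists>\<xi>. fixed_point \<xi>"
proof -
  define X where "X m = (T ^^ m) (\<lambda>l s. 0)" for m
  have X0: "X 0 = (\<lambda>l s. 0)" and XS: "X (Suc m) = T (X m)" for m by (simp_all add: X_def)
  have adm: "admissible (X m)" for m
    by (induction m) (auto simp: X0 XS admissible_zero admissible_T)
  have step: "norm1 (n - 1) (\<lambda>l. X (Suc m) l t - X m l t) \<le> q ^ m * d" for m t
  proof (induction m arbitrary: t)
    case 0
    then show ?case using adm[of 1] by (simp add: X0 admissible_def)
  next
    case (Suc m)
    have "norm1 (n - 1) (\<lambda>l. T (X (Suc m)) l t - T (X m) l t) \<le> q * (q ^ m * d)"
      by (intro T_contraction adm Suc)
    then show ?case by (simp add: XS)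
  qed
  \<comment> \<open>The limit is introduced as a telescoping series, so that the geometric bound
    \<open>step\<close> yields uniform convergence by the Weierstrass test.\<close>
  define \<xi> where "\<xi> l t = (\<Sum>m. X (Suc m) l t - X m l t)" for l t
  have lim: "uniform_limit UNIV (\<lambda>m. X m l) (\<xi> l) sequentially" if l: "l \<in> J" for l
  proof -
    have "uniform_limit UNIV (\<lambda>m t. \<Sum>i<m. X (Suc i) l t - X i l t) (\<xi> l) sequentially"
      unfolding \<xi>_def[abs_def]
    proof (rule Weierstrass_m_test)
      fix m t
      show "norm (X (Suc m) l t - X m l t) \<le> q ^ m * d"
        using norm_le_norm1[OF l, of "\<lambda>l. X (Suc m) l t - X m l t"] step[of m t] by linarith
      show "summable (\<lambda>m. q ^ m * d)" using q q_nonneg by (intro summable_mult2 summable_geometric) simp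
    qed
    moreover have "(\<Sum>i<m. X (Suc i) l t - X i l t) = X m l t" for m t
      by (subst sum_lessThan_telescope) (simp add: X0)
    ultimately show ?thesis by simp
  qed
  have ptlim: "(\<lambda>m. X m l t) \<longlonglongrightarrow> \<xi> l t" if "l \<in> J" for l t
    by (rule tendsto_uniform_limitI[OF lim[OF that]]) simp
  have adm\<xi>: "admissible \<xi>"
    unfolding admissible_def
  proof (intro conjI ballI allI)
    fix l assume l: "l \<in> J"
    show "continuous_on UNIV (\<xi> l)"
      by (rule uniform_limit_theorem[OF _ lim[OF l]]) (use adm l in \<open>auto simp: admissible_def\<close>)
  next
    fix t
    have "(\<lambda>m. norm1 (n - 1) (\<lambda>l. X m l t)) \<longlonglongrightarrow> norm1 (n - 1) (\<lambda>l. \<xi> l t)"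
      unfolding norm1_def by (intro tendsto_intros ptlim)
    then show "norm1 (n - 1) (\<lambda>l. \<xi> l t) \<le> d"
      by (rule LIMSEQ_le_const2) (use adm in \<open>auto simp: admissible_def\<close>)
  qed
  have "\<xi> l t = T \<xi> l t" if l: "l \<in> J" for l t
  proof -
    have "norm (\<xi> l t - T \<xi> l t) \<le> e" if "e > 0" for e
    proof -
      \<comment> \<open>One \<open>c\<close> pays for the distance to the next iterate, and
        \<open>n * c\<close> for the image under \<open>T\<close> of an error summed over
        \<open>n - 1\<close> components.\<close>
      define c where "c = e / (real n + 1)"
      have c: "c > 0" using that by (simp add: c_def)
      have "eventually (\<lambda>m. \<forall>l\<in>J. \<forall>t. dist (X m l t) (\<xi> l t) < c) sequentially"
        using lim c by (intro eventually_ball_finite) (auto simp: uniform_limit_iff)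
      then obtain M where "\<forall>m\<ge>M. \<forall>l\<in>J. \<forall>t. dist (X m l t) (\<xi> l t) < c"
        unfolding eventually_sequentially by blast
      then have M: "norm (X m l t - \<xi> l t) < c" if "m \<ge> M" "l \<in> J" for m l t
        using that unfolding dist_norm by blast
      have "norm1 (n - 1) (\<lambda>l. X M l s - \<xi> l s) \<le> real (n - 1) * c" for s
      proof -
        have "(\<Sum>l\<in>J. norm (X M l s - \<xi> l s)) \<le> of_nat (card J) * c"
          by (rule sum_bounded_above) (use M[of M _ s] in \<open>force intro: less_imp_le\<close>)
        then show ?thesis by (simp add: norm1_def)
      qed
      from T_contraction[OF adm adm\<xi> this, of t]
      have "norm (X (Suc M) l t - T \<xi> l t) \<le> q * (real (n - 1) * c)"
        using norm_le_norm1[OF l, of "\<lambda>l. X (Suc M) l t - T \<xi> l t"] by (simp add: XS)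
      also have "\<dots> \<le> 1 * (real n * c)" using q q_nonneg c by (intro mult_mono) auto
      finally have "norm (X (Suc M) l t - T \<xi> l t) \<le> real n * c" by simp
      moreover have "norm (\<xi> l t - X (Suc M) l t) \<le> c"
        using M[of "Suc M" l t] l by (simp add: norm_minus_commute)
      moreover have "c + real n * c = e"
      proof -
        have "real n + 1 \<noteq> 0" using of_nat_0_le_iff[of n, where ?'a = real] by linarith
        then have "(real n + 1) * c = e" by (simp add: c_def)
        then show ?thesis by (simp add: distrib_right)
      qed
      ultimately show ?thesis
        using norm_triangle_ineq[of "\<xi> l t - X (Suc M) l t" "X (Suc M) l t - T \<xi> l t"] by simp
    qed
    then have "norm (\<xi> l t - T \<xi> l t) \<le> 0" by (rule dense_ge)
    then show ?thesis by simp
  qed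
  then show ?thesis using adm\<xi> unfolding fixed_point_def by blast
qed

lemma fixed_point_AP:
  assumes q: "q < 1" and fp: "fixed_point \<xi>" and l: "l \<in> J"
  shows "AP (\<xi> l)"
proof -
  have adm: "admissible \<xi>" and eq: "\<And>l t. l \<in> J \<Longrightarrow> \<xi> l t = T \<xi> l t"
    using fp by (auto simp: fixed_point_def)
  obtain K where K: "0 \<le> K" "\<And>\<rho> \<rho>' X e. norm1 (n - 1) X \<le> d \<Longrightarrow> (\<And>i. i \<le> n \<Longrightarrow> norm (\<rho> i - \<rho>' i) \<le> e) \<Longrightarrow>
      norm (rhs n a x \<rho> X - rhs n a x \<rho>' X) \<le> K * e"
    using rhs_lipschitz_coeff[of n d a x] n3 d by auto
  define C where "C = (\<Sum>j\<in>J. weight j * (K / \<bar>Re (g j)\<bar>))"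
  show ?thesis
  proof (rule AP_transfer[where r = r and n = n and C = "C / (1 - q)"])
    show "continuous_on UNIV (\<xi> l)" using adm l by (simp add: admissible_def)
  next
    fix c e :: real
    assume e: "\<And>i s. i < n \<Longrightarrow> norm (r i (s + c) - r i s) \<le> e" and e0: "e > 0"
    have e': "norm (r i (s + c) - r i s) \<le> e" if "i \<le> n" for i s
      using e[of i s] rn e0 that by (cases "i = n") auto
    define \<eta> where "\<eta> l s = \<xi> l (s + c)" for l s
    have adm\<eta>: "admissible \<eta>" using admissible_shift[OF adm, of c] by (simp add: \<eta>_def[abs_def])
    define N where "N t = norm1 (n - 1) (\<lambda>l. \<eta> l t - \<xi> l t)" for t
    have N_bdd: "bdd_above (range N)"
    proof (rule bdd_aboveI2)
      fix t
      have "N t \<le> norm1 (n - 1) (\<lambda>l. \<eta> l t) + norm1 (n - 1) (\<lambda>l. \<xi> l t)"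
        unfolding N_def norm1_def sum.distrib[symmetric] by (intro sum_mono norm_triangle_ineq4)
      also have "\<dots> \<le> d + d" using adm adm\<eta> by (intro add_mono) (auto simp: admissible_def)
      finally show "N t \<le> d + d" .
    qed
    \<comment> \<open>Both jets lie in the ball of radius \<open>d\<close>, so the supremum is
      finite and an inequality \<open>D \<le> q * D + C * e\<close> can be solved for
      \<open>D\<close>.\<close>
    define D where "D = (SUP t. N t)"
    have ND: "N t \<le> D" for t unfolding D_def by (rule cSUP_upper[OF _ N_bdd]) simp
    \<comment> \<open>The part of the source difference caused by the coefficients alone: both terms
      use the translated jet, so \<open>u\<close> is of order \<open>e\<close>. The remaining part
      has equal coefficients and is left to \<open>contraction\<close>.\<close>
    define u where "u s = src \<xi> (s + c) - src \<eta> s" for s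
    have sb: "bcont (\<lambda>s. src \<xi> (s + c))" "bcont (src \<eta>)" "bcont (src \<xi>)"
      by (intro bcont_shift src_bcont adm adm\<eta>)+
    have ub: "bcont u" unfolding u_def[abs_def] by (intro bcont_diff sb)
    have ue: "norm (u s) \<le> K * e" for s
      unfolding u_def src_def \<eta>_def[symmetric] using adm\<eta> e' by (intro K(2)) (auto simp: admissible_def)
    have N_le: "N t \<le> q * D + C * e" for t
    proof -
      have \<eta>_eq: "\<eta> l t = - Gd (\<lambda>s. src \<xi> (s + c)) (l - 1) t" if "l \<in> J" for l
        using eq[OF that] by (simp add: \<eta>_def T_def Gd_def G_op_shift)
      have "N t = norm1 (n - 1) (\<lambda>l. - Gd (\<lambda>s. src \<xi> (s + c) - src \<xi> s) (l - 1) t)"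
        unfolding N_def by (rule norm1_cong) (simp add: \<eta>_eq eq T_def Gd_diff sb)
      also have "\<dots> \<le> (\<Sum>j\<in>J. weight j * norm (G_op (g j) (\<lambda>s. src \<xi> (s + c) - src \<xi> s) t))"
        by (rule norm1_Gd_le)
      also have "\<dots> \<le> (\<Sum>j\<in>J. weight j * norm (G_op (g j) (\<lambda>s. src \<eta> s - src \<xi> s) t) + weight j * (K / \<bar>Re (g j)\<bar>) * e)"
      proof (rule sum_mono)
        fix j assume j: "j \<in> J"
        obtain B where B: "continuous_on UNIV (\<lambda>s. src \<xi> (s + c) - src \<xi> s)" "\<And>s. norm (src \<xi> (s + c) - src \<xi> s) \<le> B"
          using bcontE[OF bcont_diff[OF sb(1) sb(3)]] by blast
        have cu: "continuous_on UNIV u" using ub by (simp add: bcont_def)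
        have "G_op (g j) (\<lambda>s. (src \<xi> (s + c) - src \<xi> s) - u s) t = G_op (g j) (\<lambda>s. src \<xi> (s + c) - src \<xi> s) t - G_op (g j) u t"
          by (rule G_op_diff[OF Re_gam[OF j] B cu ue])
        then have split: "G_op (g j) (\<lambda>s. src \<xi> (s + c) - src \<xi> s) t = G_op (g j) (\<lambda>s. src \<eta> s - src \<xi> s) t + G_op (g j) u t"
          by (simp add: u_def algebra_simps)
        have "norm (G_op (g j) (\<lambda>s. src \<xi> (s + c) - src \<xi> s) t) \<le> norm (G_op (g j) (\<lambda>s. src \<eta> s - src \<xi> s) t) + norm (G_op (g j) u t)"
          unfolding split by (rule norm_triangle_ineq)
        also have "\<dots> \<le> norm (G_op (g j) (\<lambda>s. src \<eta> s - src \<xi> s) t) + K * e / \<bar>Re (g j)\<bar>"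
          by (intro add_left_mono G_op_bounded[OF Re_gam[OF j] cu ue])
        finally have "norm (G_op (g j) (\<lambda>s. src \<xi> (s + c) - src \<xi> s) t) \<le> norm (G_op (g j) (\<lambda>s. src \<eta> s - src \<xi> s) t) + K * e / \<bar>Re (g j)\<bar>" .
        then have "weight j * norm (G_op (g j) (\<lambda>s. src \<xi> (s + c) - src \<xi> s) t) \<le>
            weight j * (norm (G_op (g j) (\<lambda>s. src \<eta> s - src \<xi> s) t) + K * e / \<bar>Re (g j)\<bar>)"
          by (rule mult_left_mono[OF _ weight_nonneg])
        then show "weight j * norm (G_op (g j) (\<lambda>s. src \<xi> (s + c) - src \<xi> s) t) \<le>
            weight j * norm (G_op (g j) (\<lambda>s. src \<eta> s - src \<xi> s) t) + weight j * (K / \<bar>Re (g j)\<bar>) * e"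
          by (simp add: distrib_left)
      qed
      also have "\<dots> \<le> q * D + C * e"
        unfolding sum.distrib C_def sum_distrib_right
        using contraction[OF adm\<eta> adm ND[unfolded N_def], of t] by simp
      finally show ?thesis .
    qed
    have "(SUP t. N t) \<le> q * D + C * e" by (rule cSUP_least) (simp_all add: N_le)
    then have "D * (1 - q) \<le> C * e" unfolding D_def[symmetric] by (simp add: algebra_simps)
    then have D_le: "D \<le> C / (1 - q) * e" using q by (simp add: pos_le_divide_eq)
    show "\<forall>t. norm (\<xi> l (t + c) - \<xi> l t) \<le> C / (1 - q) * e"
    proof
      fix t
      have "norm (\<xi> l (t + c) - \<xi> l t) \<le> N t"
        unfolding N_def \<eta>_def using norm_le_norm1[OF l, of "\<lambda>l. \<xi> l (t + c) - \<xi> l t"] .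
      also note ND[of t]
      also note D_le
      finally show "norm (\<xi> l (t + c) - \<xi> l t) \<le> C / (1 - q) * e" .
    qed
  qed (rule r_AP)
qed

text \<open>If \<open>q = 1\<close> the hypothesis on \<open>H\<close> forces \<open>G\<^sup>\<lambda>[P(r; \<lambda>)] = 0\<close>, and \<open>0\<close> is a fixed point.\<close>

lemma fixed_point_exists:
  "\<exists>\<xi>. fixed_point \<xi> \<and> (\<forall>l\<in>J. AP (\<xi> l))"
proof (cases "q < 1")
  case True
  then show ?thesis using T_fixed_point_exists fixed_point_AP by blast
next
  case False
  then have "q = 1" using q_le_1 by simp
  have "T (\<lambda>l s. 0) l t = 0" if "l \<in> J" for l t
  proof -
    have "norm1 (n - 1) (\<lambda>l. T (\<lambda>l s. 0) l t) \<le> 0" using norm1_T_zero_le[of t] \<open>q = 1\<close> by simp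
    then have "norm (T (\<lambda>l s. 0) l t) \<le> 0"
      using norm_le_norm1[OF that, of "\<lambda>l. T (\<lambda>l s. 0) l t"] by linarith
    then show ?thesis by simp
  qed
  then have "fixed_point (\<lambda>l s. 0)" by (simp add: fixed_point_def admissible_zero)
  then show ?thesis using AP_const by blast
qed

section \<open>From the fixed point to a solution of the linear equation\<close>

lemma fixed_point_solves:
  assumes fp: "fixed_point \<xi>" and AP: "\<forall>l\<in>J. AP (\<xi> l)"
  defines "z \<equiv> \<lambda>t. - G_lam n lam k (src \<xi>) t"
  shows "src \<xi> s = Pr n r x s + L_op n r lam k s z + F_op n a r lam k s (jet z s)"
    and "AP_deriv (n - 2) z" and "times_differentiable (n - 1) z"
    and "D_op n a lam k z t + src \<xi> t = 0"
    and "norm1 (n - 1) (jet z t) \<le> d"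
proof -
  have adm: "admissible \<xi>" and eq: "\<And>l t. l \<in> J \<Longrightarrow> \<xi> l t = T \<xi> l t"
    using fp by (auto simp: fixed_point_def)
  note bc = src_bcont[OF adm]
  \<comment> \<open>Only at order \<open>n - 1\<close> does the derivative differ from
    \<open>- Gd\<close>, by the source itself. In \<open>D_op\<close> the \<open>Gd\<close> parts
    cancel by \<open>sum_Pder_Gd\<close>, and this extra term survives with coefficient
    \<open>1\<close>.\<close>
  define Z where "Z i t = - (Gd (src \<xi>) i t + (if i = n - 1 then src \<xi> t else 0))" for i t
  have z: "z = Z 0" using n3 by (simp add: z_def Z_def G_lam_eq fun_eq_iff)
  have Z: "Z i = (\<lambda>t. - Gd (src \<xi>) i t)" if "i \<le> n - 2" for i
    using that n3 by (simp add: Z_def fun_eq_iff)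
  have deriv: "(Z i has_vector_derivative Z (Suc i) t) (at t)" if "i < n - 1" for i t
  proof -
    have i: "i \<le> n - 2" using that by simp
    have "Z (Suc i) t = - (Gd (src \<xi>) (Suc i) t + (if i = n - 2 then src \<xi> t else 0))"
      using that n3 by (auto simp: Z_def)
    then show ?thesis
      using has_vector_derivative_minus[OF Gd_has_vector_derivative[OF bc i, of t]] by (simp only: Z[OF i])
  qed
  have nd: "nderiv i z = Z i" if "i \<le> n - 1" for i
    unfolding z by (rule nderiv_chain(1)[where x = Z, OF deriv that])
  show td: "times_differentiable (n - 1) z"
    unfolding z by (rule nderiv_chain(2)[where x = Z, OF deriv])
  have jet: "jet z s l = \<xi> l s" if "l \<in> J" for l s
  proof -
    have l: "l - 1 \<le> n - 1" "l - 1 \<le> n - 2" using that by auto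
    show ?thesis unfolding jet_def nd[OF l(1)] Z[OF l(2)] eq[OF that] T_def ..
  qed
  show "src \<xi> s = Pr n r x s + L_op n r lam k s z + F_op n a r lam k s (jet z s)"
    unfolding rhs_eq[symmetric] src_def by (rule rhs_cong) (simp add: jet)
  show "norm1 (n - 1) (jet z t) \<le> d"
    using adm norm1_cong[of "n - 1" "jet z t" "\<lambda>l. \<xi> l t"] jet by (simp add: admissible_def)
  have "AP (nderiv i z)" if "i \<le> n - 2" for i
  proof -
    have l: "i + 1 \<in> J" using that n3 by auto
    have "nderiv i z = \<xi> (i + 1)" using jet[OF l] by (simp add: fun_eq_iff jet_def)
    then show ?thesis using bspec[OF AP l] by simp
  qed
  then show "AP_deriv (n - 2) z"
    using td by (auto simp: AP_deriv_def times_differentiable_def)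
  have "D_op n a lam k z t = (\<Sum>m=1..n. 1 / fact m * Pder n m a x * Z (m - 1) t)"
    unfolding D_op_def by (intro sum.cong) (auto simp: nd)
  also have "\<dots> = - (\<Sum>m=1..n. 1 / fact m * Pder n m a x * Gd (src \<xi>) (m - 1) t) -
      (\<Sum>m=1..n. if m = n then src \<xi> t else 0)"
  proof -
    have "1 / fact m * Pder n m a x * Z (m - 1) t = - (1 / fact m * Pder n m a x * Gd (src \<xi>) (m - 1) t) -
        (if m = n then src \<xi> t else 0)" if "m \<in> {1..n}" for m
      using that n3 by (auto simp: Z_def Pder_top algebra_simps)
    then have "(\<Sum>m=1..n. 1 / fact m * Pder n m a x * Z (m - 1) t) =
        (\<Sum>m=1..n. - (1 / fact m * Pder n m a x * Gd (src \<xi>) (m - 1) t) - (if m = n then src \<xi> t else 0))"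
      by (rule sum.cong[OF refl])
    then show ?thesis by (simp only: sum_subtractf sum_negf)
  qed
  also have "\<dots> = - src \<xi> t" using n3 by (simp only: sum_Pder_Gd) simp
  finally show "D_op n a lam k z t + src \<xi> t = 0" by simp
qed

text \<open>Sorted by Bell index, order \<open>0\<close> leaves only the part from \<open>r\<close>,
  because \<open>x\<close> is a root. The linear part of each Bell polynomial gives
  \<open>D_op\<close> and \<open>L_op\<close>, the rest gives \<open>F_op\<close>.
  \<open>L_op\<close> stops at \<open>n - 1\<close> because \<open>r n\<close> vanishes, and
  \<open>F_op\<close> starts at \<open>2\<close> because \<open>bell_f 0\<close> does.\<close>

lemma sum_coeff_bell:
  "(\<Sum>i\<le>n. (a i + r i t) * (\<Sum>j\<le>i. of_nat (i choose j) * x ^ j * bell (i - j) (jet z t))) =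
    Pr n r x t + D_op n a lam k z t + L_op n r lam k t z + F_op n a r lam k t (jet z t)"
proof -
  define \<kappa> where "\<kappa> c m = (\<Sum>j=0..n-m. of_nat ((m + j) choose j) * c (m + j) * x ^ j)" for c :: "nat \<Rightarrow> complex" and m
  have \<kappa>: "Pder n m c x = fact m * \<kappa> c m" if "m \<le> n" for m c
    unfolding \<kappa>_def by (rule Pder_eq[OF that])
  let ?c = "\<lambda>i. a i + r i t"
  have add: "\<kappa> ?c m = \<kappa> a m + \<kappa> (\<lambda>i. r i t) m" for m
    by (simp add: \<kappa>_def distrib_left distrib_right sum.distrib)
  have zero: "\<kappa> a 0 = 0"
    using root[OF k] by (simp add: \<kappa>_def poly_Ppoly atMost_atLeast0)
  have top: "\<kappa> (\<lambda>i. r i t) n = 0" using rn by (simp add: \<kappa>_def)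
  have r0: "\<kappa> (\<lambda>i. r i t) 0 = Pr n r x t"
  proof -
    have "{0..n} = insert n {0..n-1}" using n3 by auto
    then show ?thesis using rn n3 by (simp add: \<kappa>_def Pr_def mult.commute)
  qed
  have "(\<Sum>i\<le>n. ?c i * (\<Sum>j\<le>i. of_nat (i choose j) * x ^ j * bell (i - j) (jet z t))) =
      (\<Sum>m\<le>n. \<kappa> ?c m * bell m (jet z t))"
    unfolding \<kappa>_def by (rule sum_shift_binomial)
  also have "\<dots> = \<kappa> ?c 0 + (\<Sum>m=1..n. \<kappa> ?c m * bell m (jet z t))"
    unfolding atMost_atLeast0 by (simp add: sum.atLeast_Suc_atMost)
  also have "\<kappa> ?c 0 = Pr n r x t" by (simp add: add zero r0)
  also have "(\<Sum>m=1..n. \<kappa> ?c m * bell m (jet z t)) =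
      (\<Sum>m=1..n. \<kappa> a m * jet z t m + (\<kappa> (\<lambda>i. r i t) m * jet z t m + \<kappa> ?c m * bell_f (m - 1) (jet z t)))"
  proof (rule sum.cong[OF refl])
    fix m assume "m \<in> {1..n}"
    then have "bell m (jet z t) = jet z t m + bell_f (m - 1) (jet z t)" by (intro bell_eq) auto
    then show "\<kappa> ?c m * bell m (jet z t) = \<kappa> a m * jet z t m + (\<kappa> (\<lambda>i. r i t) m * jet z t m + \<kappa> ?c m * bell_f (m - 1) (jet z t))"
      unfolding add by (simp add: distrib_left distrib_right)
  qed
  also have "\<dots> = (\<Sum>m=1..n. \<kappa> a m * jet z t m) + ((\<Sum>m=1..n. \<kappa> (\<lambda>i. r i t) m * jet z t m) +
      (\<Sum>m=1..n. \<kappa> ?c m * bell_f (m - 1) (jet z t)))"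
    by (simp only: sum.distrib)
  also have "(\<Sum>m=1..n. \<kappa> a m * jet z t m) = D_op n a lam k z t"
    unfolding D_op_def by (intro sum.cong) (auto simp: \<kappa> jet_def)
  also have "(\<Sum>m=1..n. \<kappa> (\<lambda>i. r i t) m * jet z t m) = L_op n r lam k t z"
  proof -
    have "{1..n} = insert n {1..n-1}" using n3 by auto
    moreover have "n \<notin> {1..n-1}" using n3 by auto
    ultimately have "(\<Sum>m=1..n. \<kappa> (\<lambda>i. r i t) m * jet z t m) = (\<Sum>m=1..n-1. \<kappa> (\<lambda>i. r i t) m * jet z t m)"
      by (simp add: top)
    also have "\<dots> = L_op n r lam k t z"
      unfolding L_op_def by (intro sum.cong) (auto simp: \<kappa> jet_def)
    finally show ?thesis .
  qed
  also have "(\<Sum>m=1..n. \<kappa> ?c m * bell_f (m - 1) (jet z t)) = F_op n a r lam k t (jet z t)"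
  proof -
    have "{1..n} = insert 1 {2..n}" using n3 by auto
    then have "(\<Sum>m=1..n. \<kappa> ?c m * bell_f (m - 1) (jet z t)) = (\<Sum>m=2..n. \<kappa> ?c m * bell_f (m - 1) (jet z t))"
      by (simp add: bell_f_eq[of 0])
    then show ?thesis unfolding F_op_def \<kappa>_def sum_distrib_right .
  qed
  finally show ?thesis by (simp add: add_ac)
qed

text \<open>The top variable contributes \<open>d\<close> and the nonlinear rest
  \<open>m(d) d\<close>; hence the factor \<open>M_k (m(M_k) + 1)\<close> of the hypothesis.\<close>

lemma norm_jet_bell_le:
  assumes X: "norm1 (n - 1) X \<le> d" and p: "1 \<le> p" "p \<le> n - 1"
  shows "norm (bell p X) \<le> d * (m_fun n d + 1)"
proof -
  have "norm (X p) \<le> d" using norm_le_norm1[of p "n - 1" X] X p by simp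
  moreover have "norm (bell_f (p - 1) X) \<le> m_fun n d * d"
  proof (cases "p = 1")
    case True
    then show ?thesis using m_nonneg d by (simp add: bell_f_eq[of 0])
  next
    case False
    have le: "norm1 (p - 1) X \<le> d" by (rule order_trans[OF norm1_mono X]) (use p in auto)
    have "norm (bell_f (p - 1) X) \<le> m_fun n d * norm1 (p - 1) X"
      using False p n3 d le by (intro norm_bell_f_le) auto
    also have "\<dots> \<le> m_fun n d * d" by (intro mult_left_mono le m_nonneg)
    finally show ?thesis .
  qed
  moreover have "bell p X = X p + bell_f (p - 1) X" using p by (intro bell_eq) auto
  ultimately show ?thesis using norm_triangle_ineq[of "X p" "bell_f (p - 1) X"] by (simp add: algebra_simps)
qed

text \<open>The summand \<open>j = i\<close> is \<open>x ^ i\<close>. The others carry Bell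
  polynomials of positive index, and the binomial theorem sums their coefficients. The condition
  \<open>i < n\<close> keeps these indices within the jet.\<close>

lemma norm_shifted_bell_le:
  assumes X: "norm1 (n - 1) X \<le> d" and i: "i < n"
  shows "norm ((\<Sum>j\<le>i. of_nat (i choose j) * x ^ j * bell (i - j) X) - x ^ i) \<le>
    d * (m_fun n d + 1) * ((norm x + 1) ^ i - norm x ^ i)"
proof -
  have "(\<Sum>j\<le>i. of_nat (i choose j) * x ^ j * bell (i - j) X) - x ^ i =
      (\<Sum>j<i. of_nat (i choose j) * x ^ j * bell (i - j) X)"
    by (simp add: lessThan_Suc_atMost[symmetric])
  also have "norm \<dots> \<le> (\<Sum>j<i. real (i choose j) * norm x ^ j * (d * (m_fun n d + 1)))"
  proof (rule sum_norm_le)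
    fix j assume "j \<in> {..<i}"
    then have "norm (bell (i - j) X) \<le> d * (m_fun n d + 1)" using i by (intro norm_jet_bell_le X) auto
    then show "norm (of_nat (i choose j) * x ^ j * bell (i - j) X) \<le> real (i choose j) * norm x ^ j * (d * (m_fun n d + 1))"
      unfolding norm_mult norm_power norm_of_nat by (intro mult_left_mono) auto
  qed
  also have "\<dots> = d * (m_fun n d + 1) * (\<Sum>j<i. real (i choose j) * norm x ^ j)"
    by (simp only: sum_distrib_left mult_ac)
  also have "(\<Sum>j<i. real (i choose j) * norm x ^ j) = (norm x + 1) ^ i - norm x ^ i"
    by (simp add: binomial_ring lessThan_Suc_atMost[symmetric])
  finally show ?thesis .
qed

text \<open>Each Green operator divided by \<open>\<Gamma> j * g j\<close> has as derivative the
  summand of \<open>G_lam\<close> plus a multiple of \<open>R\<close>. By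
  \<open>sum_inverse_gam\<close> the integral term cancels exactly the sum of these
  multiples.\<close>

lemma exponent_has_vector_derivative:
  assumes "bcont R"
  shows "((\<lambda>t. - (\<Sum>j\<in>J. 1 / (\<Gamma> j * g j) * G_op (g j) R t) +
      (- 1) ^ n * (\<Prod>j\<in>{1..n} - {k}. inverse (lam j - x)) * (LBINT s=ereal 0..ereal t. R s))
    has_vector_derivative - G_lam n lam k R t) (at t)"
proof -
  obtain B where B: "continuous_on UNIV R" "\<And>s. norm (R s) \<le> B" using assms by (metis bcontE)
  let ?c = "(- 1) ^ n * (\<Prod>j\<in>{1..n} - {k}. inverse (lam j - x))"
  define b where "b = \<bar>t\<bar> + 1"
  \<comment> \<open>The interval contains the base point \<open>0\<close> and has \<open>t\<close>
    in its interior, whatever the sign of \<open>t\<close>.\<close>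
  have "((\<lambda>u. LBINT s=ereal 0..ereal u. R s) has_vector_derivative R t) (at t within {-b..b})"
    using interval_integral_FTC2[of "-b" 0 b R t] continuous_on_subset[OF B(1)] by (auto simp: b_def zero_ereal_def)
  then have int: "((\<lambda>u. LBINT s=ereal 0..ereal u. R s) has_vector_derivative R t) (at t)"
    by (subst (asm) at_within_interior) (auto simp: b_def)
  have "((\<lambda>t. - (\<Sum>j\<in>J. 1 / (\<Gamma> j * g j) * G_op (g j) R t) + ?c * (LBINT s=ereal 0..ereal t. R s))
    has_vector_derivative - (\<Sum>j\<in>J. 1 / (\<Gamma> j * g j) * (g j * G_op (g j) R t + R t)) + ?c * R t) (at t)"
    by (intro has_vector_derivative_add has_vector_derivative_minus has_vector_derivative_sum
        has_vector_derivative_mult_right G_op_has_vector_derivative[OF Re_gam B] int)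
  moreover have "(\<Sum>j\<in>J. 1 / (\<Gamma> j * g j) * (g j * G_op (g j) R t + R t)) = G_lam n lam k R t + ?c * R t"
  proof -
    have "1 / (\<Gamma> j * g j) * (g j * G_op (g j) R t + R t) = 1 / \<Gamma> j * G_op (g j) R t + 1 / (\<Gamma> j * g j) * R t"
      if "j \<in> J" for j
      using gam_nonzero[OF that] by (simp add: distrib_left)
    then have "(\<Sum>j\<in>J. 1 / (\<Gamma> j * g j) * (g j * G_op (g j) R t + R t)) =
        (\<Sum>j\<in>J. 1 / \<Gamma> j * G_op (g j) R t + 1 / (\<Gamma> j * g j) * R t)"
      by (rule sum.cong[OF refl])
    also have "\<dots> = G_lam n lam k R t + (\<Sum>j\<in>J. 1 / (\<Gamma> j * g j)) * R t"
      unfolding G_lam_def sum.distrib sum_distrib_right ..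
    finally show ?thesis unfolding sum_inverse_gam .
  qed
  ultimately show ?thesis by simp
qed

text \<open>With \<open>v' = z v\<close>, the functions \<open>v B\<^sub>i(z, z', \<dots>)\<close> are the successive derivatives of \<open>v\<close>: the
  recursion of the Bell polynomials is the Leibniz rule for \<open>(z v)\<^sup>(\<^sup>i\<^sup>)\<close>.\<close>

lemma nderiv_exp_mult:
  assumes v: "\<And>t. (v has_vector_derivative z t * v t) (at t)" and z: "times_differentiable (n - 1) z"
  defines "y \<equiv> \<lambda>t. exp (x * complex_of_real t) * v t"
  shows "times_differentiable n y"
    and "i \<le> n \<Longrightarrow> nderiv i y t = y t * (\<Sum>j\<le>i. of_nat (i choose j) * x ^ j * bell (i - j) (jet z t))"
proof -
  define U where "U i t = v t * bell i (jet z t)" for i t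
  have zd: "(nderiv j z has_vector_derivative nderiv (Suc j) z t) (at t)" if "j < n - 1" for j t
    using z that unfolding times_differentiable_def nderiv_def by (simp add: vector_derivative_works)
  have U_Suc: "U (Suc i) = leibniz U (\<lambda>j. nderiv j z) i" for i
    by (rule ext) (simp add: U_def leibniz_def jet_def sum_distrib_left mult_ac)
  have U: "(U i has_vector_derivative U (Suc i) t) (at t)" if "i < n" for i t
    using that
  proof (induction i rule: less_induct)
    case (less i)
    show ?case
    proof (cases i)
      case 0
      have "U 0 = v" "U (Suc 0) t = z t * v t"
        by (simp_all add: U_def fun_eq_iff jet_def nderiv_def)
      then show ?thesis using v[of t] 0 by simp
    next
      case (Suc m)
      have "(leibniz U (\<lambda>j. nderiv j z) m has_vector_derivative leibniz U (\<lambda>j. nderiv j z) (Suc m) t) (at t)"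
        using less Suc by (intro leibniz_has_vector_derivative zd) auto
      then show ?thesis unfolding Suc U_Suc .
    qed
  qed
  define E where "E j t = x ^ j * exp (x * complex_of_real t)" for j t
  have E: "(E j has_vector_derivative E (Suc j) t) (at t)" for j t
    unfolding E_def[abs_def]
    by (auto intro!: derivative_eq_intros has_vector_derivative_real_field simp: mult_ac)
  have Y: "(leibniz U E i has_vector_derivative leibniz U E (Suc i) t) (at t)" if "i < n" for i t
    using that by (intro leibniz_has_vector_derivative U E) auto
  have y: "y = leibniz U E 0"
    by (rule ext) (simp add: y_def leibniz_def U_def E_def)
  show "times_differentiable n y" unfolding y by (rule nderiv_chain(2)[where x = "leibniz U E", OF Y])
  have "leibniz U E i t = y t * (\<Sum>j\<le>i. of_nat (i choose j) * x ^ j * bell (i - j) (jet z t))"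
    by (simp add: leibniz_def y_def U_def E_def sum_distrib_left mult_ac)
  moreover have "nderiv i y = leibniz U E i" if "i \<le> n"
    unfolding y by (rule nderiv_chain(1)[where x = "leibniz U E", OF Y that])
  ultimately show "nderiv i y t = y t * (\<Sum>j\<le>i. of_nat (i choose j) * x ^ j * bell (i - j) (jet z t))" if "i \<le> n"
    using that by simp
qed

text \<open>The quotients \<beta> of the derivatives by \<open>y\<close> are returned with their
  bounds because, taken at \<open>0\<close>, they are the entries of the perturbed Vandermonde
  matrix.\<close>

lemma solution_exists:
  obtains y z \<beta> where "solution n a r y" "times_differentiable n y"
    and "\<And>t. y t \<noteq> 0" "\<And>i t. i \<le> n \<Longrightarrow> nderiv i y t = y t * \<beta> i t"
    and "\<And>i t. i < n \<Longrightarrow> norm (\<beta> i t - x ^ i) \<le> d * (m_fun n d + 1) * ((norm x + 1) ^ i - norm x ^ i)"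
    and "let R = (\<lambda>s. Pr n r x s + L_op n r lam k s z + F_op n a r lam k s (jet z s))
         in
           (\<forall>t. y t =
              exp (x * complex_of_real t)
              * exp (- (\<Sum>j=1..n-1.
                   1 / (\<Gamma> j * g j) * G_op (g j) R t))
              * exp ((-1) ^ n * (\<Prod>j\<in>{1..n} - {k}. inverse (lam j - x))
                   * (LBINT s=ereal 0..ereal t. R s))) \<and>
           AP_deriv (n - 2) z \<and>
           times_differentiable (n - 1) z \<and>
           (\<forall>t. D_op n a lam k z t + R t = 0) \<and>
           (\<forall>t. z t = - G_lam n lam k R t)"
proof -
  obtain \<xi> where fp: "fixed_point \<xi>" and AP: "\<forall>l\<in>J. AP (\<xi> l)"
    using fixed_point_exists by blast
  define z where "z = (\<lambda>t. - G_lam n lam k (src \<xi>) t)"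
  note Z = fixed_point_solves[OF fp AP, folded z_def]
  define R where "R = (\<lambda>s. Pr n r x s + L_op n r lam k s z + F_op n a r lam k s (jet z s))"
  have R: "src \<xi> = R" using Z(1) by (simp add: R_def fun_eq_iff)
  have bc: "bcont R" using fp src_bcont by (auto simp: R[symmetric] fixed_point_def)
  define e where "e t = - (\<Sum>j\<in>J. 1 / (\<Gamma> j * g j) * G_op (g j) R t) +
      (- 1) ^ n * (\<Prod>j\<in>{1..n} - {k}. inverse (lam j - x)) * (LBINT s=ereal 0..ereal t. R s)" for t
  define v where "v t = exp (e t)" for t
  define y where "y t = exp (x * complex_of_real t) * v t" for t
  define \<beta> where "\<beta> i t = (\<Sum>j\<le>i. of_nat (i choose j) * x ^ j * bell (i - j) (jet z t))" for i t
  have "(v has_vector_derivative z t * v t) (at t)" for t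
  proof -
    have "(e has_vector_derivative z t) (at t)"
      using exponent_has_vector_derivative[OF bc, of t] by (simp add: e_def[abs_def] z_def R)
    then have "((exp \<circ> e) has_vector_derivative z t * exp (e t)) (at t)"
      by (rule field_vector_diff_chain_at) (rule DERIV_exp)
    then show ?thesis by (simp add: v_def[abs_def] o_def)
  qed
  note Y = nderiv_exp_mult[OF this Z(3), folded y_def[abs_def], folded y_def \<beta>_def]
  have sol: "solution n a r y"
    unfolding solution_def
  proof (intro conjI allI Y(1))
    fix t
    have "nderiv n y t + (\<Sum>i=0..n-1. (a i + r i t) * nderiv i y t) = (\<Sum>i\<le>n. (a i + r i t) * nderiv i y t)"
    proof -
      have "{..n} = insert n {0..n-1}" using n3 by auto
      then show ?thesis using n3 an rn by simp
    qed
    also have "\<dots> = (\<Sum>i\<le>n. y t * ((a i + r i t) * \<beta> i t))"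
    proof (rule sum.cong[OF refl])
      fix i assume "i \<in> {..n}"
      then have "nderiv i y t = y t * \<beta> i t" by (intro Y(2)) auto
      then show "(a i + r i t) * nderiv i y t = y t * ((a i + r i t) * \<beta> i t)" by simp
    qed
    also have "\<dots> = y t * (\<Sum>i\<le>n. (a i + r i t) * \<beta> i t)"
      by (simp only: sum_distrib_left)
    also have "(\<Sum>i\<le>n. (a i + r i t) * \<beta> i t) = D_op n a lam k z t + R t"
      unfolding \<beta>_def sum_coeff_bell R_def by simp
    also have "\<dots> = 0" using Z(4)[of t] by (simp add: R)
    finally show "nderiv n y t + (\<Sum>i=0..n-1. (a i + r i t) * nderiv i y t) = 0" by simp
  qed
  show ?thesis
  proof (rule that[of y \<beta> z])
    show "y t \<noteq> 0" for t by (simp add: y_def v_def)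
    show "norm (\<beta> i t - x ^ i) \<le> d * (m_fun n d + 1) * ((norm x + 1) ^ i - norm x ^ i)" if "i < n" for i t
      unfolding \<beta>_def by (rule norm_shifted_bell_le[OF Z(5) that])
    show "nderiv i y t = y t * \<beta> i t" if "i \<le> n" for i t by (rule Y(2)[OF that])
    have "D_op n a lam k z t + R t = 0" "z t = - G_lam n lam k R t" for t
      using Z(4)[of t] by (simp_all add: R z_def)
    moreover have "y t = exp (x * complex_of_real t) * exp (- (\<Sum>j\<in>J. 1 / (\<Gamma> j * g j) * G_op (g j) R t)) *
        exp ((-1) ^ n * (\<Prod>j\<in>{1..n} - {k}. inverse (lam j - x)) * (LBINT s=ereal 0..ereal t. R s))" for t
      unfolding y_def v_def e_def exp_add by (rule mult.assoc[symmetric])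
    ultimately show "let R = (\<lambda>s. Pr n r x s + L_op n r lam k s z + F_op n a r lam k s (jet z s))
         in
           (\<forall>t. y t =
              exp (x * complex_of_real t)
              * exp (- (\<Sum>j=1..n-1.
                   1 / (\<Gamma> j * g j) * G_op (g j) R t))
              * exp ((-1) ^ n * (\<Prod>j\<in>{1..n} - {k}. inverse (lam j - x))
                   * (LBINT s=ereal 0..ereal t. R s))) \<and>
           AP_deriv (n - 2) z \<and>
           times_differentiable (n - 1) z \<and>
           (\<forall>t. D_op n a lam k z t + R t = 0) \<and>
           (\<forall>t. z t = - G_lam n lam k R t)"
      unfolding R_def[symmetric] Let_def using Z(2,3) by blast
  qed (rule sol Y(1))+
qed

end

section \<open>The solutions for all roots and their linear independence\<close>

theorem theorem3p4:
  fixes n :: nat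
    and a :: "nat \<Rightarrow> complex"
    and r :: "nat \<Rightarrow> real \<Rightarrow> complex"
    and lam :: "nat \<Rightarrow> complex"
    and M :: "nat \<Rightarrow> real"
  assumes n3: "n \<ge> 3"
    and an: "a n = 1"
    and rAP: "\<forall>i<n. AP (r i)"
    and rn: "\<forall>t. r n t = 0"
    and roots: "proots (Ppoly n a) = image_mset lam (mset_set {1..n})"
    and Re_distinct: "\<forall>i\<in>{1..n}. \<forall>j\<in>{1..n}. i \<noteq> j \<longrightarrow> Re (lam i) \<noteq> Re (lam j)"
    and L0_less: "\<forall>k\<in>{1..n}. L0 n r lam k < 1"
    and M_range: "\<forall>k\<in>{1..n}. 0 < M k \<and> M k < Min ((\<lambda>l. delta_lam n a r lam l) ` {1..n})"
    and H_le: "\<forall>k\<in>{1..n}. H_lam n r lam k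
                 \<le> (1 - L0 n r lam k - m_fun n (M k) * Q0 n a r lam k) * M k"
    and V_less: "Max ((\<lambda>k. M k * (m_fun n (M k) + 1) *
                     (\<Sum>i=2..n. (norm (lam k) + 1) ^ (i - 1) - norm (lam k) ^ (i - 1))) ` {1..n})
                   * mat_norm1 (the (mat_inverse (vandermonde n lam))) < 1"
  shows "\<exists>y z :: nat \<Rightarrow> real \<Rightarrow> complex.
      fundamental_system n a r y \<and>
      (\<forall>k\<in>{1..n}.
         let R = (\<lambda>s. Pr n r (lam k) s + L_op n r lam k s (z k)
                        + F_op n a r lam k s (jet (z k) s))
         in
           (\<forall>t. y k t =
              exp (lam k * complex_of_real t)
              * exp (- (\<Sum>j=1..n-1.
                   1 / (Gam n lam k j * gam lam k j) * G_op (gam lam k j) R t))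
              * exp ((-1) ^ n * (\<Prod>j\<in>{1..n} - {k}. inverse (lam j - lam k))
                   * (LBINT s=ereal 0..ereal t. R s))) \<and>
           AP_deriv (n - 2) (z k) \<and>
           times_differentiable (n - 1) (z k) \<and>
           (\<forall>t. D_op n a lam k (z k) t + R t = 0) \<and>
           (\<forall>t. z k t = - G_lam n lam k R t))"
proof -
  \<comment> \<open>One predicate holds all conclusions for a single root, so that \<open>y\<close>,
    \<open>z\<close> and \<beta> can be chosen simultaneously for all \<open>k\<close>.\<close>
  define A where "A k y z \<beta> \<longleftrightarrow> solution n a r y \<and> (\<forall>t. y t \<noteq> 0) \<and>
      (\<forall>i\<le>n. \<forall>t. nderiv i y t = y t * \<beta> i t) \<and>
      (\<forall>i<n. \<forall>t. norm (\<beta> i t - lam k ^ i) \<le> M k * (m_fun n (M k) + 1) * ((norm (lam k) + 1) ^ i - norm (lam k) ^ i)) \<and>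
      (let R = (\<lambda>s. Pr n r (lam k) s + L_op n r lam k s z + F_op n a r lam k s (jet z s))
         in
           (\<forall>t. y t =
              exp (lam k * complex_of_real t)
              * exp (- (\<Sum>j=1..n-1.
                   1 / (Gam n lam k j * gam lam k j) * G_op (gam lam k j) R t))
              * exp ((-1) ^ n * (\<Prod>j\<in>{1..n} - {k}. inverse (lam j - lam k))
                   * (LBINT s=ereal 0..ereal t. R s))) \<and>
           AP_deriv (n - 2) z \<and>
           times_differentiable (n - 1) z \<and>
           (\<forall>t. D_op n a lam k z t + R t = 0) \<and>
           (\<forall>t. z t = - G_lam n lam k R t))"
    for k and y z :: "real \<Rightarrow> complex" and \<beta> :: "nat \<Rightarrow> real \<Rightarrow> complex"
  have root: "poly (Ppoly n a) (lam i) = 0" if "i \<in> {1..n}" for i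
  proof -
    have "Ppoly n a \<noteq> 0" using coeff_Ppoly[of n a n] an by auto
    moreover have "lam i \<in># proots (Ppoly n a)" unfolding roots using that by simp
    ultimately show ?thesis by simp
  qed
  have "\<exists>y z \<beta>. A k y z \<beta>" if k: "k \<in> {1..n}" for k
  proof -
    interpret perturbed_root n a r lam k "M k"
      using n3 an rAP rn root Re_distinct k M_range H_le by unfold_locales auto
    show ?thesis unfolding A_def by (rule solution_exists) blast
  qed
  then obtain y z \<beta> where A: "\<forall>k\<in>{1..n}. A k (y k) (z k) (\<beta> k)" by metis
  have sol: "solution n a r (y k)" and nz: "y k t \<noteq> 0"
    and nd: "i \<le> n \<Longrightarrow> nderiv i (y k) t = y k t * \<beta> k i t"
    and \<beta>: "i < n \<Longrightarrow> norm (\<beta> k i t - lam k ^ i) \<le>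
      M k * (m_fun n (M k) + 1) * ((norm (lam k) + 1) ^ i - norm (lam k) ^ i)"
    if "k \<in> {1..n}" for k i t
    using bspec[OF A that] unfolding A_def by blast+
  have independent: "c k = 0" if zero: "\<forall>t. (\<Sum>k=1..n. c k * y k t) = 0" and k: "k \<in> {1..n}" for c k
  proof -
    \<comment> \<open>Differentiating the linear relation up to order \<open>n - 1\<close> gives one
      equation for each row of the Wronskian matrix.\<close>
    have derivs: "(\<Sum>k=1..n. c k * nderiv i (y k) t) = 0" if "i < n" for i t
      using that
    proof (induction i arbitrary: t)
      case 0
      then show ?case using zero by (simp add: nderiv_def)
    next
      case (Suc i)
      have "(nderiv i (y k) has_vector_derivative nderiv (Suc i) (y k) t) (at t)" if "k \<in> {1..n}" for k
        using sol[OF that] Suc.prems unfolding solution_def times_differentiable_def nderiv_def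
        by (simp add: vector_derivative_works)
      then have "((\<lambda>t. \<Sum>k=1..n. c k * nderiv i (y k) t) has_vector_derivative
          (\<Sum>k=1..n. c k * nderiv (Suc i) (y k) t)) (at t)"
        by (intro has_vector_derivative_sum has_vector_derivative_mult_right)
      moreover have "(\<lambda>t. \<Sum>k=1..n. c k * nderiv i (y k) t) = (\<lambda>t. 0)"
        using Suc by (intro ext) simp
      ultimately have "((\<lambda>t. 0 :: complex) has_vector_derivative (\<Sum>k=1..n. c k * nderiv (Suc i) (y k) t)) (at t)"
        by (simp only:)
      then show ?case by (rule vector_derivative_unique_at[OF _ has_vector_derivative_const])
    qed
    define h where "h k l = (norm (lam k) + 1) ^ l - norm (lam k) ^ l" for k l
    let ?E = "\<lambda>k. M k * (m_fun n (M k) + 1) * (\<Sum>i=2..n. h k (i - 1))"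
    \<comment> \<open>The nonzero values \<open>y k 0\<close> are factors of the Wronskian columns
      and go into the unknowns; what remains is the matrix with entries
      \<open>\<beta> k l 0\<close>.\<close>
    have "c k * y k 0 = 0"
    proof (rule perturbed_vandermonde[where \<beta> = "\<lambda>k l. \<beta> k l 0" and E = "Max (?E ` {1..n})" and p = "\<lambda>k. c k * y k 0"])
      show "inj_on lam {1..n}" using Re_distinct by (metis inj_onI)
      show "0 < n" using n3 by simp
      show "Max (?E ` {1..n}) * mat_norm1 (the (mat_inverse (vandermonde n lam))) < 1"
        using V_less unfolding h_def .
      show "(\<Sum>l<n. norm (\<beta> k l 0 - lam k ^ l)) \<le> Max (?E ` {1..n})" if k: "k \<in> {1..n}" for k
      proof -
        have "(\<Sum>l<n. norm (\<beta> k l 0 - lam k ^ l)) \<le> (\<Sum>l<n. M k * (m_fun n (M k) + 1) * h k l)"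
          unfolding h_def by (intro sum_mono \<beta>[OF k]) simp
        also have "\<dots> = M k * (m_fun n (M k) + 1) * (\<Sum>l<n. h k l)" by (simp only: sum_distrib_left)
        \<comment> \<open>\<open>h k 0\<close> is zero: the first row consists of ones in both
          matrices. This matches the hypothesis, where the sum starts with exponent
          \<open>1\<close>.\<close>
        also have "(\<Sum>l<n. h k l) = (\<Sum>l=1..n-1. h k l)"
          by (rule sum.mono_neutral_right) (use n3 in \<open>auto simp: h_def not_le\<close>)
        also have "\<dots> = (\<Sum>i=2..n. h k (i - 1))"
          by (rule sum.reindex_bij_witness[of _ "\<lambda>i. i - 1" Suc]) auto
        also have "M k * (m_fun n (M k) + 1) * \<dots> \<le> Max (?E ` {1..n})" using k by (intro Max_ge) auto
        finally show ?thesis .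
      qed
      show "(\<Sum>k=1..n. c k * y k 0 * \<beta> k l 0) = 0" if "l < n" for l
      proof -
        have "(\<Sum>k=1..n. c k * y k 0 * \<beta> k l 0) = (\<Sum>k=1..n. c k * nderiv l (y k) 0)"
          using that by (intro sum.cong) (auto simp: nd)
        then show ?thesis using derivs[OF that] by simp
      qed
    qed (rule k)
    then show ?thesis using nz[OF k] by simp
  qed
  show ?thesis
  proof (rule exI[of _ y], rule exI[of _ z], intro conjI)
    show "fundamental_system n a r y"
      unfolding fundamental_system_def using sol independent by blast
  qed (use A in \<open>unfold A_def, blast\<close>)
qed

end
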